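(* There exist constants $C_1, C_2 > 0$ such that for every $V \in L^1_{2\pi}$ with $V \ge 0$, $$ C_1 \|V\|_{L^1_{2\pi}} \le N_-(\mathbf{q}_V) \le C_2\, \|V\|_{\mathcal{B},[-\pi,\pi]} + 1 . $$
   Context: All functions are real valued. $L^p_{2\pi}$ is the space of $2\pi$-periodic functions on $\mathbb{R}$ that are locally $p$-th power summable, with $\|V\|_{L^1_{2\pi}}=\int_{-\pi}^\pi |V(t)|\,dt$; $C_{2\pi}$ is the space of continuous $2\pi$-periodic functions; $H^{1/2,2}_{2\pi}$ is the space of $u\in L^2_{2\pi}$ with $\sum_{n\in\mathbb{Z}}(1+|n|)|\hat u(n)|^2<\infty$, where $\hat u(n)=\frac1{2\pi}\int_{-\pi}^{\pi}u(t)e^{-int}dt$. The periodic Hilbert transform $\mathcal{C}$ is given by $\mathcal{C}u(t) = \frac{1}{2\pi}\int_{-\pi}^{\pi} u(s)\cot\frac{t-s}{2}\,ds$ (principal value), so $\widehat{\mathcal{C}u'}(n)=|n|\hat u(n)$. For $V\in L^1_{2\pi}$, $V\ge 0$, $$\mathbf{q}_V[u] := \int_{-\pi}^{\pi}\Big((\mathcal{C}u'(t))\,u(t) - V(t)u^2(t)\Big)dt, \quad u\in \mathrm{Dom}(\mathbf{q}_V) = H^{1/2,2}_{2\pi}\cap C_{2\pi},$$ where the first term is understood (by continuity) as $\int_{-\pi}^{\pi}(\mathcal{C}u')u\,dt = 2\pi\sum_{n\in\mathbb{Z}}|n||\hat u(n)|^2$. For a quadratic form $\mathbf{q}$ with domain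 $\mathrm{Dom}(\mathbf{q})$, $$N_-(\mathbf{q}) := \sup\{\dim\mathcal{L} : \mathcal{L} \text{ a linear subspace of } \mathrm{Dom}(\mathbf{q}),\ \mathbf{q}[u]<0 \ \ \forall u\in\mathcal{L}\setminus\{0\}\}.$$ Let $\mathcal{A}(s) = e^{|s|}-1-|s|$ and $\mathcal{B}(s)=(1+|s|)\ln(1+|s|)-|s|$, $s\in\mathbb{R}$ (a pair of mutually complementary $N$-functions). The Orlicz norm is $$\|f\|_{\mathcal{B},[-\pi,\pi]} := \sup\left\{\left|\int_{-\pi}^{\pi} f g\,dt\right| : \int_{-\pi}^{\pi}\mathcal{A}(g(t))\,dt\le 1\right\},$$ with value $+\infty$ if $f$ does not belong to the Orlicz space $L_{\mathcal{B}}([-\pi,\pi])$ (in that case the upper estimate is trivially true). *)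

theory Defs
  imports "HOL-Analysis.Analysis" "HOL-Library.Function_Algebras"
begin

section \<open>Function spaces on the circle\<close>

definition periodic_2pi :: "(real \<Rightarrow> real) \<Rightarrow> bool" where
  "periodic_2pi f \<longleftrightarrow> (\<forall>t. f (t + 2 * pi) = f t)"

text \<open>Elements are functions rather than classes modulo null sets; every class has
  representatives here, and nothing below depends on the choice of representative.\<close>

definition Lp_2pi :: "real \<Rightarrow> (real \<Rightarrow> real) set" where
  "Lp_2pi p = {f. periodic_2pi f \<and> f \<in> borel_measurable lebesgue \<and>
     (\<forall>a b. set_integrable lebesgue {a..b} (\<lambda>t. \<bar>f t\<bar> powr p))}"

definition L1_norm_2pi :: "(real \<Rightarrow> real) \<Rightarrow> real" where
  "L1_norm_2pi f = (LINT t|lebesgue_on {-pi..pi}. \<bar>f t\<bar>)"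

definition C_2pi :: "(real \<Rightarrow> real) set" where
  "C_2pi = {u. periodic_2pi u \<and> continuous_on UNIV u}"

definition fourier_coeff :: "(real \<Rightarrow> real) \<Rightarrow> int \<Rightarrow> complex" where
  "fourier_coeff u n =
     1 / (2 * of_real pi) *
     (LINT t|lebesgue_on {-pi..pi}. of_real (u t) * exp (- (\<i> * of_int n * of_real t)))"

definition H_half_2pi :: "(real \<Rightarrow> real) set" where
  "H_half_2pi = {u \<in> Lp_2pi 2.
     (\<lambda>n. (1 + \<bar>real_of_int n\<bar>) * (norm (fourier_coeff u n))\<^sup>2) summable_on UNIV}"


section \<open>Quadratic forms on spaces of real functions\<close>

definition fun_scale :: "real \<Rightarrow> ('a \<Rightarrow> real) \<Rightarrow> 'a \<Rightarrow> real" where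
  "fun_scale c f = (\<lambda>x. c * f x)"

global_interpretation fun_space: vector_space "fun_scale :: real \<Rightarrow> ('a \<Rightarrow> real) \<Rightarrow> _"
  by unfold_locales (auto simp: fun_scale_def fun_eq_iff algebra_simps)

text \<open>The library's \<open>dim\<close> is a natural number, and is 0 on infinite-dimensional subspaces.\<close>

definition ext_dim :: "('a \<Rightarrow> real) set \<Rightarrow> enat" where
  "ext_dim L = (if \<exists>B. finite B \<and> L \<subseteq> fun_space.span B then enat (fun_space.dim L) else \<infinity>)"

definition N_minus :: "('a \<Rightarrow> real) set \<Rightarrow> (('a \<Rightarrow> real) \<Rightarrow> real) \<Rightarrow> enat" where
  "N_minus D q = (SUP L \<in> {L. fun_space.subspace L \<and> L \<subseteq> D \<and> (\<forall>u \<in> L - {0}. q u < 0)}. ext_dim L)"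

definition Dom_qform :: "(real \<Rightarrow> real) set" where
  "Dom_qform = H_half_2pi \<inter> C_2pi"

text \<open>Writing \<open>C\<close> for the periodic Hilbert transform, the Fourier coefficients of \<open>C u'\<close> are
  \<open>\<bar>n\<bar>\<close> times those of \<open>u\<close>. The first term is the integral of \<open>(C u') u\<close> over a period,
  extended by continuity (Parseval) to all of \<open>H_half_2pi\<close>.\<close>

definition qform :: "(real \<Rightarrow> real) \<Rightarrow> (real \<Rightarrow> real) \<Rightarrow> real" where
  "qform V u =
     2 * pi * (\<Sum>\<^sub>\<infinity>n\<in>UNIV. \<bar>real_of_int n\<bar> * (norm (fourier_coeff u n))\<^sup>2)
     - (LINT t|lebesgue_on {-pi..pi}. V t * (u t)\<^sup>2)"


section \<open>Orlicz spaces\<close>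

definition A_fun :: "real \<Rightarrow> real" where
  "A_fun s = exp \<bar>s\<bar> - 1 - \<bar>s\<bar>"

definition B_fun :: "real \<Rightarrow> real" where
  "B_fun s = (1 + \<bar>s\<bar>) * ln (1 + \<bar>s\<bar>) - \<bar>s\<bar>"

definition orlicz_space :: "'a measure \<Rightarrow> (real \<Rightarrow> real) \<Rightarrow> ('a \<Rightarrow> real) set" where
  "orlicz_space M \<Psi> = {f \<in> borel_measurable M. \<exists>\<kappa>>0. integrable M (\<lambda>t. \<Psi> (f t / \<kappa>))}"

text \<open>The Orlicz norm on the space of \<open>\<Psi>\<close>, where \<open>\<Phi>\<close> is the complementary N-function.
  The constraint on \<open>g\<close> uses the nonnegative integral, so that it fails when \<open>\<Phi> \<circ> g\<close> is not
  integrable. For \<open>f\<close> in the Orlicz space every product \<open>f g\<close> below is integrable.\<close>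

definition orlicz_norm ::
    "'a measure \<Rightarrow> (real \<Rightarrow> real) \<Rightarrow> (real \<Rightarrow> real) \<Rightarrow> ('a \<Rightarrow> real) \<Rightarrow> ereal" where
  "orlicz_norm M \<Phi> \<Psi> f =
     (if f \<in> orlicz_space M \<Psi>
      then SUP g \<in> {g \<in> borel_measurable M. (\<integral>\<^sup>+ t. ennreal (\<Phi> (g t)) \<partial>M) \<le> 1}.
             ereal \<bar>LINT t|M. f t * g t\<bar>
      else \<infinity>)"

definition norm_B :: "(real \<Rightarrow> real) \<Rightarrow> ereal" where
  "norm_B f = orlicz_norm (lebesgue_on {-pi..pi}) A_fun B_fun f"

end

theory Submission
  imports Defs
begin

text \<open>
  Let \<open>E u\<close> be the first term of the form, \<open>2 * pi\<close> times the sum of \<open>\<bar>n\<bar> * \<bar>c n\<bar>\<^sup>2\<close> over the Fourier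
  coefficients \<open>c n\<close> of \<open>u\<close>. It is comparable with the double integral of
  \<open>(u x - u y)\<^sup>2 / (x - y)\<^sup>2\<close>, and thus it does not change when \<open>u\<close> is rescaled. Both bounds live on this
  scale invariance.

  Lower bound. A cutoff that is 1 on an arc and 0 off the arc of twice the radius has an energy below
  an absolute constant, whatever the radius. Functions of disjoint supports are not orthogonal for
  the nonlocal form \<open>E\<close>, but their sum has at most twice the sum of their energies
  (\<open>dyadic_energy_disjoint\<close>). So it suffices to find a number, of the order of the norm of \<open>V\<close>, of functions
  with disjoint supports and bounded energies, each equal to 1 on a set of large \<open>V\<close>-mass
  (\<open>N_minus_ge_of_disjoint\<close>). Cutting the circle into intervals of equal mass does not do, since
  neighbouring intervals may have very different lengths, and then a cutoff between them is
  expensive. Instead, arcs are chosen greedily (\<open>greedy_arcs\<close>): at every step, an arc of nearly minimal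
  radius among those that carry a fixed mass \<open>h\<close> outside the enlargements of the earlier arcs. By
  minimality each enlargement costs only a multiple of \<open>h\<close>, so that the number of steps is of the
  right order. The cutoff of an arc has to vanish near the earlier arcs in its way, and each of these
  adds to its energy. But an arc gets in the way only of the first later arc that it meets, so that
  on average a cutoff avoids at most one earlier arc (\<open>many_light_arcs\<close>). A potential of small norm is
  taken care of by the constant functions.

  Upper bound. The Orlicz norm of \<open>V\<close> over an interval, averaged suitably, is superadditive. Hence
  the circle splits into at most \<open>C * norm_B V + 1\<close> intervals on each of which it is at most a small
  \<open>\<delta>\<close> (\<open>mass_between_cuts\<close>). The functions with mean zero on every one of these intervals form a space
  whose codimension is at most the number of the intervals, and the form is nonnegative there; this
  bounds the dimension of a negative subspace (\<open>N_minus_le\<close>). Nonnegativity reduces to a single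
  interval: for \<open>u\<close> of mean zero, the integral of \<open>V * u\<^sup>2\<close> is at most a multiple of \<open>\<delta>\<close> times the double
  integral over the interval. By the duality that defines the Orlicz norm, this follows from the
  exponential integrability of \<open>u\<^sup>2\<close> (\<open>trudinger_interval\<close>). Here the means of \<open>u\<close> over dyadic
  subintervals form a martingale, and the squares of its increments, which are differences of means
  over two halves of an interval, add up to at most the double integral; such a martingale is
  subgaussian. Finally the double integrals over disjoint intervals add up to at most the one over
  the circle, which Parseval's identity bounds by a multiple of \<open>E u\<close> (\<open>gagliardo_le_energy\<close>).
\<close>

section \<open>Fourier coefficients of continuous periodic functions\<close>

lemma C_2pi_continuous: "u \<in> C_2pi \<Longrightarrow> continuous_on S u"
  unfolding C_2pi_def using continuous_on_subset by blast

lemma C_2pi_continuous_compose: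
  "u \<in> C_2pi \<Longrightarrow> continuous_on S g \<Longrightarrow> continuous_on S (\<lambda>x. u (g x))"
  using continuous_on_compose2[of UNIV u S g] unfolding C_2pi_def by auto

lemma LINT_eq_integral_continuous:
  fixes f :: "real \<Rightarrow> 'a::euclidean_space"
  assumes "continuous_on {a..b} f"
  shows "(LINT t|lebesgue_on {a..b}. f t) = integral {a..b} f"
  by (rule lebesgue_integral_eq_integral) (use assms continuous_imp_integrable_real in auto)

lemma periodic_int_shift:
  fixes f :: "real \<Rightarrow> 'a"
  assumes "\<And>t. f (t + 2 * pi) = f t"
  shows "f (t + 2 * pi * of_int k) = f t"
proof (induction k arbitrary: t rule: int_induct[where k = 0])
  case (step1 i) 
  have "f (t + 2 * pi * of_int (i + 1)) = f ((t + 2 * pi * of_int i) + 2 * pi)"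
    by (simp add: algebra_simps)
  with step1 show ?case using assms by simp
next
  case (step2 i) 
  have "f (t + 2 * pi * of_int i) = f ((t + 2 * pi * of_int (i - 1)) + 2 * pi)"
    by (simp add: algebra_simps)
  with step2 show ?case using assms by simp
qed simp

lemma integral_period_shift:
  fixes f :: "real \<Rightarrow> 'a::euclidean_space"
  assumes cont: "continuous_on UNIV f" and per: "\<And>t. f (t + 2 * pi) = f t"
  shows "integral {-pi..pi} (\<lambda>t. f (t + h)) = integral {-pi..pi} f"
proof -
  \<comment> \<open>The shift is reduced to one by \<open>g\<close> in \<open>[0, 2 * pi]\<close>; then the part beyond \<open>pi\<close> is moved back by a period.\<close>
  define k where "k = \<lfloor>h / (2 * pi)\<rfloor>"
  define g where "g = h - 2 * pi * of_int k"
  have "of_int k \<le> h / (2 * pi)" "h / (2 * pi) < of_int k + 1"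
    unfolding k_def by linarith+
  then have g: "0 \<le> g" "g \<le> 2 * pi"
    unfolding g_def by (auto simp: field_simps)
  have int: "f integrable_on {a..b}" for a b :: real
    by (intro integrable_continuous_interval continuous_on_subset[OF cont]) auto
  have shift: "integral {a..b} (\<lambda>t. f (t + c)) = integral {a + c..b + c} f" for a b c :: real
    using integral_shift_Icc_real[of a b f c] by (simp add: o_def add.commute)
  have "(\<lambda>t. f (t + h)) = (\<lambda>t. f (t + g))"
  proof
    fix t
    show "f (t + h) = f (t + g)"
      using periodic_int_shift[of f "t + g" k, OF per] by (simp add: g_def algebra_simps)
  qed
  then have "integral {-pi..pi} (\<lambda>t. f (t + h)) = integral {-pi + g..pi + g} f"
    by (simp add: shift)
  also have "\<dots> = integral {-pi + g..pi} f + integral {pi..pi + g} f"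
    using Henstock_Kurzweil_Integration.integral_combine[where a = "-pi + g" and c = pi and b = "pi + g" and f = f] g int by simp
  also have "integral {pi..pi + g} f = integral {-pi..-pi + g} (\<lambda>t. f (t + 2 * pi))"
    by (subst shift) (simp add: algebra_simps)
  also have "\<dots> = integral {-pi..-pi + g} f"
    using per by simp
  also have "integral {-pi + g..pi} f + integral {-pi..-pi + g} f = integral {-pi..pi} f"
    using Henstock_Kurzweil_Integration.integral_combine[where a = "-pi" and c = "-pi + g" and b = pi and f = f] g int
    by (simp add: add.commute)
  finally show ?thesis .
qed

lemma fourier_coeff_has_integral:
  assumes "continuous_on {-pi..pi} u"
  shows "((\<lambda>t. of_real (u t) * cis (- (of_int n * t))) has_integral
     of_real (2 * pi) * fourier_coeff u n) {-pi..pi}"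
proof -
  have eq: "exp (- (\<i> * of_int n * of_real t)) = cis (- (of_int n * t))" for t :: real
    by (simp add: cis_conv_exp algebra_simps)
  have cont: "continuous_on {-pi..pi} (\<lambda>t. of_real (u t) * cis (- (of_int n * t)))"
    by (intro continuous_intros assms)
  have "of_real (2 * pi) * fourier_coeff u n =
      integral {-pi..pi} (\<lambda>t. of_real (u t) * cis (- (of_int n * t)))"
    unfolding fourier_coeff_def eq LINT_eq_integral_continuous[OF cont] by simp
  then show ?thesis
    using integrable_integral[OF integrable_continuous_interval[OF cont]] by simp
qed

lemma fourier_coeff_has_integral_cnj:
  assumes "continuous_on {-pi..pi} u"
  shows "((\<lambda>t. of_real (u t) * cis (of_int n * t)) has_integral
     of_real (2 * pi) * cnj (fourier_coeff u n)) {-pi..pi}"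
  using has_integral_linear[OF fourier_coeff_has_integral[OF assms] bounded_linear_cnj]
  by (simp add: o_def cis_cnj)

lemma cis_has_integral:
  "((\<lambda>t. cis (of_int k * t)) has_integral (if k = 0 then of_real (2 * pi) else 0)) {-pi..pi}"
proof (cases "k = 0")
  case True
  then show ?thesis
    using has_integral_const_real[of "1::complex" "-pi" pi] by (simp add: scaleR_conv_of_real)
next
  case False
  let ?F = "\<lambda>t. cis (of_int k * t) / (\<i> * of_int k)"
  have "((\<lambda>t. cis (of_int k * t)) has_integral (?F pi - ?F (-pi))) {-pi..pi}"
  proof (rule fundamental_theorem_of_calculus)
    fix x :: real
    have "((\<lambda>z. exp (\<i> * of_int k * z) / (\<i> * of_int k)) has_field_derivative
        exp (\<i> * of_int k * of_real x)) (at (of_real x))"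
      using False by (auto intro!: derivative_eq_intros)
    from has_vector_derivative_real_field[OF this]
    show "(?F has_vector_derivative cis (of_int k * x)) (at x within {-pi..pi})"
      by (simp add: cis_conv_exp algebra_simps)
  qed auto
  moreover have "cis (of_int k * pi) = cis (- (of_int k * pi))"
    using sin_npi_int[of k] by (simp add: complex_eq_iff mult.commute)
  ultimately show ?thesis using False by simp
qed

text \<open>The square of the distance to an arbitrary trigonometric polynomial splits off the square
  of the distance of the coefficients. Bessel's inequality and the best approximation property of
  Fourier sums are the two special uses.\<close>

lemma integral_norm2_diff_trig_poly:
  fixes b :: "int \<Rightarrow> complex"
  assumes cont: "continuous_on {-pi..pi} u" and F: "finite F"
  shows "((\<lambda>t. (norm (of_real (u t) - (\<Sum>n\<in>F. b n * cis (of_int n * t))))\<^sup>2) has_integral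
    integral {-pi..pi} (\<lambda>t. (u t)\<^sup>2) - 2 * pi * (\<Sum>n\<in>F. (norm (fourier_coeff u n))\<^sup>2)
      + 2 * pi * (\<Sum>n\<in>F. (norm (fourier_coeff u n - b n))\<^sup>2)) {-pi..pi}"
proof -
  define c where "c = fourier_coeff u"
  define U where "U = integral {-pi..pi} (\<lambda>t. (u t)\<^sup>2)"
  have "continuous_on {-pi..pi} (\<lambda>t. (u t)\<^sup>2)" by (intro continuous_intros cont)
  then have "((\<lambda>t. (u t)\<^sup>2) has_integral U) {-pi..pi}"
    unfolding U_def by (intro integrable_integral integrable_continuous_interval)
  from has_integral_linear[OF this bounded_linear_of_real]
  have hU: "((\<lambda>t. of_real ((u t)\<^sup>2) :: complex) has_integral of_real U) {-pi..pi}"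
    by (simp add: o_def)
  have total: "((\<lambda>t. of_real ((u t)\<^sup>2)
      - (\<Sum>n\<in>F. cnj (b n) * (of_real (u t) * cis (- (of_int n * t))))
      - (\<Sum>n\<in>F. b n * (of_real (u t) * cis (of_int n * t)))
      + (\<Sum>n\<in>F. \<Sum>m\<in>F. (b n * cnj (b m)) * cis (of_int (n - m) * t)))
    has_integral (of_real U
      - (\<Sum>n\<in>F. cnj (b n) * (of_real (2 * pi) * c n))
      - (\<Sum>n\<in>F. b n * (of_real (2 * pi) * cnj (c n)))
      + (\<Sum>n\<in>F. \<Sum>m\<in>F. (b n * cnj (b m)) * (if n - m = 0 then of_real (2 * pi) else 0)))) {-pi..pi}"
    unfolding c_def
    by (intro has_integral_add has_integral_diff has_integral_sum F has_integral_mult_right hU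
        fourier_coeff_has_integral fourier_coeff_has_integral_cnj cont cis_has_integral)
  have pt: "Re (of_real ((u t)\<^sup>2)
      - (\<Sum>n\<in>F. cnj (b n) * (of_real (u t) * cis (- (of_int n * t))))
      - (\<Sum>n\<in>F. b n * (of_real (u t) * cis (of_int n * t)))
      + (\<Sum>n\<in>F. \<Sum>m\<in>F. (b n * cnj (b m)) * cis (of_int (n - m) * t)))
    = (norm (of_real (u t) - (\<Sum>n\<in>F. b n * cis (of_int n * t))))\<^sup>2" (is "Re ?L = (norm ?w)\<^sup>2") for t
  proof -
    let ?p = "\<Sum>n\<in>F. b n * cis (of_int n * t)"
    have 1: "(\<Sum>n\<in>F. cnj (b n) * (of_real (u t) * cis (- (of_int n * t)))) = of_real (u t) * cnj ?p"
      by (simp add: sum_distrib_left cis_cnj mult_ac)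
    have 2: "(\<Sum>n\<in>F. b n * (of_real (u t) * cis (of_int n * t))) = of_real (u t) * ?p"
      by (simp add: sum_distrib_left mult_ac)
    have 3: "(\<Sum>n\<in>F. \<Sum>m\<in>F. (b n * cnj (b m)) * cis (of_int (n - m) * t)) = ?p * cnj ?p"
      by (simp add: sum_product cis_cnj cis_mult algebra_simps)
    have "?L = ?w * cnj ?w"
      unfolding 1 2 3 by (simp add: algebra_simps power2_eq_square)
    also have "\<dots> = of_real ((norm ?w)\<^sup>2)"
      by (rule complex_norm_square[symmetric])
    finally show ?thesis by simp
  qed
  have val: "of_real U
      - (\<Sum>n\<in>F. cnj (b n) * (of_real (2 * pi) * c n))
      - (\<Sum>n\<in>F. b n * (of_real (2 * pi) * cnj (c n)))
      + (\<Sum>n\<in>F. \<Sum>m\<in>F. (b n * cnj (b m)) * (if n - m = 0 then of_real (2 * pi) else 0))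
     = of_real (U - 2 * pi * (\<Sum>n\<in>F. (norm (c n))\<^sup>2) + 2 * pi * (\<Sum>n\<in>F. (norm (c n - b n))\<^sup>2))"
  proof -
    have d: "(\<Sum>m\<in>F. (b n * cnj (b m)) * (if n - m = 0 then of_real (2 * pi) else 0))
        = of_real (2 * pi) * (b n * cnj (b n))" if "n \<in> F" for n
    proof -
      have "(\<Sum>m\<in>F. (b n * cnj (b m)) * (if n - m = 0 then of_real (2 * pi) else 0))
        = (\<Sum>m\<in>F. if m = n then of_real (2 * pi) * (b n * cnj (b n)) else 0)"
        by (rule sum.cong) auto
      then show ?thesis using that F by simp
    qed
    have "(\<Sum>n\<in>F. \<Sum>m\<in>F. (b n * cnj (b m)) * (if n - m = 0 then of_real (2 * pi) else 0))
      = (\<Sum>n\<in>F. of_real (2 * pi) * (b n * cnj (b n)))"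
      by (rule sum.cong) (use d in auto)
    moreover have regroup: "W - K * X - K * Y + K * Z = W - K * S + K * (S - X - Y + Z)"
      for W K X Y Z S :: complex
      by (simp add: algebra_simps)
    moreover have sq: "complex_of_real (\<Sum>n\<in>F. (norm (f n))\<^sup>2) = (\<Sum>n\<in>F. f n * cnj (f n))" for f
      by (simp only: of_real_sum complex_norm_square)
    moreover have "(\<Sum>n\<in>F. (c n - b n) * cnj (c n - b n)) = (\<Sum>n\<in>F. c n * cnj (c n))
        - (\<Sum>n\<in>F. cnj (b n) * c n) - (\<Sum>n\<in>F. b n * cnj (c n)) + (\<Sum>n\<in>F. b n * cnj (b n))"
      by (simp only: sum.distrib[symmetric] sum_subtractf[symmetric]) (simp add: algebra_simps)
    moreover have "(\<Sum>n\<in>F. f n * (of_real (2 * pi) * g n)) = of_real (2 * pi) * (\<Sum>n\<in>F. f n * g n)"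
      for f g :: "int \<Rightarrow> complex"
      by (simp only: sum_distrib_left mult.left_commute)
    ultimately show ?thesis
      unfolding of_real_add of_real_diff of_real_mult[of _ "sum _ _"] sq
      by (simp only: sum_distrib_left[symmetric])
  qed
  from has_integral_linear[OF total bounded_linear_Re]
  show ?thesis
    unfolding val c_def[symmetric] U_def[symmetric] by (simp only: o_def pt Re_complex_of_real)
qed

lemma fourier_bessel:
  assumes cont: "continuous_on {-pi..pi} u" and F: "finite F"
  shows "2 * pi * (\<Sum>n\<in>F. (norm (fourier_coeff u n))\<^sup>2) \<le> integral {-pi..pi} (\<lambda>t. (u t)\<^sup>2)"
  using has_integral_nonneg[OF integral_norm2_diff_trig_poly[OF assms, of "fourier_coeff u"]]
  by simp

lemma fourier_coeff_shift_diff: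
  assumes u: "u \<in> C_2pi"
  shows "fourier_coeff (\<lambda>t. u (t + h) - u t) n = (cis (of_int n * h) - 1) * fourier_coeff u n"
proof -
  let ?f = "\<lambda>t. of_real (u t) * cis (- (of_int n * t))"
  have c: "continuous_on {-pi..pi} (\<lambda>t. u (t + h))"
    by (intro C_2pi_continuous_compose[OF u] continuous_intros)
  have f: "integral {-pi..pi} ?f = of_real (2 * pi) * fourier_coeff u n"
    by (intro integral_unique fourier_coeff_has_integral C_2pi_continuous[OF u])
  have cf: "continuous_on UNIV ?f"
    by (intro continuous_intros C_2pi_continuous[OF u])
  have "cis (- (of_int n * (t + 2 * pi))) = cis (- (of_int n * t))" for t
  proof -
    have "cis (- (of_int n * (t + 2 * pi))) = cis (- (of_int n * t)) * cis (2 * pi * of_int (- n))"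
      by (simp add: cis_mult algebra_simps)
    then show ?thesis using cis_multiple_2pi[of "of_int (- n)"] by simp
  qed
  then have pf: "?f (t + 2 * pi) = ?f t" for t
    using u by (simp add: C_2pi_def periodic_2pi_def)
  have "continuous_on {-pi..pi} (\<lambda>t. ?f (t + h))"
    by (intro continuous_intros C_2pi_continuous_compose[OF u])
  from integrable_integral[OF integrable_continuous_interval[OF this]]
  have "((\<lambda>t. ?f (t + h)) has_integral of_real (2 * pi) * fourier_coeff u n) {-pi..pi}"
    unfolding integral_period_shift[OF cf pf] f .
  from has_integral_diff[OF has_integral_mult_right[OF this, of "cis (of_int n * h)"]
      fourier_coeff_has_integral[OF C_2pi_continuous[OF u], of n]]
  have "((\<lambda>t. cis (of_int n * h) * ?f (t + h) - ?f t) has_integral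
     of_real (2 * pi) * ((cis (of_int n * h) - 1) * fourier_coeff u n)) {-pi..pi}"
    by (simp only: left_diff_distrib right_diff_distrib mult.left_commute mult_1)
  moreover have "cis (of_int n * h) * ?f (t + h) - ?f t
      = of_real (u (t + h) - u t) * cis (- (of_int n * t))" for t
  proof -
    have "cis (of_int n * h) * cis (- (of_int n * (t + h))) = cis (- (of_int n * t))"
      unfolding cis_mult by (rule arg_cong[of _ _ cis]) (simp add: distrib_left)
    then show ?thesis
      unfolding mult.left_commute[of "cis (of_int n * h)" "of_real (u (t + h))"]
        of_real_diff left_diff_distrib by (simp only:)
  qed
  ultimately have "((\<lambda>t. of_real (u (t + h) - u t) * cis (- (of_int n * t))) has_integral
     of_real (2 * pi) * ((cis (of_int n * h) - 1) * fourier_coeff u n)) {-pi..pi}"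
    by (simp only:)
  moreover have "((\<lambda>t. of_real (u (t + h) - u t) * cis (- (of_int n * t))) has_integral
     of_real (2 * pi) * fourier_coeff (\<lambda>t. u (t + h) - u t) n) {-pi..pi}"
    by (intro fourier_coeff_has_integral continuous_intros c C_2pi_continuous[OF u])
  ultimately have "of_real (2 * pi) * ((cis (of_int n * h) - 1) * fourier_coeff u n)
      = of_real (2 * pi) * fourier_coeff (\<lambda>t. u (t + h) - u t) n"
    by (rule has_integral_unique)
  then show ?thesis by simp
qed

subsection \<open>Completeness of the trigonometric system\<close>

definition trig_poly :: "(real \<Rightarrow> complex) \<Rightarrow> bool" where
  "trig_poly f \<longleftrightarrow> (\<exists>N::nat. \<exists>b. \<forall>t. f t = (\<Sum>n\<in>{-int N..int N}. b n * cis (of_int n * t)))"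

lemma trig_poly_monomial: "trig_poly (\<lambda>t. c * cis (of_int k * t))"
  unfolding trig_poly_def
proof (intro exI allI)
  fix t
  show "c * cis (of_int k * t) =
     (\<Sum>n\<in>{-int (nat \<bar>k\<bar>)..int (nat \<bar>k\<bar>)}. (if n = k then c else 0) * cis (of_int n * t))"
    by (subst sum.cong[OF refl, of _ _ "\<lambda>n. if n = k then c * cis (of_int n * t) else 0"]) auto
qed

lemma trig_poly_add:
  assumes "trig_poly f" "trig_poly g"
  shows "trig_poly (\<lambda>t. f t + g t)"
proof -
  obtain N b where f: "\<And>t. f t = (\<Sum>n\<in>{-int N..int N}. b n * cis (of_int n * t))"
    using assms(1) unfolding trig_poly_def by blast
  obtain M c where g: "\<And>t. g t = (\<Sum>n\<in>{-int M..int M}. c n * cis (of_int n * t))"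
    using assms(2) unfolding trig_poly_def by blast
  let ?K = "{-int (N + M)..int (N + M)}"
  have ext: "(\<Sum>n\<in>{-int L..int L}. a n * cis (of_int n * t))
      = (\<Sum>n\<in>?K. (if n \<in> {-int L..int L} then a n else 0) * cis (of_int n * t))"
    if "L \<le> N + M" for L a t
    by (rule sum.mono_neutral_cong_left) (use that in auto)
  let ?b = "\<lambda>n. if n \<in> {-int N..int N} then b n else 0"
  let ?c = "\<lambda>n. if n \<in> {-int M..int M} then c n else 0"
  have "f t + g t = (\<Sum>n\<in>?K. (?b n + ?c n) * cis (of_int n * t))" for t
    unfolding f g ext[OF le_add1, of b] ext[OF le_add2, of c] distrib_right sum.distrib ..
  then show ?thesis
    unfolding trig_poly_def by (intro exI[of _ "N + M"] exI[of _ "\<lambda>n. ?b n + ?c n"]) blast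
qed

lemma trig_poly_sum:
  assumes "finite F" "\<And>i. i \<in> F \<Longrightarrow> trig_poly (f i)"
  shows "trig_poly (\<lambda>t. \<Sum>i\<in>F. f i t)"
  using assms
proof (induction rule: finite_induct)
  case empty
  show ?case using trig_poly_monomial[of 0] by simp
next
  case (insert x F)
  then show ?case using trig_poly_add[of "f x" "\<lambda>t. \<Sum>i\<in>F. f i t"] by simp
qed

lemma trig_poly_mult:
  assumes "trig_poly f" "trig_poly g"
  shows "trig_poly (\<lambda>t. f t * g t)"
proof -
  obtain N b where f: "\<And>t. f t = (\<Sum>n\<in>{-int N..int N}. b n * cis (of_int n * t))"
    using assms(1) unfolding trig_poly_def by blast
  obtain M c where g: "\<And>t. g t = (\<Sum>n\<in>{-int M..int M}. c n * cis (of_int n * t))"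
    using assms(2) unfolding trig_poly_def by blast
  have "f t * g t = (\<Sum>n\<in>{-int N..int N}. \<Sum>m\<in>{-int M..int M}. (b n * c m) * cis (of_int (n + m) * t))"
    for t
    unfolding f g sum_product of_int_add distrib_right cis_mult[symmetric]
    by (intro sum.cong refl) (simp only: mult_ac)
  moreover have "trig_poly (\<lambda>t. \<Sum>n\<in>{-int N..int N}. \<Sum>m\<in>{-int M..int M}. (b n * c m) * cis (of_int (n + m) * t))"
    by (intro trig_poly_sum trig_poly_monomial) auto
  ultimately show ?thesis by presburger
qed

lemma trig_poly_of_real_polynomial:
  assumes "real_polynomial_function p"
  shows "trig_poly (\<lambda>t. of_real (p (cis t)))"
  using assms
proof (induction rule: real_polynomial_function.induct)
  case (linear f)
  interpret f: bounded_linear f by fact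
  let ?a = "of_real (f 1) / 2 - \<i> * of_real (f \<i>) / 2" and ?b = "of_real (f 1) / 2 + \<i> * of_real (f \<i>) / 2"
  have "of_real (f (cis t)) = ?a * cis (of_int 1 * t) + ?b * cis (of_int (-1) * t)" for t
  proof -
    have "cis t = cos t *\<^sub>R 1 + sin t *\<^sub>R \<i>" by (simp add: complex_eq_iff)
    then have "f (cis t) = cos t * f 1 + sin t * f \<i>" 
      by (simp only: f.add f.scaleR real_scaleR_def)
    then show ?thesis by (simp add: complex_eq_iff field_simps)
  qed
  then show ?case using trig_poly_add[OF trig_poly_monomial[of ?a 1] trig_poly_monomial[of ?b "-1"]]
    by simp
next
  case (const c)
  show ?case using trig_poly_monomial[of "of_real c" 0] by simp
next
  case (add f g)
  then show ?case using trig_poly_add by fastforce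
next
  case (mult f g)
  then show ?case using trig_poly_mult by fastforce
qed

text \<open>A function on the circle. The angle jumps at 1, so the two closed half circles are treated
  separately, the lower one by means of the angle of the conjugate.\<close>

lemma continuous_on_compose_Arg2pi:
  assumes u: "u \<in> C_2pi"
  shows "continuous_on (sphere 0 1) (\<lambda>z. u (Arg2pi z))"
proof -
  have Arg_cnj: "u (Arg2pi z) = u (- Arg2pi (cnj z))" if "cmod z = 1" for z
  proof (cases "Arg2pi z = 0")
    case True
    then have "Arg2pi (cnj z) = 0"
      by (simp add: Arg2pi_cnj) (metis Arg2pi_eq_0)
    then show ?thesis using True by simp
  next
    case False
    have "u (t + 2 * pi) = u t" for t
      using u by (simp add: C_2pi_def periodic_2pi_def)
    from this[of "- pi"] this[of "Arg2pi z - 2 * pi"] show ?thesis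
      using False by (auto simp: Arg2pi_cnj Arg2pi_real split: if_splits)
  qed
  let ?j = "\<lambda>z. if 0 \<le> Im z then u (Arg2pi z) else u (- Arg2pi (cnj z))"
  have j: "?j z = u (Arg2pi z)" if "z \<in> sphere 0 1" for z
    using Arg_cnj[of z] that by simp
  have 1: "continuous_on (sphere 0 1 \<inter> {z. 0 \<le> Im z}) (\<lambda>z. u (Arg2pi z))"
    by (intro C_2pi_continuous_compose[OF u] continuous_on_subset[OF continuous_on_upperhalf_Arg2pi]) auto
  have 2: "continuous_on (sphere 0 1 \<inter> {z. Im z \<le> 0}) (\<lambda>z. u (- Arg2pi (cnj z)))"
    by (intro C_2pi_continuous_compose[OF u] continuous_intros
        continuous_on_compose2[OF continuous_on_upperhalf_Arg2pi]) auto
  have eq: "sphere 0 1 = (sphere 0 1 \<inter> {z. 0 \<le> Im z}) \<union> (sphere 0 1 \<inter> {z. Im z \<le> (0::real)})"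
    by auto
  have "continuous_on (sphere 0 1) ?j"
    by (subst eq, rule continuous_on_cases_local)
      (use 1 2 j Arg_cnj in \<open>auto simp: eq[symmetric] closedin_closed_Int closed_halfspace_Im_le closed_halfspace_Im_ge\<close>)
  then show ?thesis
    using j by (rule continuous_on_eq)
qed

text \<open>On the unit circle, a real polynomial in the two coordinates is a trigonometric polynomial of the
  angle, so that this is the theorem of Stone and Weierstrass.\<close>

lemma trig_poly_dense:
  assumes u: "u \<in> C_2pi" and e: "e > 0"
  obtains f where "trig_poly f" "\<And>t. norm (of_real (u t) - f t) < e"
proof -
  obtain p where p: "real_polynomial_function p" "\<And>z. z \<in> sphere 0 1 \<Longrightarrow> \<bar>u (Arg2pi z) - p z\<bar> < e"
    using Stone_Weierstrass_real_polynomial_function[OF compact_sphere continuous_on_compose_Arg2pi[OF u] e]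
    by blast
  have per: "u (t + 2 * pi) = u t" for t
    using u by (simp add: C_2pi_def periodic_2pi_def)
  have "u (Arg2pi (cis t)) = u t" for t
  proof -
    have "cis (Arg2pi (cis t)) = cis t"
      using Arg2pi_eq[of "cis t"] by (simp add: cis_conv_exp)
    then have "exp (\<i> * of_real (Arg2pi (cis t))) = exp (\<i> * of_real t)"
      by (simp add: cis_conv_exp)
    then obtain n :: int where "\<i> * of_real (Arg2pi (cis t)) = \<i> * of_real t + of_real (of_int (2 * n) * pi) * \<i>"
      unfolding exp_eq by blast
    then have "Im (\<i> * of_real (Arg2pi (cis t))) = Im (\<i> * of_real t + of_real (of_int (2 * n) * pi) * \<i>)"
      by simp
    then have "Arg2pi (cis t) = t + 2 * pi * of_int n" by simp
    then show ?thesis using periodic_int_shift[of u t n, OF per] by simp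
  qed
  then have "norm (of_real (u t) - complex_of_real (p (cis t))) < e" for t
    using p(2)[of "cis t"] by (simp add: norm_of_real flip: of_real_diff)
  then show ?thesis
    using that[OF trig_poly_of_real_polynomial[OF p(1)]] by blast
qed

text \<open>The inequality in Parseval's identity that needs completeness, with a partial sum instead of the
  series.\<close>

lemma fourier_parseval_approx:
  assumes u: "u \<in> C_2pi" and e: "e > 0"
  shows "\<exists>N::nat. integral {-pi..pi} (\<lambda>t. (u t)\<^sup>2) \<le>
    2 * pi * (\<Sum>n\<in>{-int N..int N}. (norm (fourier_coeff u n))\<^sup>2) + e"
proof -
  define d where "d = sqrt (e / (2 * pi))"
  have d: "d > 0" "d\<^sup>2 * (2 * pi) = e" using e by (auto simp: d_def)
  obtain f where f: "trig_poly f" "\<And>t. norm (of_real (u t) - f t) < d"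
    using trig_poly_dense[OF u d(1)] by blast
  obtain N b where b: "\<And>t. f t = (\<Sum>n\<in>{-int N..int N}. b n * cis (of_int n * t))"
    using f(1) unfolding trig_poly_def by blast
  let ?F = "{-int N..int N}"
  have h: "((\<lambda>t. (norm (of_real (u t) - (\<Sum>n\<in>?F. b n * cis (of_int n * t))))\<^sup>2) has_integral
    integral {-pi..pi} (\<lambda>t. (u t)\<^sup>2) - 2 * pi * (\<Sum>n\<in>?F. (norm (fourier_coeff u n))\<^sup>2)
      + 2 * pi * (\<Sum>n\<in>?F. (norm (fourier_coeff u n - b n))\<^sup>2)) {-pi..pi}"
    by (intro integral_norm2_diff_trig_poly C_2pi_continuous[OF u]) auto
  have "integral {-pi..pi} (\<lambda>t. (u t)\<^sup>2) - 2 * pi * (\<Sum>n\<in>?F. (norm (fourier_coeff u n))\<^sup>2)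
      + 2 * pi * (\<Sum>n\<in>?F. (norm (fourier_coeff u n - b n))\<^sup>2) \<le> d\<^sup>2 * (2 * pi)"
  proof (rule has_integral_le[OF h])
    show "((\<lambda>t. d\<^sup>2) has_integral d\<^sup>2 * (2 * pi)) {-pi..pi}"
      using has_integral_const_real[of "d\<^sup>2" "-pi" pi] by (simp add: mult.commute)
    show "(norm (of_real (u t) - (\<Sum>n\<in>?F. b n * cis (of_int n * t))))\<^sup>2 \<le> d\<^sup>2" for t
      using f(2)[of t] unfolding b by (intro power_mono) auto
  qed
  moreover have "0 \<le> 2 * pi * (\<Sum>n\<in>?F. (norm (fourier_coeff u n - b n))\<^sup>2)"
    by (intro mult_nonneg_nonneg sum_nonneg) auto
  ultimately show ?thesis
    using d(2) by (intro exI[of _ N]) linarith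
qed

section \<open>Dyadic differences control the energy\<close>

definition fourier_energy :: "(real \<Rightarrow> real) \<Rightarrow> real" where
  "fourier_energy u = 2 * pi * (\<Sum>\<^sub>\<infinity>n\<in>UNIV. \<bar>real_of_int n\<bar> * (norm (fourier_coeff u n))\<^sup>2)"

lemma chord_ge:
  assumes "\<bar>x\<bar> \<le> pi"
  shows "\<bar>x\<bar> / 2 \<le> cmod (cis x - 1)"
proof -
  have "\<bar>sin (x / 2) - (\<Sum>m<3. sin_coeff m * (x / 2) ^ m)\<bar> \<le> inverse (fact 3) * \<bar>x / 2\<bar> ^ 3"
    by (rule Maclaurin_sin_bound)
  moreover have "(\<Sum>m<3. sin_coeff m * (x / 2) ^ m) = x / 2"
    by (simp add: eval_nat_numeral sin_coeff_def)
  moreover have "inverse (fact 3) = (1 / 6 :: real)"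
    by (simp add: fact_numeral)
  ultimately have "\<bar>sin (x / 2) - x / 2\<bar> \<le> \<bar>x / 2\<bar> ^ 3 / 6"
    by simp
  moreover have "\<bar>x / 2\<bar> ^ 3 / 6 \<le> \<bar>x / 2\<bar> / 2"
  proof -
    \<comment> \<open>The cubic error of the sine is at most half of the argument, as \<open>(pi / 2)\<^sup>2 \<le> 3\<close>.\<close>
    have "\<bar>x / 2\<bar>\<^sup>2 \<le> (1.6)\<^sup>2"
      using assms pi_less_4 pi_approx by (intro power_mono) auto
    then have "\<bar>x / 2\<bar> * \<bar>x / 2\<bar>\<^sup>2 \<le> \<bar>x / 2\<bar> * 3"
      by (intro mult_left_mono) (auto simp: power2_eq_square)
    then show ?thesis by (simp add: power3_eq_cube power2_eq_square)
  qed
  ultimately have "\<bar>x\<bar> / 4 \<le> \<bar>sin (x / 2)\<bar>" by linarith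
  then show ?thesis
    using dist_exp_i_1[of x] by (simp add: cis_conv_exp)
qed

lemma chord_le: "cmod (cis x - cis y) \<le> \<bar>x - y\<bar>"
proof -
  have "cis x - cis y = cis y * (cis (x - y) - 1)"
    by (simp add: right_diff_distrib cis_mult)
  then have "cmod (cis x - cis y) = cmod (cis (x - y) - 1)"
    by (simp add: norm_mult)
  also have "\<dots> = 2 * \<bar>sin ((x - y) / 2)\<bar>"
    using dist_exp_i_1[of "x - y"] by (simp add: cis_conv_exp)
  also have "\<dots> \<le> 2 * \<bar>(x - y) / 2\<bar>"
    by (intro mult_left_mono abs_sin_x_le_abs_x) auto
  finally show ?thesis by simp
qed

text \<open>The squared modulus of continuity in the mean, at the step \<open>2^-i\<close>. The sum of these over all
  scales, with weights \<open>2^i\<close>, is a discrete form of the double integral of \<open>(u x - u y)\<^sup>2 / (x - y)\<^sup>2\<close>. It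
  shares with it what the cutoff argument uses: it is a sum of squares of differences, so that it can
  be estimated pointwise.\<close>

definition dyadic_diff :: "(real \<Rightarrow> real) \<Rightarrow> nat \<Rightarrow> real" where
  "dyadic_diff u i = integral {-pi..pi} (\<lambda>x. (u (x + 1 / 2 ^ i) - u x)\<^sup>2)"

definition dyadic_energy_le :: "(real \<Rightarrow> real) \<Rightarrow> real \<Rightarrow> bool" where
  "dyadic_energy_le u E \<longleftrightarrow> (\<forall>m. (\<Sum>i\<le>m. 2 ^ i * dyadic_diff u i) \<le> E)"

lemma dyadic_diff_integrable:
  assumes "u \<in> C_2pi"
  shows "(\<lambda>x. (u (x + h) - u x)\<^sup>2) integrable_on {-pi..pi}"
  by (intro integrable_continuous_interval continuous_intros C_2pi_continuous_compose[OF assms])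

text \<open>The scale that detects a nonzero frequency \<open>n\<close> is the one with \<open>2^i / 2 < \<bar>n\<bar> \<le> 2^i\<close>.\<close>

lemma dyadic_frequency:
  fixes n :: int
  shows "\<exists>i::nat. \<bar>real_of_int n\<bar> \<le> 16 * (2 ^ i * (cmod (cis (of_int n * (1 / 2 ^ i)) - 1))\<^sup>2)"
proof (cases "n = 0")
  case False
  define i where "i = (LEAST i. nat \<bar>n\<bar> \<le> 2 ^ i)"
  have "nat \<bar>n\<bar> \<le> 2 ^ nat \<bar>n\<bar>" by (rule less_imp_le[OF less_exp])
  then have i: "nat \<bar>n\<bar> \<le> 2 ^ i" unfolding i_def by (rule LeastI)
  have j: "\<not> nat \<bar>n\<bar> \<le> 2 ^ j" if "j < i" for j
    using that unfolding i_def by (rule not_less_Least)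
  have "(2::nat) ^ i \<le> 2 * nat \<bar>n\<bar>"
  proof (cases i)
    case 0
    then show ?thesis using False by simp
  next
    case (Suc k)
    then show ?thesis using j[of k] by simp
  qed
  then have "real (2 ^ i) \<le> real (2 * nat \<bar>n\<bar>)" by (simp only: of_nat_le_iff)
  then have 1: "2 ^ i \<le> 2 * \<bar>real_of_int n\<bar>" by simp
  have "real (nat \<bar>n\<bar>) \<le> real (2 ^ i)" using i by (simp only: of_nat_le_iff)
  then have 2: "\<bar>real_of_int n\<bar> \<le> 2 ^ i" by simp
  define \<theta> where "\<theta> = of_int n * (1 / 2 ^ i :: real)"
  have "1 / 2 \<le> \<bar>\<theta>\<bar>" "\<bar>\<theta>\<bar> \<le> 1"
    using 1 2 by (auto simp: \<theta>_def abs_mult field_simps)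
  then have "1 / 4 \<le> cmod (cis \<theta> - 1)"
    using chord_ge[of \<theta>] pi_ge_two by simp
  then have "(1 / 4)\<^sup>2 \<le> (cmod (cis \<theta> - 1))\<^sup>2" by (rule power_mono) simp
  then have "1 \<le> 16 * (cmod (cis \<theta> - 1))\<^sup>2" by (simp add: power2_eq_square)
  then have "2 ^ i * 1 \<le> 2 ^ i * (16 * (cmod (cis \<theta> - 1))\<^sup>2)" by (intro mult_left_mono) auto
  with 2 show ?thesis unfolding \<theta>_def by (intro exI[of _ i]) linarith
qed simp

text \<open>Each frequency is charged to the scale that detects it, and Bessel's inequality is applied to the
  differences at every scale.\<close>

lemma fourier_energy_le_dyadic:
  assumes u: "u \<in> C_2pi" and E: "dyadic_energy_le u E" and F: "finite F"
  shows "2 * pi * (\<Sum>n\<in>F. \<bar>real_of_int n\<bar> * (norm (fourier_coeff u n))\<^sup>2) \<le> 16 * E"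
proof -
  obtain s where s: "\<And>n. \<bar>real_of_int n\<bar> \<le> 16 * (2 ^ s n * (cmod (cis (of_int n * (1 / 2 ^ s n)) - 1))\<^sup>2)"
    using dyadic_frequency by metis
  define m where "m = Max (insert 0 (s ` F))"
  have m: "s n \<le> m" if "n \<in> F" for n
    unfolding m_def by (rule Max_ge) (use F that in auto)
  let ?d = "\<lambda>i n. (norm (fourier_coeff (\<lambda>t. u (t + 1 / 2 ^ i) - u t) n))\<^sup>2"
  have "2 * pi * (\<Sum>n\<in>F. \<bar>real_of_int n\<bar> * (norm (fourier_coeff u n))\<^sup>2)
      \<le> 2 * pi * (\<Sum>n\<in>F. \<Sum>i\<le>m. 16 * (2 ^ i * ?d i n))"
  proof (intro mult_left_mono sum_mono)
    fix n assume n: "n \<in> F"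
    have "\<bar>real_of_int n\<bar> * (norm (fourier_coeff u n))\<^sup>2
        \<le> (16 * (2 ^ s n * (cmod (cis (of_int n * (1 / 2 ^ s n)) - 1))\<^sup>2)) * (norm (fourier_coeff u n))\<^sup>2"
      by (intro mult_right_mono s) auto
    also have "\<dots> = 16 * (2 ^ s n * ?d (s n) n)"
      unfolding fourier_coeff_shift_diff[OF u] by (simp add: norm_mult power_mult_distrib)
    also have "\<dots> \<le> (\<Sum>i\<le>m. 16 * (2 ^ i * ?d i n))"
      by (rule member_le_sum) (use m[OF n] in auto)
    finally show "\<bar>real_of_int n\<bar> * (norm (fourier_coeff u n))\<^sup>2 \<le> \<dots>" .
  qed auto
  also have "\<dots> = 16 * (\<Sum>i\<le>m. 2 ^ i * (2 * pi * (\<Sum>n\<in>F. ?d i n)))"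
    by (subst sum.swap) (simp add: sum_distrib_left mult_ac)
  also have "\<dots> \<le> 16 * (\<Sum>i\<le>m. 2 ^ i * dyadic_diff u i)"
    unfolding dyadic_diff_def
    by (intro mult_left_mono sum_mono fourier_bessel F continuous_intros C_2pi_continuous_compose[OF u]) auto
  also have "\<dots> \<le> 16 * E"
    using E unfolding dyadic_energy_le_def by simp
  finally show ?thesis .
qed

lemma continuous_imp_borel_lebesgue:
  fixes u :: "real \<Rightarrow> real"
  assumes "continuous_on UNIV u"
  shows "u \<in> borel_measurable lebesgue"
  using borel_measurable_continuous_onI[OF assms] by (intro measurable_completion) simp

lemma H_half_of_dyadic:
  assumes u: "u \<in> C_2pi" and E: "dyadic_energy_le u E"
  shows "u \<in> H_half_2pi"
    and "fourier_energy u \<le> 16 * E"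
proof -
  have bnd: "(\<Sum>n\<in>F. (1 + \<bar>real_of_int n\<bar>) * (norm (fourier_coeff u n))\<^sup>2)
      \<le> (integral {-pi..pi} (\<lambda>t. (u t)\<^sup>2) + 16 * E) / (2 * pi)" if "finite F" for F
    using fourier_energy_le_dyadic[OF assms that] fourier_bessel[OF C_2pi_continuous[OF u] that]
    by (simp add: field_simps sum.distrib)
  have sum: "(\<lambda>n. (1 + \<bar>real_of_int n\<bar>) * (norm (fourier_coeff u n))\<^sup>2) summable_on UNIV"
    by (rule nonneg_bdd_above_summable_on) (use bnd in \<open>auto intro!: bdd_aboveI\<close>)
  have "set_integrable lebesgue {a..b} (\<lambda>t. \<bar>u t\<bar> powr 2)" for a b
    by (intro absolutely_integrable_continuous_real)
      (simp add: powr_numeral, intro continuous_intros C_2pi_continuous[OF u])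
  then show "u \<in> H_half_2pi"
    using u sum continuous_imp_borel_lebesgue[OF C_2pi_continuous[OF u]]
    unfolding H_half_2pi_def Lp_2pi_def C_2pi_def by auto
  have "(\<lambda>n. \<bar>real_of_int n\<bar> * (norm (fourier_coeff u n))\<^sup>2) summable_on UNIV"
    by (rule summable_on_comparison_test[OF sum]) (auto simp: distrib_right)
  then have "(\<Sum>\<^sub>\<infinity>n\<in>UNIV. \<bar>real_of_int n\<bar> * (norm (fourier_coeff u n))\<^sup>2) \<le> 16 * E / (2 * pi)"
    by (rule infsum_le_finite_sums)
      (use fourier_energy_le_dyadic[OF assms] in \<open>simp add: field_simps\<close>)
  then show "fourier_energy u \<le> 16 * E"
    by (simp add: fourier_energy_def field_simps)
qed

lemma C_2pi_min: "u \<in> C_2pi \<Longrightarrow> v \<in> C_2pi \<Longrightarrow> (\<lambda>x. min (u x) (v x)) \<in> C_2pi"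
  unfolding C_2pi_def periodic_2pi_def by (auto intro: continuous_intros)

lemma C_2pi_diff_const: "u \<in> C_2pi \<Longrightarrow> (\<lambda>x. c - u x) \<in> C_2pi"
  unfolding C_2pi_def periodic_2pi_def by (auto intro: continuous_intros)

lemma C_2pi_linear_combination:
  assumes "B \<subseteq> C_2pi"
  shows "(\<lambda>x. \<Sum>v\<in>B. a v * v x) \<in> C_2pi"
proof -
  have "continuous_on UNIV (\<lambda>x. \<Sum>v\<in>B. a v * v x)"
    using assms by (intro continuous_intros) (auto simp: C_2pi_def)
  moreover have "a v * v (x + 2 * pi) = a v * v x" if "v \<in> B" for v x
    using assms that by (auto simp: C_2pi_def periodic_2pi_def)
  then have "(\<Sum>v\<in>B. a v * v (x + 2 * pi)) = (\<Sum>v\<in>B. a v * v x)" for x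
    by (rule sum.cong[OF refl])
  ultimately show ?thesis
    by (simp add: C_2pi_def periodic_2pi_def)
qed

lemma dyadic_energy_le_mono:
  "dyadic_energy_le u E \<Longrightarrow> E \<le> E' \<Longrightarrow> dyadic_energy_le u E'"
  unfolding dyadic_energy_le_def by (meson order_trans)

lemma dyadic_energy_diff_const:
  "dyadic_energy_le u E \<Longrightarrow> dyadic_energy_le (\<lambda>x. c - u x) E"
  unfolding dyadic_energy_le_def dyadic_diff_def by (simp add: power2_commute)

text \<open>Taking minima, rather than products, keeps the energy of many combined cutoffs under control:
  the increment of a minimum is bounded by one of the two increments.\<close>

lemma dyadic_energy_min:
  assumes u: "u \<in> C_2pi" "dyadic_energy_le u E" and v: "v \<in> C_2pi" "dyadic_energy_le v E'"
  shows "dyadic_energy_le (\<lambda>x. min (u x) (v x)) (E + E')"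
proof -
  have pt: "(min a b - min c d)\<^sup>2 \<le> (a - c)\<^sup>2 + (b - d)\<^sup>2" for a b c d :: real
  proof -
    have "\<bar>min a b - min c d\<bar> \<le> \<bar>a - c\<bar> \<or> \<bar>min a b - min c d\<bar> \<le> \<bar>b - d\<bar>" by linarith
    then have "(min a b - min c d)\<^sup>2 \<le> (a - c)\<^sup>2 \<or> (min a b - min c d)\<^sup>2 \<le> (b - d)\<^sup>2"
      by (simp add: abs_le_square_iff)
    then show ?thesis using zero_le_power2[of "a - c"] zero_le_power2[of "b - d"] by linarith
  qed
  have "dyadic_diff (\<lambda>x. min (u x) (v x)) i \<le> dyadic_diff u i + dyadic_diff v i" for i
    unfolding dyadic_diff_def
      integral_add[OF dyadic_diff_integrable[OF u(1)] dyadic_diff_integrable[OF v(1)], symmetric]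
    by (intro integral_le pt integrable_add dyadic_diff_integrable u v
        dyadic_diff_integrable[OF C_2pi_min[OF u(1) v(1)]])
  then have "(\<Sum>i\<le>m. 2 ^ i * dyadic_diff (\<lambda>x. min (u x) (v x)) i)
     \<le> (\<Sum>i\<le>m. 2 ^ i * (dyadic_diff u i + dyadic_diff v i))" for m
    by (intro sum_mono mult_left_mono) auto
  then show ?thesis
    using u(2) v(2) unfolding dyadic_energy_le_def
    by (simp add: distrib_left sum.distrib) (meson add_mono order_trans)
qed

text \<open>The energy is nonlocal, so that functions of disjoint supports are not orthogonal for it.
  But a difference \<open>u (x + h) - u x\<close> involves at most two of them, which costs only a factor 2.\<close>

lemma dyadic_energy_disjoint:
  assumes B: "finite B" "B \<subseteq> C_2pi" and E: "\<And>v. v \<in> B \<Longrightarrow> dyadic_energy_le v E"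
    and disj: "\<And>v w x. v \<in> B \<Longrightarrow> w \<in> B \<Longrightarrow> v x \<noteq> 0 \<Longrightarrow> w x \<noteq> 0 \<Longrightarrow> v = w"
  shows "dyadic_energy_le (\<lambda>x. \<Sum>v\<in>B. a v * v x) (2 * E * (\<Sum>v\<in>B. (a v)\<^sup>2))"
proof -
  let ?u = "\<lambda>x. \<Sum>v\<in>B. a v * v x"
  have pt: "(?u y - ?u x)\<^sup>2 \<le> (\<Sum>v\<in>B. 2 * (a v)\<^sup>2 * (v y - v x)\<^sup>2)" for x y
  proof -
    let ?d = "\<lambda>v. a v * (v y - v x)"
    define S where "S = {v \<in> B. ?d v \<noteq> 0}"
    have "finite S" using B by (simp add: S_def)
    have sub1: "\<exists>p. {v \<in> B. v z \<noteq> 0} \<subseteq> {p}" for z using disj by blast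
    obtain p q where "{v \<in> B. v y \<noteq> 0} \<subseteq> {p}" "{v \<in> B. v x \<noteq> 0} \<subseteq> {q}"
      using sub1[of y] sub1[of x] by blast
    then have "S \<subseteq> {p, q}" unfolding S_def by force
    then have "card S \<le> card {p, q}" by (intro card_mono) auto
    also have "\<dots> \<le> 2" by (simp add: card_insert_if)
    finally have cS: "card S \<le> 2" .
    have "?u y - ?u x = sum ?d B"
      by (simp add: sum_subtractf right_diff_distrib)
    also have "\<dots> = sum ?d S"
      unfolding S_def by (rule sum.mono_neutral_right) (use B in auto)
    finally have "(?u y - ?u x)\<^sup>2 \<le> (\<Sum>v\<in>S. (?d v)\<^sup>2) * card S"
      using sum_squared_le_sum_of_squares[of ?d S] by simp
    also have "\<dots> \<le> (\<Sum>v\<in>B. (?d v)\<^sup>2) * 2"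
      by (intro mult_mono sum_mono2) (use B cS in \<open>auto simp: S_def sum_nonneg\<close>)
    also have "\<dots> = (\<Sum>v\<in>B. 2 * (a v)\<^sup>2 * (v y - v x)\<^sup>2)"
      by (simp add: sum_distrib_left power_mult_distrib mult_ac)
    finally show ?thesis .
  qed
  have vC: "v \<in> C_2pi" if "v \<in> B" for v using B that by blast
  have "dyadic_diff ?u i \<le> (\<Sum>v\<in>B. 2 * (a v)\<^sup>2 * dyadic_diff v i)" for i
  proof -
    have "dyadic_diff ?u i \<le> integral {-pi..pi} (\<lambda>x. \<Sum>v\<in>B. 2 * (a v)\<^sup>2 * (v (x + 1 / 2 ^ i) - v x)\<^sup>2)"
      unfolding dyadic_diff_def
      by (intro integral_le pt dyadic_diff_integrable C_2pi_linear_combination B integrable_sum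
          integrable_on_mult_right vC)
    also have "\<dots> = (\<Sum>v\<in>B. 2 * (a v)\<^sup>2 * dyadic_diff v i)"
      unfolding dyadic_diff_def
      by (subst integral_sum) (use B in \<open>auto intro!: dyadic_diff_integrable integrable_on_mult_right vC\<close>)
    finally show ?thesis .
  qed
  then have "(\<Sum>i\<le>m. 2 ^ i * dyadic_diff ?u i) \<le> (\<Sum>i\<le>m. 2 ^ i * (\<Sum>v\<in>B. 2 * (a v)\<^sup>2 * dyadic_diff v i))" for m
    by (intro sum_mono mult_left_mono) auto
  also have "\<dots> m = (\<Sum>v\<in>B. 2 * (a v)\<^sup>2 * (\<Sum>i\<le>m. 2 ^ i * dyadic_diff v i))" for m
    unfolding sum_distrib_left by (subst sum.swap) (simp add: mult_ac)
  also have "\<dots> m \<le> (\<Sum>v\<in>B. 2 * (a v)\<^sup>2 * E)" for m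
    by (intro sum_mono mult_left_mono) (use E in \<open>auto simp: dyadic_energy_le_def\<close>)
  finally show ?thesis
    by (simp add: dyadic_energy_le_def sum_distrib_left mult_ac)
qed

subsection \<open>Cutoff functions\<close>

definition bump :: "real \<Rightarrow> real \<Rightarrow> real \<Rightarrow> real" where
  "bump c r x = max 0 (min 1 (2 - cmod (cis x - cis c) / r))"

lemma cis_plus_2pi: "cis (x + 2 * pi) = cis x"
  by (simp add: complex_eq_iff)

lemma bump_C_2pi: "r > 0 \<Longrightarrow> bump c r \<in> C_2pi"
  unfolding C_2pi_def periodic_2pi_def bump_def
  by (auto intro!: continuous_intros simp: cis_plus_2pi)

lemma bump_bounds: "0 \<le> bump c r x" "bump c r x \<le> 1"
  by (auto simp: bump_def)

lemma bump_eq_1: "r > 0 \<Longrightarrow> cmod (cis x - cis c) \<le> r \<Longrightarrow> bump c r x = 1"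
  by (auto simp: bump_def field_simps max_def min_def)

lemma bump_eq_0: "r > 0 \<Longrightarrow> 2 * r \<le> cmod (cis x - cis c) \<Longrightarrow> bump c r x = 0"
  by (auto simp: bump_def field_simps max_def min_def)

text \<open>The terms decay geometrically on both sides of the scale where \<open>2^i * y\<close> is 1.\<close>

lemma sum_min_geometric_le:
  fixes y :: real
  assumes "y > 0"
  shows "(\<Sum>i\<le>m. min (2 ^ i * y) (1 / (2 ^ i * y))) \<le> 4"
proof -
  \<comment> \<open>A bound of the partial sums that survives induction: geometric growth up to 1, and a geometric tail after it.\<close>
  have "(\<Sum>i\<le>m. min (2 ^ i * y) (1 / (2 ^ i * y))) \<le>
      (if 2 ^ m * y \<le> 1 then 2 * (2 ^ m * y) else 4 - 1 / (2 ^ m * y))"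
  proof (induction m)
    case 0
    then show ?case using assms by (auto simp: min_def field_simps)
  next
    case (Suc m)
    define t where "t = 2 ^ m * y"
    have t: "t > 0" "2 ^ Suc m * y = 2 * t" using assms by (auto simp: t_def)
    have IH: "(\<Sum>i\<le>m. min (2 ^ i * y) (1 / (2 ^ i * y))) \<le> (if t \<le> 1 then 2 * t else 4 - 1 / t)"
      using Suc unfolding t_def .
    have "(if t \<le> 1 then 2 * t else 4 - 1 / t) + min (2 * t) (1 / (2 * t))
        \<le> (if 2 * t \<le> 1 then 2 * (2 * t) else 4 - 1 / (2 * t))"
    proof (cases "2 * t \<le> 1")
      case False
      have "2 * t + 1 / t \<le> 4" if "t \<le> 1"
      proof -
        have "(2 * t - 1) * (t - 1) \<le> 0"
          using that False by (intro mult_nonneg_nonpos) auto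
        then have "2 * t * t + 1 \<le> 3 * t" by (simp add: algebra_simps)
        then have "2 * t + 1 / t \<le> 3" using t by (simp add: field_simps)
        then show ?thesis by simp
      qed
      moreover have "1 / t = 2 * (1 / (2 * t))" using t by simp
      moreover have "min (2 * t) (1 / (2 * t)) \<le> 1 / (2 * t)" by simp
      ultimately show ?thesis using False by (simp only: if_False split: if_split) linarith
    next
      case True
      moreover have "min (2 * t) (1 / (2 * t)) \<le> 2 * t" by simp
      ultimately show ?thesis using t by (simp only: if_True split: if_split) linarith
    qed
    with IH show ?case unfolding sum.atMost_Suc t(2) by linarith
  qed
  also have "\<dots> \<le> 4"
  proof (cases "2 ^ m * y \<le> 1")
    case True
    then show ?thesis by (simp only: if_True)
  next
    case False
    then show ?thesis using assms by simp
  qed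
  finally show ?thesis .
qed

lemma bump_integral_le:
  assumes r: "r > 0"
  shows "integral {-pi..pi} (bump c r) \<le> 8 * r"
proof -
  define a b where "a = max (-pi) (-4 * r)" and "b = min pi (4 * r)"
  have ab: "a \<le> b" "b - a \<le> 8 * r" "{a..b} \<subseteq> {-pi..pi}"
    using r pi_gt_zero unfolding a_def b_def by (auto simp del: pi_gt_zero)
  have one: "((\<lambda>x. if x \<in> {a..b} then 1 else 0) has_integral (b - a)) {-pi..pi}"
    unfolding has_integral_restrict[OF ab(3)]
    using has_integral_const_real[of "1::real" a b] ab(1) by simp
  have C: "bump c r \<in> C_2pi" using r by (rule bump_C_2pi)
  have "integral {-pi..pi} (bump c r) = integral {-pi..pi} (\<lambda>x. bump c r (x + c))"
    using C by (intro integral_period_shift[symmetric]) (auto simp: C_2pi_def periodic_2pi_def)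
  also have "\<dots> \<le> b - a"
  proof (rule has_integral_le[OF integrable_integral one])
    show "(\<lambda>x. bump c r (x + c)) integrable_on {-pi..pi}"
      by (intro integrable_continuous_interval C_2pi_continuous_compose[OF C] continuous_intros)
    fix x :: real assume x: "x \<in> {-pi..pi}"
    have "cis (x + c) - cis c = cis c * (cis x - 1)"
      by (simp add: right_diff_distrib cis_mult add.commute)
    then have "cmod (cis (x + c) - cis c) = cmod (cis x - 1)" by (simp add: norm_mult)
    then have "\<bar>x\<bar> / 2 \<le> cmod (cis (x + c) - cis c)" using chord_ge[of x] x by auto
    then have "bump c r (x + c) = 0" if "\<bar>x\<bar> > 4 * r"
      using that bump_eq_0[OF r, of "x + c" c] by linarith
    moreover have "x \<in> {a..b}" if "\<bar>x\<bar> \<le> 4 * r"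
      using that x unfolding a_def b_def by auto
    ultimately show "bump c r (x + c) \<le> (if x \<in> {a..b} then 1 else 0)"
      using bump_bounds[of c r "x + c"] by (cases "\<bar>x\<bar> \<le> 4 * r") auto
  qed
  finally show ?thesis using ab(2) by linarith
qed

text \<open>At the step \<open>h\<close>, the increments of the cutoff are at most \<open>min 1 (h / r)\<close>, and they live on a set of
  length a multiple of \<open>r\<close>. Summation over \<open>h = 2^-i\<close> with weights \<open>1 / h\<close> removes \<open>r\<close>.\<close>

lemma bump_dyadic_energy:
  assumes r: "r > 0"
  shows "dyadic_energy_le (bump c r) 128"
proof -
  \<comment> \<open>A continuous majorant of the indicator of the support; its integral is invariant under shifts.\<close>
  define G where "G = bump c (2 * r)"
  have GC: "G \<in> C_2pi" unfolding G_def using r by (intro bump_C_2pi) simp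
  have G01: "0 \<le> G x" "G x \<le> 1" for x by (auto simp: G_def bump_bounds)
  have G1: "G x = 1" if "bump c r x \<noteq> 0" for x
    using that r bump_eq_0[OF r, of x c] bump_eq_1[of "2 * r" x c] by (force simp: G_def)
  have per: "G (x + 2 * pi) = G x" for x using GC by (simp add: C_2pi_def periodic_2pi_def)
  have Gint: "integral {-pi..pi} (\<lambda>x. G (x + h)) = integral {-pi..pi} G" for h
    by (rule integral_period_shift[OF C_2pi_continuous[OF GC] per])
  have IG: "integral {-pi..pi} G \<le> 16 * r"
    using bump_integral_le[of "2 * r" c] r by (simp add: G_def)
  have lip: "\<bar>bump c r y - bump c r x\<bar> \<le> \<bar>y - x\<bar> / r" for x y
  proof -
    have "\<bar>cmod (cis y - cis c) - cmod (cis x - cis c)\<bar> \<le> cmod (cis y - cis x)"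
      using norm_triangle_ineq3[of "cis y - cis c" "cis x - cis c"] by simp
    also have "\<dots> \<le> \<bar>y - x\<bar>" by (rule chord_le)
    finally have "\<bar>cmod (cis y - cis c) / r - cmod (cis x - cis c) / r\<bar> \<le> \<bar>y - x\<bar> / r"
      using r by (simp add: diff_divide_distrib[symmetric] divide_right_mono)
    then show ?thesis unfolding bump_def by linarith
  qed
  have D: "2 ^ i * dyadic_diff (bump c r) i \<le> 32 * min (2 ^ i * r) (1 / (2 ^ i * r))" for i
  proof -
    define h :: real where "h = 1 / 2 ^ i"
    have h: "h > 0" "2 ^ i * h = 1" by (auto simp: h_def)
    have "(bump c r (x + h) - bump c r x)\<^sup>2 \<le> min 1 ((h / r)\<^sup>2) * (G x + G (x + h))" for x
    proof (cases "bump c r (x + h) = 0 \<and> bump c r x = 0")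
      case True
      then show ?thesis using G01 by simp
    next
      case False
      have "\<bar>bump c r (x + h) - bump c r x\<bar> \<le> h / r" using lip[of "x + h" x] h by simp
      then have 1: "(bump c r (x + h) - bump c r x)\<^sup>2 \<le> (h / r)\<^sup>2"
        using power_mono[of "\<bar>bump c r (x + h) - bump c r x\<bar>" "h / r" 2] by simp
      have "\<bar>bump c r (x + h) - bump c r x\<bar> \<le> 1"
        using bump_bounds[of c r x] bump_bounds[of c r "x + h"] by linarith
      then have 2: "(bump c r (x + h) - bump c r x)\<^sup>2 \<le> 1"
        using power_mono[of "\<bar>bump c r (x + h) - bump c r x\<bar>" 1 2] by simp
      have "1 \<le> G x + G (x + h)"
        using False G1[of x] G1[of "x + h"] G01[of x] G01[of "x + h"] by force
      then have "min 1 ((h / r)\<^sup>2) * 1 \<le> min 1 ((h / r)\<^sup>2) * (G x + G (x + h))"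
        by (intro mult_left_mono) auto
      with 1 2 show ?thesis by linarith
    qed
    then have "dyadic_diff (bump c r) i \<le> integral {-pi..pi} (\<lambda>x. min 1 ((h / r)\<^sup>2) * (G x + G (x + h)))"
      unfolding dyadic_diff_def h_def[symmetric]
      by (intro integral_le dyadic_diff_integrable bump_C_2pi r integrable_continuous_interval
          continuous_intros C_2pi_continuous_compose[OF GC])
    also have "\<dots> = min 1 ((h / r)\<^sup>2) * (integral {-pi..pi} G + integral {-pi..pi} G)"
      unfolding integral_mult_right
      by (subst integral_add) (auto simp: Gint intro!: integrable_continuous_interval continuous_intros
          C_2pi_continuous_compose[OF GC])
    also have "\<dots> \<le> min 1 ((h / r)\<^sup>2) * (32 * r)"
      using IG by (intro mult_left_mono) auto
    finally have "2 ^ i * dyadic_diff (bump c r) i \<le> 2 ^ i * (min 1 ((h / r)\<^sup>2) * (32 * r))"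
      by (intro mult_left_mono) auto
    also have "\<dots> = 32 * min (2 ^ i * r) (1 / (2 ^ i * r))"
    proof -
      have "2 ^ i * (min 1 ((h / r)\<^sup>2) * (32 * r)) = 32 * (min 1 ((h / r)\<^sup>2) * (2 ^ i * r))"
        by simp
      also have "min 1 ((h / r)\<^sup>2) * (2 ^ i * r) = min (1 * (2 ^ i * r)) ((h / r)\<^sup>2 * (2 ^ i * r))"
        using r by (intro min_mult_distrib_right[THEN trans]) auto
      also have "(h / r)\<^sup>2 * (2 ^ i * r) = 1 / (2 ^ i * r)"
        using r unfolding h_def by (simp add: power2_eq_square field_simps)
      finally show ?thesis by simp
    qed
    finally show ?thesis .
  qed
  have "(\<Sum>i\<le>m. 2 ^ i * dyadic_diff (bump c r) i) \<le> 32 * (\<Sum>i\<le>m. min (2 ^ i * r) (1 / (2 ^ i * r)))" for m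
    unfolding sum_distrib_left by (intro sum_mono D)
  also have "\<dots> m \<le> 32 * 4" for m
    by (intro mult_left_mono sum_min_geometric_le r) auto
  finally show ?thesis by (simp add: dyadic_energy_le_def)
qed

section \<open>The lower bound\<close>

lemma fun_scale_sum_apply:
  "(\<Sum>v\<in>B. fun_scale (a v) v) x = (\<Sum>v\<in>B. a v * v x)"
  by (induction B rule: infinite_finite_induct) (auto simp: fun_scale_def)

lemma integrable_mult_bounded:
  fixes V g :: "'a \<Rightarrow> real"
  assumes V: "integrable M V" and g: "g \<in> borel_measurable M" and C: "\<And>t. t \<in> space M \<Longrightarrow> \<bar>g t\<bar> \<le> C"
  shows "integrable M (\<lambda>t. V t * g t)"
proof (rule Bochner_Integration.integrable_bound[of _ "\<lambda>t. C * V t"])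
  show "integrable M (\<lambda>t. C * V t)" using V by simp
  show "(\<lambda>t. V t * g t) \<in> borel_measurable M"
    using V g by (intro borel_measurable_times) auto
  show "AE t in M. norm (V t * g t) \<le> norm (C * V t)"
  proof (rule AE_I2)
    fix t assume "t \<in> space M"
    then have "\<bar>g t\<bar> \<le> \<bar>C\<bar>" using C[of t] by linarith
    then have "\<bar>g t\<bar> * \<bar>V t\<bar> \<le> \<bar>C\<bar> * \<bar>V t\<bar>" by (rule mult_right_mono) simp
    then show "norm (V t * g t) \<le> norm (C * V t)" by (simp add: abs_mult mult.commute)
  qed
qed

lemma integrable_mult_continuous:
  fixes V g :: "real \<Rightarrow> real"
  assumes V: "integrable (lebesgue_on {a..b}) V" and g: "continuous_on {a..b} g"
  shows "integrable (lebesgue_on {a..b}) (\<lambda>t. V t * g t)"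
proof -
  have "compact (g ` {a..b})" by (intro compact_continuous_image g) auto
  then obtain C where C: "\<And>t. t \<in> {a..b} \<Longrightarrow> \<bar>g t\<bar> \<le> C"
    using compact_imp_bounded bounded_iff by (metis imageI real_norm_def)
  show ?thesis
    by (rule integrable_mult_bounded[OF V continuous_imp_measurable_on_sets_lebesgue[OF g]])
      (use C in auto)
qed

text \<open>The potential term is additive over functions of disjoint supports, and the energy is additive up
  to a factor 2. The constant 32 is this factor times the constant of \<open>H_half_of_dyadic\<close>.\<close>

lemma N_minus_ge_of_disjoint:
  assumes V: "integrable (lebesgue_on {-pi..pi}) V"
    and B: "finite B" "B \<subseteq> C_2pi" and E: "\<And>v. v \<in> B \<Longrightarrow> dyadic_energy_le v E"
    and disj: "\<And>v w x. v \<in> B \<Longrightarrow> w \<in> B \<Longrightarrow> v x \<noteq> 0 \<Longrightarrow> w x \<noteq> 0 \<Longrightarrow> v = w"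
    and E0: "0 \<le> E"
    and mass: "\<And>v. v \<in> B \<Longrightarrow> 32 * E < (LINT t|lebesgue_on {-pi..pi}. V t * (v t)\<^sup>2)"
  shows "enat (card B) \<le> N_minus Dom_qform (qform V)"
proof -
  let ?L = "fun_space.span B"
  have span: "\<exists>a. u = (\<lambda>x. \<Sum>v\<in>B. a v * v x)" if u: "u \<in> ?L" for u
  proof -
    obtain a where "u = (\<Sum>v\<in>B. fun_scale (a v) v)"
      using u fun_space.span_finite[OF B(1)] by auto
    then show ?thesis by (auto simp: fun_scale_sum_apply fun_eq_iff)
  qed
  have Vint: "integrable (lebesgue_on {-pi..pi}) (\<lambda>t. V t * (v t)\<^sup>2)" if "v \<in> B" for v
    using that B by (intro integrable_mult_continuous[OF V] continuous_intros C_2pi_continuous) auto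
  have neg: "u \<in> Dom_qform \<and> (u \<noteq> 0 \<longrightarrow> qform V u < 0)" if uL: "u \<in> ?L" for u
  proof -
    obtain a where u: "u = (\<lambda>x. \<Sum>v\<in>B. a v * v x)" using span[OF uL] by blast
    have uC: "u \<in> C_2pi" unfolding u by (rule C_2pi_linear_combination[OF B(2)])
    have uE: "dyadic_energy_le u (2 * E * (\<Sum>v\<in>B. (a v)\<^sup>2))"
      unfolding u by (rule dyadic_energy_disjoint[OF B E disj])
    have "qform V u < 0" if "u \<noteq> 0"
    proof -
      have "\<exists>v\<in>B. a v \<noteq> 0"
        using that unfolding u by (auto simp: fun_eq_iff intro: sum.neutral)
      then have pos: "0 < (\<Sum>v\<in>B. (a v)\<^sup>2)"
        using B(1) by (auto intro: sum_pos2)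
      \<comment> \<open>At most one of the functions is nonzero at \<open>t\<close>.\<close>
      have sq: "(u t)\<^sup>2 = (\<Sum>v\<in>B. (a v)\<^sup>2 * (v t)\<^sup>2)" for t
      proof (cases "\<exists>w\<in>B. w t \<noteq> 0")
        case True
        then obtain w where w: "w \<in> B" "w t \<noteq> 0" by blast
        have z: "v t = 0" if "v \<in> B" "v \<noteq> w" for v
          using disj[of v w t] that w by blast
        have "u t = a w * w t"
          unfolding u by (subst sum.remove[OF B(1) w(1)]) (simp add: z)
        moreover have "(\<Sum>v\<in>B. (a v)\<^sup>2 * (v t)\<^sup>2) = (a w)\<^sup>2 * (w t)\<^sup>2"
          by (subst sum.remove[OF B(1) w(1)]) (simp add: z)
        ultimately show ?thesis by (simp add: power_mult_distrib)
      qed (simp add: u sum.neutral)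
      have "(LINT t|lebesgue_on {-pi..pi}. V t * (u t)\<^sup>2)
          = (LINT t|lebesgue_on {-pi..pi}. (\<Sum>v\<in>B. (a v)\<^sup>2 * (V t * (v t)\<^sup>2)))"
        by (simp add: sq sum_distrib_left mult_ac)
      also have "\<dots> = (\<Sum>v\<in>B. (a v)\<^sup>2 * (LINT t|lebesgue_on {-pi..pi}. V t * (v t)\<^sup>2))"
        by (subst Bochner_Integration.integral_sum) (auto intro!: Vint)
      also have "\<dots> > (\<Sum>v\<in>B. (a v)\<^sup>2 * (32 * E))"
      proof -
        obtain w where w: "w \<in> B" "a w \<noteq> 0" using \<open>\<exists>v\<in>B. a v \<noteq> 0\<close> by blast
        show ?thesis
        proof (rule sum_strict_mono_ex1[OF B(1)])
          show "\<forall>v\<in>B. (a v)\<^sup>2 * (32 * E) \<le> (a v)\<^sup>2 * (LINT t|lebesgue_on {-pi..pi}. V t * (v t)\<^sup>2)"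
            by (intro ballI mult_left_mono[OF less_imp_le[OF mass]]) auto
          show "\<exists>v\<in>B. (a v)\<^sup>2 * (32 * E) < (a v)\<^sup>2 * (LINT t|lebesgue_on {-pi..pi}. V t * (v t)\<^sup>2)"
            using mass w by (intro bexI[of _ w] mult_strict_left_mono) auto
        qed
      qed
      also have "(\<Sum>v\<in>B. (a v)\<^sup>2 * (32 * E)) = 16 * (2 * E * (\<Sum>v\<in>B. (a v)\<^sup>2))"
        by (simp add: sum_distrib_left mult_ac)
      finally show ?thesis
        using H_half_of_dyadic(2)[OF uC uE] by (simp add: qform_def fourier_energy_def)
    qed
    then show ?thesis using H_half_of_dyadic(1)[OF uC uE] uC by (simp add: Dom_qform_def)
  qed
  have nz: "\<exists>x. v x \<noteq> 0" if "v \<in> B" for v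
  proof (rule ccontr)
    assume "\<nexists>x. v x \<noteq> 0"
    then have "(LINT t|lebesgue_on {-pi..pi}. V t * (v t)\<^sup>2) = 0" by simp
    then show False using mass[OF that] E0 by simp
  qed
  have "\<not> fun_space.dependent B"
  proof
    assume "fun_space.dependent B"
    then obtain a w where w: "w \<in> B" "a w \<noteq> 0" and s: "(\<Sum>v\<in>B. fun_scale (a v) v) = 0"
      using fun_space.dependent_finite[OF B(1)] by blast
    obtain x where x: "w x \<noteq> 0" using nz[OF w(1)] by blast
    have z: "v x = 0" if "v \<in> B" "v \<noteq> w" for v
      using disj[of v w x] that w x by blast
    have "0 = (\<Sum>v\<in>B. a v * v x)"
      using fun_cong[OF s, of x] by (simp add: fun_scale_sum_apply)
    also have "\<dots> = a w * w x"
      by (subst sum.remove[OF B(1) w(1)]) (simp add: z)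
    finally show False using w x by simp
  qed
  then have "ext_dim ?L = enat (card B)"
    using B(1) fun_space.dim_span_eq_card_independent[of B] by (auto simp: ext_dim_def)
  moreover have "ext_dim ?L \<le> N_minus Dom_qform (qform V)"
    unfolding N_minus_def by (rule SUP_upper) (use neg in auto)
  ultimately show ?thesis by simp
qed

subsection \<open>Selecting disjoint cutoffs from a sequence of arcs\<close>

text \<open>The cutoffs below are built on arcs of centre \<open>c k\<close> and radius \<open>r k\<close>, none of which is contained
  in the 33-fold enlargement of an earlier one. The cutoff of an arc has to avoid the earlier arcs
  near it, but only those that no intermediate arc has taken care of already: an earlier arc \<open>j\<close>
  is left to the first later arc that it meets. As that arc is much larger than \<open>j\<close>, everything
  that avoids it avoids \<open>j\<close> too.\<close>

definition arcs_meet :: "(nat \<Rightarrow> real) \<Rightarrow> (nat \<Rightarrow> real) \<Rightarrow> nat \<Rightarrow> nat \<Rightarrow> bool" where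
  "arcs_meet c r j k \<longleftrightarrow> cmod (cis (c j) - cis (c k)) \<le> 6 * r j + 2 * r k"

text \<open>The earlier arcs that are left to the arc \<open>k\<close>.\<close>

definition first_met :: "(nat \<Rightarrow> real) \<Rightarrow> (nat \<Rightarrow> real) \<Rightarrow> nat \<Rightarrow> nat set" where
  "first_met c r k = {j. j < k \<and> arcs_meet c r j k \<and> (\<forall>i. j < i \<and> i < k \<longrightarrow> \<not> arcs_meet c r j i)}"

definition cutoff :: "(nat \<Rightarrow> real) \<Rightarrow> (nat \<Rightarrow> real) \<Rightarrow> nat \<Rightarrow> real \<Rightarrow> real" where
  "cutoff c r k x =
     Min (insert (bump (c k) (r k) x) ((\<lambda>j. 1 - bump (c j) (3 * r j) x) ` first_met c r k))"

lemma finite_first_met: "finite (first_met c r k)"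
  unfolding first_met_def by (rule finite_subset[of _ "{..<k}"]) auto

lemma cutoff_nonneg: "0 \<le> cutoff c r k x"
  unfolding cutoff_def using finite_first_met bump_bounds by (intro Min.boundedI) auto

lemma cutoff_le_bump: "cutoff c r k x \<le> bump (c k) (r k) x"
  unfolding cutoff_def using finite_first_met by (intro Min_le) auto

lemma cutoff_le_compl: "j \<in> first_met c r k \<Longrightarrow> cutoff c r k x \<le> 1 - bump (c j) (3 * r j) x"
  unfolding cutoff_def using finite_first_met by (intro Min_le) auto

lemma cutoff_eq_1:
  assumes r: "\<And>j. j \<le> k \<Longrightarrow> 0 < r j" and x: "cmod (cis x - cis (c k)) \<le> r k"
    and far: "\<And>j. j < k \<Longrightarrow> 33 * r j < cmod (cis x - cis (c j))"
  shows "cutoff c r k x = 1"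
proof -
  have "1 - bump (c j) (3 * r j) x = 1" if "j \<in> first_met c r k" for j
    using that far[of j] r[of j] bump_eq_0[of "3 * r j" x "c j"] by (auto simp: first_met_def)
  then have eq: "insert (bump (c k) (r k) x) ((\<lambda>j. 1 - bump (c j) (3 * r j) x) ` first_met c r k) = {1}"
    using bump_eq_1[OF r[OF order_refl] x] by auto
  show ?thesis unfolding cutoff_def eq by simp
qed

text \<open>The constant is twice the energy of a single bump: the cutoff is a bump, or the minimum of a bump
  and of the complement of one.\<close>

lemma cutoff_regular:
  assumes r: "\<And>j. j \<le> k \<Longrightarrow> 0 < r j" and card: "card (first_met c r k) \<le> 1"
  shows "cutoff c r k \<in> C_2pi \<and> dyadic_energy_le (cutoff c r k) 256"
proof (cases "first_met c r k = {}")
  case True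
  then have "cutoff c r k = bump (c k) (r k)" by (auto simp: cutoff_def)
  then show ?thesis
    using bump_C_2pi bump_dyadic_energy dyadic_energy_le_mono[of "bump (c k) (r k)" 128 256] r[of k] by auto
next
  case False
  then have "card (first_met c r k) = 1" 
    using card finite_first_met[of c r k] by (simp add: le_Suc_eq)
  then obtain j where j: "first_met c r k = {j}" by (rule card_1_singletonE)
  then have "j < k" by (auto simp: first_met_def)
  with r[of j] have rj: "0 < 3 * r j" by simp
  have "cutoff c r k = (\<lambda>x. min (bump (c k) (r k) x) (1 - bump (c j) (3 * r j) x))"
    by (auto simp: cutoff_def j)
  moreover note C_2pi_diff_const[OF bump_C_2pi[OF rj, of "c j"], of 1]
  moreover note dyadic_energy_diff_const[OF bump_dyadic_energy[OF rj, of "c j"], of 1]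
  ultimately show ?thesis
    using C_2pi_min dyadic_energy_min bump_C_2pi[OF r[OF order_refl], of "c k"]
      bump_dyadic_energy[OF r[OF order_refl], of "c k"] by fastforce
qed

text \<open>Suppose that the bump of \<open>k\<close> does not vanish at a point within \<open>3 * r j\<close> of the centre of \<open>j\<close>. Then the
  two arcs meet. If no arc in between meets \<open>j\<close>, the cutoff of \<open>k\<close> avoids this neighbourhood of \<open>j\<close> by
  definition. Otherwise the first arc that meets \<open>j\<close> is so large, since it escapes the enlargement of
  \<open>j\<close>, that its own neighbourhood contains the point, and the argument repeats with that arc.\<close>

lemma cutoff_disjoint:
  assumes r: "\<And>j. j < K \<Longrightarrow> 0 < r j"
    and escape: "\<And>j k. j < k \<Longrightarrow> k < K \<Longrightarrow> 33 * r j < cmod (cis (c j) - cis (c k)) + r k"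
    and jk: "j < k" "k < K" and x: "cutoff c r j x \<noteq> 0"
  shows "cutoff c r k x = 0"
proof -
  have zero: "cutoff c r k x = 0" if "j < k" "k < K" "cmod (cis x - cis (c j)) \<le> 3 * r j" for j
    using that
  proof (induction "k - j" arbitrary: j rule: less_induct)
    case less
    show ?case
    proof (cases "bump (c k) (r k) x = 0")
      case True
      then show ?thesis using cutoff_le_bump[of c r k x] cutoff_nonneg[of c r k x] by simp
    next
      case False
      then have "cmod (cis x - cis (c k)) < 2 * r k"
        using bump_eq_0[of "r k" x "c k"] r[of k] less.prems by force
      then have "arcs_meet c r j k"
        using less.prems norm_triangle_ineq4[of "cis x - cis (c k)" "cis x - cis (c j)"] r[of j]
        by (simp add: arcs_meet_def)
      define i where "i = (LEAST i. j < i \<and> arcs_meet c r j i)"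
      have i: "j < i" "arcs_meet c r j i"
        using LeastI[of "\<lambda>i. j < i \<and> arcs_meet c r j i" k] less.prems(1) \<open>arcs_meet c r j k\<close>
        unfolding i_def by auto
      have ik: "i \<le> k"
        unfolding i_def using less.prems(1) \<open>arcs_meet c r j k\<close> by (intro Least_le) auto
      have least: "\<not> arcs_meet c r j l" if "j < l" "l < i" for l
        using not_less_Least[of l "\<lambda>i. j < i \<and> arcs_meet c r j i"] that unfolding i_def by auto
      show ?thesis
      proof (cases "i = k")
        case True
        then have "j \<in> first_met c r k"
          using i least by (auto simp: first_met_def)
        then have "cutoff c r k x \<le> 1 - bump (c j) (3 * r j) x" by (rule cutoff_le_compl)
        also have "\<dots> = 0" using bump_eq_1[of "3 * r j" x "c j"] less.prems r[of j] by simp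
        finally show ?thesis using cutoff_nonneg[of c r k x] by simp
      next
        case False
        with ik have ik: "i < k" by simp
        \<comment> \<open>This gives \<open>9 * r j < r i\<close>, which is where the enlargement factor 33 comes from.\<close>
        have "33 * r j < (6 * r j + 2 * r i) + r i"
          using escape[of j i] i ik less.prems by (simp add: arcs_meet_def)
        moreover have "cmod (cis x - cis (c i)) \<le> 3 * r j + (6 * r j + 2 * r i)"
          using norm_triangle_ineq[of "cis x - cis (c j)" "cis (c j) - cis (c i)"] less.prems i
          by (simp add: arcs_meet_def)
        ultimately have "cmod (cis x - cis (c i)) \<le> 3 * r i" by linarith
        then show ?thesis using less.hyps[of i] i ik less.prems by simp
      qed
    qed
  qed
  have "bump (c j) (r j) x \<noteq> 0"
    using x cutoff_le_bump[of c r j x] cutoff_nonneg[of c r j x] by force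
  then have "cmod (cis x - cis (c j)) \<le> 3 * r j"
    using bump_eq_0[of "r j" x "c j"] r[of j] jk by force
  then show ?thesis using zero jk by blast
qed

text \<open>Every arc has at most one first later arc that it meets. So the sets \<open>first_met c r k\<close> are disjoint,
  and at most half of them have two or more elements.\<close>

lemma many_light_arcs:
  "K \<le> 2 * card {k. k < K \<and> card (first_met c r k) \<le> 1}"
proof -
  let ?H = "{k. k < K \<and> \<not> card (first_met c r k) \<le> 1}"
  let ?G = "{k. k < K \<and> card (first_met c r k) \<le> 1}"
  have disj: "first_met c r k \<inter> first_met c r l = {}" if "k \<noteq> l" for k l
    using that unfolding first_met_def by (cases k l rule: linorder_cases) auto
  have "2 * card ?H = (\<Sum>k\<in>?H. 2)" by simp
  also have "\<dots> \<le> (\<Sum>k\<in>?H. card (first_met c r k))" by (rule sum_mono) auto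
  also have "\<dots> = card (\<Union>k\<in>?H. first_met c r k)"
    by (rule card_UN_disjoint[symmetric]) (use finite_first_met disj in auto)
  also have "\<dots> \<le> card {..<K}"
    by (rule card_mono) (auto simp: first_met_def)
  finally have "2 * card ?H \<le> K" by simp
  moreover have "card ?H + card ?G = K"
  proof -
    have "card (?H \<union> ?G) = card ?H + card ?G" by (rule card_Un_disjoint) auto
    moreover have "?H \<union> ?G = {..<K}" by auto
    ultimately show ?thesis by simp
  qed
  ultimately show ?thesis by linarith
qed

subsection \<open>Greedy choice of arcs\<close>

text \<open>The arcs are taken with respect to the chord distance, which makes the triangle inequality and
  periodicity immediate.\<close>

definition chord_arc :: "real \<Rightarrow> real \<Rightarrow> real set" where
  "chord_arc c r = {x \<in> {-pi..pi}. cmod (cis x - cis c) \<le> r}"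

lemma closed_in_sets_lebesgue: "closed (S :: real set) \<Longrightarrow> S \<in> sets lebesgue"
  by (simp add: sets_completionI_sets borel_closed)

lemma arc_sets: "chord_arc c r \<in> sets (lebesgue_on {-pi..pi})"
proof -
  have eq: "chord_arc c r = {-pi..pi} \<inter> {x. cmod (cis x - cis c) \<le> r}"
    by (auto simp: chord_arc_def)
  have "closed (chord_arc c r)"
    unfolding eq by (intro closed_Int closed_Collect_le continuous_intros closed_real_atLeastAtMost)
  then show ?thesis
    using closed_in_sets_lebesgue by (auto simp: sets_restrict_space_iff chord_arc_def)
qed

text \<open>The chord determines the angle modulo \<open>2 * pi\<close>, and it is at least half of the reduced angle.\<close>

lemma chord_reduce:
  obtains k :: int and s where "x = c + 2 * pi * of_int k + s" "\<bar>s\<bar> \<le> pi"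
    "\<bar>s\<bar> / 2 \<le> cmod (cis x - cis c)"
proof -
  define k where "k = \<lfloor>(x - c + pi) / (2 * pi)\<rfloor>"
  define s where "s = x - c - 2 * pi * of_int k"
  have "of_int k \<le> (x - c + pi) / (2 * pi)" "(x - c + pi) / (2 * pi) < of_int k + 1"
    unfolding k_def by linarith+
  then have "\<bar>s\<bar> \<le> pi" unfolding s_def by (simp add: field_simps abs_le_iff)
  have "cis x = cis (c + s)"
    using periodic_int_shift[of cis "c + s" k, OF cis_plus_2pi] by (simp add: s_def algebra_simps)
  then have "cis x - cis c = cis c * (cis s - 1)" by (simp add: right_diff_distrib cis_mult)
  then have "cmod (cis x - cis c) = cmod (cis s - 1)" by (simp add: norm_mult)
  with chord_ge[OF \<open>\<bar>s\<bar> \<le> pi\<close>] show ?thesis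
    using that[of k s] \<open>\<bar>s\<bar> \<le> pi\<close> by (simp add: s_def)
qed

text \<open>A chord of length at most \<open>33 * r\<close> belongs to an angle of at most \<open>66 * r\<close>, which is 132 steps of
  length \<open>r / 2\<close>.\<close>

lemma arc_cover:
  assumes r: "r > 0"
  shows "chord_arc c (33 * r) \<subseteq> (\<Union>i\<in>{-132..132::int}. chord_arc (c + of_int i * (r / 2)) (r / 2))"
proof
  fix x assume x: "x \<in> chord_arc c (33 * r)"
  obtain k s where s: "x = c + 2 * pi * of_int k + s" "\<bar>s\<bar> / 2 \<le> cmod (cis x - cis c)"
    using chord_reduce[of x c] by metis
  then have s66: "\<bar>s\<bar> \<le> 66 * r" using x by (auto simp: chord_arc_def)
  define i where "i = (if 0 \<le> s then \<lfloor>s / (r / 2)\<rfloor> else \<lceil>s / (r / 2)\<rceil>)"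
  have q: "\<bar>s / (r / 2)\<bar> \<le> 132" using s66 r by (simp add: abs_divide field_simps)
  have "\<bar>of_int i - s / (r / 2)\<bar> \<le> 1" unfolding i_def by (auto; linarith)
  then have "\<bar>of_int i - s / (r / 2)\<bar> * (r / 2) \<le> 1 * (r / 2)" using r by (intro mult_right_mono) auto
  then have "\<bar>of_int i - s / (r / 2)\<bar> * (r / 2) \<le> r / 2" by simp
  moreover have "\<bar>of_int i - s / (r / 2)\<bar> * (r / 2) = \<bar>(of_int i - s / (r / 2)) * (r / 2)\<bar>"
    using r by (simp add: abs_mult)
  moreover have "(of_int i - s / (r / 2)) * (r / 2) = of_int i * (r / 2) - s"
    using r by (simp add: field_simps)
  ultimately have d: "\<bar>of_int i * (r / 2) - s\<bar> \<le> r / 2" by metis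
  have "-132 \<le> i" "i \<le> 132"
    using abs_le_D1[OF q] abs_le_D2[OF q] unfolding i_def by (simp_all split: if_splits)
  moreover have "cmod (cis x - cis (c + of_int i * (r / 2))) \<le> r / 2"
  proof -
    have "cis x = cis (c + s)"
      using periodic_int_shift[of cis "c + s" k, OF cis_plus_2pi] by (simp add: s algebra_simps)
    then show ?thesis using chord_le[of "c + s" "c + of_int i * (r / 2)"] d by (simp only:)
  qed
  ultimately show "x \<in> (\<Union>i\<in>{-132..132::int}. chord_arc (c + of_int i * (r / 2)) (r / 2))"
    using x by (auto simp: chord_arc_def)
qed

text \<open>The second assumption is the absence of atoms, in the uniform form that makes the radii in the
  greedy choice bounded below.\<close>

locale circle_measure = finite_measure M for M :: "real measure" +
  assumes sets_M: "sets M = sets (lebesgue_on {-pi..pi})"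
    and small_arcs: "\<And>h. h > 0 \<Longrightarrow> \<exists>\<rho>>0. \<forall>c. measure M (chord_arc c \<rho>) < h"
begin

lemma arc_in_sets [measurable]: "chord_arc c r \<in> sets M"
  using arc_sets sets_M by simp

lemma space_eq: "space M = {-pi..pi}"
  using sets_eq_imp_space_eq[OF sets_M] by simp

lemma arc_mono: "r \<le> r' \<Longrightarrow> chord_arc c r \<subseteq> chord_arc c r'"
  by (auto simp: chord_arc_def)

text \<open>The radius is minimal, up to a factor 2, among those of the arcs that carry mass \<open>h\<close> outside \<open>R\<close>. So
  each of the 265 arcs of half the radius that cover the enlarged arc has mass at most \<open>h\<close> outside \<open>R\<close>.\<close>

lemma exists_minimal_arc:
  assumes R: "R \<in> sets M" and h: "h > 0" and big: "h \<le> measure M (space M - R)"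
  shows "\<exists>c r. r > 0 \<and> h \<le> measure M (chord_arc c r - R) \<and> measure M (chord_arc c (33 * r) - R) \<le> 265 * h"
proof -
  define P where "P n \<longleftrightarrow> (\<exists>c. h \<le> measure M (chord_arc c (2 / 2 ^ n) - R))" for n :: nat
  have le2: "cmod (cis x - cis y) \<le> 2" for x y
    using norm_triangle_ineq4[of "cis x" "cis y"] by simp
  \<comment> \<open>The radii are \<open>2 / 2 ^ n\<close>: no chord is longer than 2, so the first arc is the whole circle.\<close>
  have "chord_arc 0 2 = space M" using le2[of _ 0] by (auto simp: chord_arc_def space_eq)
  then have P0: "P 0" unfolding P_def using big by (intro exI[of _ 0]) simp
  obtain \<rho> where rho: "\<rho> > 0" "\<And>c. measure M (chord_arc c \<rho>) < h" using small_arcs[OF h] by blast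
  obtain N :: nat where N: "2 / \<rho> < 2 ^ N" using real_arch_pow[of 2 "2 / \<rho>"] by auto
  have nP: "n \<le> N" if "P n" for n
  proof (rule ccontr)
    assume "\<not> n \<le> N"
    then have "(2::real) ^ N \<le> 2 ^ n" by (intro power_increasing) auto
    with N have "2 / \<rho> < 2 ^ n" by linarith
    then have "2 / 2 ^ n \<le> \<rho>" using rho(1) by (simp add: field_simps)
    then have "measure M (chord_arc c (2 / 2 ^ n) - R) \<le> measure M (chord_arc c \<rho>)" for c
      using arc_mono[of "2 / 2 ^ n" \<rho> c] by (intro finite_measure_mono) auto
    with rho(2) that show False unfolding P_def by (meson leD le_less_trans)
  qed
  define n where "n = (GREATEST n. P n)"
  have n: "P n" unfolding n_def by (rule GreatestI_nat[of P, OF P0]) (use nP in auto)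
  have "\<not> P (Suc n)"
    using Greatest_le_nat[of P "Suc n" N] nP unfolding n_def by force
  obtain c where c: "h \<le> measure M (chord_arc c (2 / 2 ^ n) - R)" using n unfolding P_def by blast
  define r :: real where "r = 2 / 2 ^ n"
  have r: "r > 0" "r / 2 = 2 / 2 ^ Suc n" by (auto simp: r_def)
  have small: "measure M (chord_arc d (r / 2) - R) \<le> h" for d
    using \<open>\<not> P (Suc n)\<close> unfolding P_def r(2) by (meson le_cases)
  have "measure M (chord_arc c (33 * r) - R)
      \<le> measure M (\<Union>i\<in>{-132..132::int}. chord_arc (c + of_int i * (r / 2)) (r / 2) - R)"
    using arc_cover[OF r(1), of c] R by (intro finite_measure_mono sets.finite_UN) auto
  also have "\<dots> \<le> (\<Sum>i\<in>{-132..132::int}. measure M (chord_arc (c + of_int i * (r / 2)) (r / 2) - R))"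
    using R by (intro finite_measure_subadditive_finite) auto
  also have "\<dots> \<le> (\<Sum>i\<in>{-132..132::int}. h)" by (intro sum_mono small)
  finally show ?thesis using c r(1) unfolding r_def[symmetric] by auto
qed

text \<open>As long as fewer than \<open>K\<close> arcs are chosen, their enlargements have taken so little mass that at least
  \<open>h\<close> is left for the next one.\<close>

lemma greedy_arcs:
  assumes h: "h > 0" and K: "real K * (265 * h) + h \<le> measure M (space M)"
  shows "\<exists>c r. \<forall>k<K. r k > 0 \<and>
    h \<le> measure M (chord_arc (c k) (r k) - (\<Union>j<k. chord_arc (c j) (33 * r j)))"
proof -
  have "\<exists>c r. (\<forall>k<L. r k > 0 \<and> h \<le> measure M (chord_arc (c k) (r k) - (\<Union>j<k. chord_arc (c j) (33 * r j))))
      \<and> measure M (\<Union>j<L. chord_arc (c j) (33 * r j)) \<le> real L * (265 * h)" if "L \<le> K" for L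
    using that
  proof (induction L)
    case 0
    then show ?case by simp
  next
    case (Suc L)
    then obtain c r where IH: "\<And>k. k < L \<Longrightarrow> r k > 0"
        "\<And>k. k < L \<Longrightarrow> h \<le> measure M (chord_arc (c k) (r k) - (\<Union>j<k. chord_arc (c j) (33 * r j)))"
        "measure M (\<Union>j<L. chord_arc (c j) (33 * r j)) \<le> real L * (265 * h)"
      by auto
    let ?R = "\<Union>j<L. chord_arc (c j) (33 * r j)"
    have R: "?R \<in> sets M" by auto
    have "real L * (265 * h) \<le> real K * (265 * h)" using Suc.prems h by (intro mult_right_mono) auto
    then have "h \<le> measure M (space M) - measure M ?R" using IH(3) K by linarith
    also have "\<dots> = measure M (space M - ?R)" using R by (rule finite_measure_compl[symmetric])
    finally obtain d s where ds: "s > 0" "h \<le> measure M (chord_arc d s - ?R)"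
        "measure M (chord_arc d (33 * s) - ?R) \<le> 265 * h"
      using exists_minimal_arc[OF R h] by blast
    let ?c = "c(L := d)" and ?r = "r(L := s)"
    have eq: "(\<Union>j<k. chord_arc (?c j) (33 * ?r j)) = (\<Union>j<k. chord_arc (c j) (33 * r j))" if "k \<le> L" for k
      using that by (intro SUP_cong) auto
    have "(\<Union>j<Suc L. chord_arc (?c j) (33 * ?r j)) = ?R \<union> (chord_arc d (33 * s) - ?R)"
      unfolding lessThan_Suc using eq[of L] by auto
    then have "measure M (\<Union>j<Suc L. chord_arc (?c j) (33 * ?r j)) \<le> real L * (265 * h) + 265 * h"
      using measure_Un_le[of ?R M "chord_arc d (33 * s) - ?R"] R IH(3) ds(3) by auto
    then have "measure M (\<Union>j<Suc L. chord_arc (?c j) (33 * ?r j)) \<le> real (Suc L) * (265 * h)"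
      by (simp add: algebra_simps)
    moreover have "?r k > 0 \<and> h \<le> measure M (chord_arc (?c k) (?r k) - (\<Union>j<k. chord_arc (?c j) (33 * ?r j)))"
      if "k < Suc L" for k
      using that IH(1,2)[of k] ds eq[of k] by (cases "k = L") auto
    ultimately show ?case by blast
  qed
  from this[OF order_refl] show ?thesis by blast
qed

text \<open>The cutoff of a chosen arc is 1 on the part of the arc outside the earlier enlargements, and this
  part has mass at least \<open>h\<close>. Only the cutoffs of bounded energy are kept.\<close>

lemma disjoint_cutoffs:
  assumes h: "h > 0" and K: "real K * (265 * h) + h \<le> measure M (space M)"
  shows "\<exists>B. finite B \<and> K \<le> 2 * card B \<and> B \<subseteq> C_2pi \<and> (\<forall>v\<in>B. dyadic_energy_le v 256) \<and>
    (\<forall>v\<in>B. h \<le> measure M {x\<in>{-pi..pi}. v x = 1}) \<and>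
    (\<forall>v\<in>B. \<forall>w\<in>B. \<forall>x. v x \<noteq> 0 \<longrightarrow> w x \<noteq> 0 \<longrightarrow> v = w)"
proof -
  obtain c r where r: "\<And>k. k < K \<Longrightarrow> r k > 0"
    and mass: "\<And>k. k < K \<Longrightarrow> h \<le> measure M (chord_arc (c k) (r k) - (\<Union>j<k. chord_arc (c j) (33 * r j)))"
    using greedy_arcs[OF assms] by blast
  have escape: "33 * r j < cmod (cis (c j) - cis (c k)) + r k" if "j < k" "k < K" for j k
  proof (rule ccontr)
    assume *: "\<not> ?thesis"
    have "chord_arc (c k) (r k) \<subseteq> chord_arc (c j) (33 * r j)"
    proof
      fix x assume x: "x \<in> chord_arc (c k) (r k)"
      have "cmod (cis x - cis (c j)) \<le> cmod (cis x - cis (c k)) + cmod (cis (c k) - cis (c j))"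
        using norm_triangle_ineq[of "cis x - cis (c k)" "cis (c k) - cis (c j)"] by simp
      then show "x \<in> chord_arc (c j) (33 * r j)"
        using x * by (simp add: chord_arc_def norm_minus_commute)
    qed
    then have "chord_arc (c k) (r k) - (\<Union>j<k. chord_arc (c j) (33 * r j)) = {}" using that by auto
    with mass[OF that(2)] h show False by simp
  qed
  have dis: "cutoff c r k x = 0" if "j < k" "k < K" "cutoff c r j x \<noteq> 0" for j k x
    using cutoff_disjoint[of K r c, OF r escape that] by blast
  define G where "G = {k. k < K \<and> card (first_met c r k) \<le> 1}"
  have GK: "k < K" if "k \<in> G" for k using that by (simp add: G_def)
  have disj: "k = l" if "k \<in> G" "l \<in> G" "cutoff c r k x \<noteq> 0" "cutoff c r l x \<noteq> 0" for k l x
    using dis[of k l x] dis[of l k x] that GK by (cases k l rule: linorder_cases) auto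
  have m: "h \<le> measure M {x\<in>{-pi..pi}. cutoff c r k x = 1}" if k: "k \<in> G" for k
  proof -
    have "chord_arc (c k) (r k) - (\<Union>j<k. chord_arc (c j) (33 * r j)) \<subseteq> {x\<in>{-pi..pi}. cutoff c r k x = 1}"
      using GK[OF k] r by (auto simp: chord_arc_def not_le intro!: cutoff_eq_1)
    moreover have "{x\<in>{-pi..pi}. cutoff c r k x = 1} \<in> sets M"
    proof -
      have C: "cutoff c r k \<in> C_2pi" using cutoff_regular[of k r c] k GK[OF k] r by (auto simp: G_def)
      have "closed ({-pi..pi} \<inter> {x. cutoff c r k x = 1})"
        by (intro closed_Int closed_Collect_eq continuous_intros C_2pi_continuous[OF C])
      moreover have "{-pi..pi} \<inter> {x. cutoff c r k x = 1} = {x\<in>{-pi..pi}. cutoff c r k x = 1}" by auto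
      ultimately have "{x\<in>{-pi..pi}. cutoff c r k x = 1} \<in> sets lebesgue"
        by (metis closed_in_sets_lebesgue)
      then show ?thesis unfolding sets_M by (auto simp: sets_restrict_space_iff)
    qed
    ultimately have "measure M (chord_arc (c k) (r k) - (\<Union>j<k. chord_arc (c j) (33 * r j)))
        \<le> measure M {x\<in>{-pi..pi}. cutoff c r k x = 1}"
      by (intro finite_measure_mono)
    with mass[OF GK[OF k]] show ?thesis by linarith
  qed
  have inj: "inj_on (cutoff c r) G"
  proof (rule inj_onI)
    fix k l assume kl: "k \<in> G" "l \<in> G" "cutoff c r k = cutoff c r l"
    have "{x\<in>{-pi..pi}. cutoff c r k x = 1} \<noteq> {}" using m[OF kl(1)] h by (metis measure_empty not_less)
    then obtain x where "cutoff c r k x = 1" by auto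
    then show "k = l" using disj[OF kl(1,2), of x] kl(3) by simp
  qed
  show ?thesis
  proof (intro exI[of _ "cutoff c r ` G"] conjI ballI allI impI)
    show "finite (cutoff c r ` G)" by (simp add: G_def)
    show "K \<le> 2 * card (cutoff c r ` G)"
      using many_light_arcs[of K c r] unfolding card_image[OF inj] by (simp only: G_def)
    show "cutoff c r ` G \<subseteq> C_2pi"
      using cutoff_regular r by (force simp: G_def)
    show "dyadic_energy_le v 256" if "v \<in> cutoff c r ` G" for v
      using that cutoff_regular[of _ r c] r by (force simp: G_def)
    show "h \<le> measure M {x\<in>{-pi..pi}. v x = 1}" if "v \<in> cutoff c r ` G" for v
      using that m by auto
    show "v = w" if "v \<in> cutoff c r ` G" "w \<in> cutoff c r ` G" "v x \<noteq> 0" "w x \<noteq> 0" for v w x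
      using that disj by blast
  qed
qed

end

lemma measure_arc_le:
  assumes r: "r > 0"
  shows "measure (lebesgue_on {-pi..pi}) (chord_arc c r) \<le> 8 * r"
proof -
  have b: "integrable (lebesgue_on {-pi..pi}) (bump c r)"
    by (intro continuous_imp_integrable_real C_2pi_continuous bump_C_2pi r)
  have "measure (lebesgue_on {-pi..pi}) (chord_arc c r) = (LINT x|lebesgue_on {-pi..pi}. indicat_real (chord_arc c r) x)"
    using arc_sets[of c r, THEN sets.sets_into_space] by (simp add: Int_absorb2)
  also have "\<dots> \<le> (LINT x|lebesgue_on {-pi..pi}. bump c r x)"
  proof (rule Bochner_Integration.integral_mono[OF _ b])
    have "emeasure (lebesgue_on {-pi..pi}) (chord_arc c r) \<le> emeasure (lebesgue_on {-pi..pi}) (space (lebesgue_on {-pi..pi}))"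
      by (rule emeasure_space)
    also have "\<dots> < \<infinity>" by (simp add: emeasure_restrict_space)
    finally show "integrable (lebesgue_on {-pi..pi}) (indicat_real (chord_arc c r))"
      using arc_sets[of c r] arc_sets[of c r, THEN sets.sets_into_space]
      by (simp add: integrable_indicator_iff Int_absorb2)
    show "indicat_real (chord_arc c r) x \<le> bump c r x" for x
      using bump_eq_1[OF r, of x c] bump_bounds[of c r x] by (auto simp: indicator_def chord_arc_def)
  qed
  also have "\<dots> = integral {-pi..pi} (bump c r)"
    by (rule LINT_eq_integral_continuous) (intro C_2pi_continuous bump_C_2pi r)
  also have "\<dots> \<le> 8 * r" by (rule bump_integral_le[OF r])
  finally show ?thesis .
qed

text \<open>Absolute continuity of the integral: the part of \<open>V\<close> above a high level has a small integral,
  and the part below that level has little mass on short arcs.\<close>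

lemma small_arc_integral:
  fixes V :: "real \<Rightarrow> real"
  assumes V: "integrable (lebesgue_on {-pi..pi}) V" and h: "h > 0"
  shows "\<exists>\<rho>>0. \<forall>c. (LINT t|lebesgue_on {-pi..pi}. indicator (chord_arc c \<rho>) t * \<bar>V t\<bar>) < h"
proof -
  let ?L = "lebesgue_on {-pi..pi}"
  define f where "f n t = max 0 (\<bar>V t\<bar> - real n)" for n :: nat and t :: real
  have fi: "integrable ?L (f n)" for n
    unfolding f_def
    by (rule Bochner_Integration.integrable_bound[of _ "\<lambda>t. \<bar>V t\<bar>"]) (use V in auto)
  have "(\<lambda>n. LINT t|?L. f n t) \<longlonglongrightarrow> (LINT t|?L. 0)"
  proof (rule integral_dominated_convergence[where w = "\<lambda>t. \<bar>V t\<bar>"])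
    show "AE t in ?L. (\<lambda>n. f n t) \<longlonglongrightarrow> 0"
    proof (rule AE_I2)
      fix t
      obtain N :: nat where N: "\<bar>V t\<bar> \<le> real N" using real_arch_simple by blast
      show "(\<lambda>n. f n t) \<longlonglongrightarrow> 0"
        by (rule tendsto_eventually)
          (use N in \<open>auto simp: f_def max_def intro!: eventually_sequentiallyI[of N]\<close>)
    qed
  qed (use V fi in \<open>auto simp: f_def\<close>)
  then have "\<forall>\<^sub>F n in sequentially. (LINT t|?L. f n t) < h / 2"
    using h by (intro order_tendstoD(2)) auto
  then obtain n where n: "(LINT t|?L. f n t) < h / 2"
    by (meson eventually_happens trivial_limit_sequentially)
  define \<rho> where "\<rho> = h / (16 * (real n + 1))"
  have rho: "\<rho> > 0" using h by (simp add: \<rho>_def)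
  have "(LINT t|?L. indicator (chord_arc c \<rho>) t * \<bar>V t\<bar>) < h" for c
  proof -
    have A: "integrable ?L (indicat_real (chord_arc c \<rho>))"
      by (rule Bochner_Integration.integrable_bound[OF continuous_imp_integrable_real[of "-pi" pi "\<lambda>_. 1::real"]])
        (use arc_sets[of c \<rho>] in \<open>auto simp: indicator_def\<close>)
    have "integrable ?L (\<lambda>t. \<bar>V t\<bar> * indicat_real (chord_arc c \<rho>) t)"
      using V by (intro integrable_real_mult_indicator arc_sets) auto
    then have "(LINT t|?L. indicator (chord_arc c \<rho>) t * \<bar>V t\<bar>) \<le> (LINT t|?L. f n t + real n * indicator (chord_arc c \<rho>) t)"
      using fi[of n] A
      by (intro Bochner_Integration.integral_mono Bochner_Integration.integrable_add
          integrable_mult_right)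
        (auto simp: mult.commute split: split_indicator, auto simp: f_def)
    also have "\<dots> = (LINT t|?L. f n t) + real n * measure ?L (chord_arc c \<rho>)"
      using fi A arc_sets[of c \<rho>, THEN sets.sets_into_space] by (simp add: Int_absorb2)
    also have "\<dots> \<le> (LINT t|?L. f n t) + real n * (8 * \<rho>)"
      using measure_arc_le[OF rho, of c] by (intro add_left_mono mult_left_mono) auto
    also have "real n * (8 * \<rho>) \<le> h / 2"
      using h unfolding \<rho>_def by (simp add: field_simps)
    finally show ?thesis using n by linarith
  qed
  with rho show ?thesis by blast
qed

lemma measure_density_real:
  fixes V :: "'a \<Rightarrow> real"
  assumes V: "integrable M V" "AE t in M. 0 \<le> V t" and A: "A \<in> sets M"
  shows "measure (density M (\<lambda>t. ennreal (V t))) A = (LINT t|M. indicator A t * V t)"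
proof -
  have i: "integrable M (\<lambda>t. indicator A t * V t)"
    using integrable_real_mult_indicator[OF A V(1)] by (simp add: mult.commute)
  have "emeasure (density M (\<lambda>t. ennreal (V t))) A = (\<integral>\<^sup>+t. ennreal (V t) * indicator A t \<partial>M)"
    using V A by (intro emeasure_density) auto
  also have "\<dots> = (\<integral>\<^sup>+t. ennreal (indicator A t * V t) \<partial>M)"
    by (intro nn_integral_cong) (auto split: split_indicator)
  also have "\<dots> = ennreal (LINT t|M. indicator A t * V t)"
    by (rule nn_integral_eq_integral[OF i]) (use V(2) in \<open>auto split: split_indicator\<close>)
  moreover have "0 \<le> (LINT t|M. indicator A t * V t)"
    by (rule integral_nonneg_AE) (use V(2) in \<open>auto split: split_indicator\<close>)
  ultimately show ?thesis by (simp add: measure_def)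
qed

lemma circle_measure_density:
  assumes V: "integrable (lebesgue_on {-pi..pi}) V" "AE t in lebesgue_on {-pi..pi}. 0 \<le> V t"
  shows "circle_measure (density (lebesgue_on {-pi..pi}) (\<lambda>t. ennreal (V t)))"
proof -
  let ?L = "lebesgue_on {-pi..pi}"
  let ?M = "density ?L (\<lambda>t. ennreal (V t))"
  have "emeasure ?M (space ?M) = (\<integral>\<^sup>+t. ennreal (V t) * indicator (space ?L) t \<partial>?L)"
    using V(1) by (simp only: space_density) (intro emeasure_density, auto)
  also have "\<dots> = (\<integral>\<^sup>+t. ennreal (V t) \<partial>?L)"
    by (intro nn_integral_cong) (auto split: split_indicator)
  also have "\<dots> = ennreal (LINT t|?L. V t)" by (rule nn_integral_eq_integral[OF V])
  finally have fin: "finite_measure ?M" by (intro finite_measureI) simp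
  have "\<exists>\<rho>>0. \<forall>c. measure ?M (chord_arc c \<rho>) < h" if h: "h > 0" for h
  proof -
    obtain \<rho> where rho: "\<rho> > 0" "\<And>c. (LINT t|?L. indicator (chord_arc c \<rho>) t * \<bar>V t\<bar>) < h"
      using small_arc_integral[OF V(1) h] by blast
    have "measure ?M (chord_arc c \<rho>) = (LINT t|?L. indicator (chord_arc c \<rho>) t * \<bar>V t\<bar>)" for c
      unfolding measure_density_real[OF V arc_sets]
      by (rule Bochner_Integration.integral_cong_AE)
        (use V arc_sets[of c \<rho>] in \<open>auto intro!: borel_measurable_times\<close>)
    with rho show ?thesis by auto
  qed
  then show ?thesis
    using fin by (intro circle_measure.intro circle_measure_axioms.intro) auto
qed

text \<open>A constant has no energy.\<close>

lemma constant_test: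
  assumes V: "integrable (lebesgue_on {-pi..pi}) V" and pos: "0 < (LINT t|lebesgue_on {-pi..pi}. V t)"
  shows "1 \<le> N_minus Dom_qform (qform V)"
proof -
  have "enat (card {\<lambda>_::real. 1::real}) \<le> N_minus Dom_qform (qform V)"
    by (rule N_minus_ge_of_disjoint[OF V, where E = 0])
      (use pos in \<open>auto simp: C_2pi_def periodic_2pi_def dyadic_energy_le_def dyadic_diff_def\<close>)
  then show ?thesis by (simp add: one_enat_def)
qed

text \<open>The mass threshold \<open>h = 8193\<close> exceeds \<open>32 * 256\<close>, the requirement of \<open>N_minus_ge_of_disjoint\<close> for
  cutoffs of energy 256. If the mass is at least \<open>2120 * h\<close>, where \<open>2120 = 8 * 265\<close>, the greedy choice uses
  half of the mass and loses the rest of the factor by keeping half of the arcs and by rounding;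
  otherwise one negative direction is enough.\<close>

lemma N_minus_lower_bound:
  assumes V: "integrable (lebesgue_on {-pi..pi}) V" "AE t in lebesgue_on {-pi..pi}. 0 \<le> V t"
  defines "m \<equiv> LINT t|lebesgue_on {-pi..pi}. V t"
  shows "ereal (m / (2120 * 8193)) \<le> ereal_of_enat (N_minus Dom_qform (qform V))"
proof -
  let ?L = "lebesgue_on {-pi..pi}"
  let ?M = "density ?L (\<lambda>t. ennreal (V t))"
  let ?N = "N_minus Dom_qform (qform V)"
  define h :: real where "h = 8193"
  interpret circle_measure ?M by (rule circle_measure_density[OF V])
  have mass: "measure ?M (space ?M) = m"
  proof -
    have "measure ?M (space ?M) = (LINT t|?L. indicator (space ?L) t * V t)"
      unfolding space_density by (rule measure_density_real[OF V]) auto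
    also have "\<dots> = m"
      unfolding m_def by (rule Bochner_Integration.integral_cong) auto
    finally show ?thesis .
  qed
  then have m0: "0 \<le> m" using measure_nonneg by metis
  have *: "ereal x \<le> ereal_of_enat ?N" if "x \<le> real n" "enat n \<le> ?N" for x n
  proof -
    have "ereal x \<le> ereal_of_enat (enat n)" using that(1) by simp
    also have "\<dots> \<le> ereal_of_enat ?N" using that(2) by (simp only: ereal_of_enat_le_iff)
    finally show ?thesis .
  qed
  consider "m = 0" | "0 < m" "m \<le> 2120 * h" | "2120 * h < m" using m0 by linarith
  then show ?thesis
  proof cases
    case 1
    then show ?thesis using *[of 0 0] by (simp add: zero_enat_def[symmetric])
  next
    case 2
    then show ?thesis
      using *[of "m / (2120 * 8193)" 1] constant_test[OF V(1)] by (simp add: m_def h_def one_enat_def)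
  next
    case 3
    define K where "K = nat \<lfloor>m / (530 * h)\<rfloor>"
    have K: "real K \<le> m / (530 * h)" "m / (530 * h) - 1 \<le> real K"
      unfolding K_def using m0 by (auto simp: h_def) linarith+
    have "real K * (530 * h) \<le> m" using K(1) by (simp add: h_def field_simps)
    then have "real K * (265 * h) + h \<le> measure ?M (space ?M)"
      unfolding mass using 3 by (simp add: h_def)
    then obtain B where B: "finite B" "K \<le> 2 * card B" "B \<subseteq> C_2pi" "\<And>v. v \<in> B \<Longrightarrow> dyadic_energy_le v 256"
        "\<And>v. v \<in> B \<Longrightarrow> h \<le> measure ?M {x\<in>{-pi..pi}. v x = 1}"
        "\<And>v w x. v \<in> B \<Longrightarrow> w \<in> B \<Longrightarrow> v x \<noteq> 0 \<Longrightarrow> w x \<noteq> 0 \<Longrightarrow> v = w"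
      using disjoint_cutoffs[of h K] by (auto simp: h_def)
    have "enat (card B) \<le> ?N"
    proof (rule N_minus_ge_of_disjoint[OF V(1) B(1,3,4,6)])
      fix v assume v: "v \<in> B"
      let ?S = "{x\<in>{-pi..pi}. v x = 1}"
      have vC: "v \<in> C_2pi" using v B by blast
      have "?S \<in> sets ?M"
      proof (rule ccontr)
        assume "?S \<notin> sets ?M"
        then have "measure ?M ?S = 0" by (rule measure_notin_sets)
        with B(5)[OF v] show False by (simp add: h_def)
      qed
      then have S: "?S \<in> sets ?L" by simp
      have "32 * 256 < h" by (simp add: h_def)
      also have "h \<le> measure ?M ?S" by (rule B(5)[OF v])
      also have "\<dots> = (LINT t|?L. indicator ?S t * V t)" by (rule measure_density_real[OF V S])
      also have "\<dots> \<le> (LINT t|?L. V t * (v t)\<^sup>2)"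
      proof (rule integral_mono_AE)
        show "integrable ?L (\<lambda>t. indicator ?S t * V t)"
          using integrable_real_mult_indicator[OF S V(1)] by (simp add: mult.commute)
        show "integrable ?L (\<lambda>t. V t * (v t)\<^sup>2)"
          by (intro integrable_mult_continuous[OF V(1)] continuous_intros C_2pi_continuous vC)
        show "AE t in ?L. indicator ?S t * V t \<le> V t * (v t)\<^sup>2"
          using V(2) by eventually_elim (auto simp: indicator_def)
      qed
      finally show "32 * 256 < (LINT t|?L. V t * (v t)\<^sup>2)" .
    qed simp_all
    moreover have "m / (2120 * 8193) \<le> real (card B)"
    proof -
      have "m / (530 * h) - 1 \<le> 2 * real (card B)" using K(2) B(2) by linarith
      then show ?thesis using 3 by (simp add: h_def field_simps)
    qed
    ultimately show ?thesis by (intro *)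
  qed
qed

section \<open>An exponential inequality on intervals\<close>

text \<open>Half of the square of the Gagliardo seminorm of order 1/2 on the interval.\<close>

definition gagliardo :: "(real \<Rightarrow> real) \<Rightarrow> real \<Rightarrow> real \<Rightarrow> ennreal" where
  "gagliardo u a b = (\<integral>\<^sup>+x. \<integral>\<^sup>+y.
     (if a < x \<and> x < y \<and> y < b then ennreal ((u y - u x)\<^sup>2 / (y - x)\<^sup>2) else 0) \<partial>lborel \<partial>lborel)"

lemma nn_integral_iterated_add:
  assumes [measurable]: "case_prod f \<in> borel_measurable (lborel \<Otimes>\<^sub>M lborel)"
    "case_prod g \<in> borel_measurable (lborel \<Otimes>\<^sub>M lborel)"
  shows "(\<integral>\<^sup>+x. \<integral>\<^sup>+y. f x y \<partial>lborel \<partial>lborel) + (\<integral>\<^sup>+x. \<integral>\<^sup>+y. g x y \<partial>lborel \<partial>lborel)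
     = (\<integral>\<^sup>+x. \<integral>\<^sup>+y. f x y + g x y \<partial>lborel \<partial>(lborel :: real measure))" (is "?L = ?R")
proof -
  have "?R = (\<integral>\<^sup>+x. (\<integral>\<^sup>+y. f x y \<partial>lborel) + (\<integral>\<^sup>+y. g x y \<partial>lborel) \<partial>lborel)"
    by (intro nn_integral_cong nn_integral_add; measurable)
  also have "\<dots> = ?L" by (intro nn_integral_add; measurable)
  finally show ?thesis by simp
qed

definition mean :: "(real \<Rightarrow> real) \<Rightarrow> real \<Rightarrow> real \<Rightarrow> real" where
  "mean u a b = integral {a..b} u / (b - a)"

lemma nn_integral_continuous_Ioo:
  fixes f :: "real \<Rightarrow> real"
  assumes f: "continuous_on UNIV f" and nn: "\<And>x. 0 \<le> f x"
  shows "(\<integral>\<^sup>+x. ennreal (f x) * indicator {a<..<b} x \<partial>lborel) = ennreal (integral {a..b} f)"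
proof -
  have [measurable]: "f \<in> borel_measurable borel" by (rule borel_measurable_continuous_onI[OF f])
  have "(f has_integral integral {a..b} f) {a..b}"
    by (intro integrable_integral integrable_continuous_interval continuous_on_subset[OF f]) auto
  then have "(f has_integral integral {a..b} f) {a<..<b}"
    by (simp add: has_integral_Icc_iff_Ioo)
  then have "((\<lambda>x. if x \<in> {a<..<b} then f x else 0) has_integral integral {a..b} f) UNIV"
    by (subst has_integral_restrict_UNIV)
  then have "(\<integral>\<^sup>+x. ennreal (if x \<in> {a<..<b} then f x else 0) \<partial>lborel) = ennreal (integral {a..b} f)"
    by (intro nn_integral_has_integral_lborel) (use nn in auto)
  moreover have "ennreal (if x \<in> {a<..<b} then f x else 0) = ennreal (f x) * indicator {a<..<b} x" for x
    by (auto split: split_indicator)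
  ultimately show ?thesis by simp
qed

text \<open>Jensen's inequality for the square, obtained by integrating the tangent line inequality
  \<open>2 * d * e - d\<^sup>2 \<le> e\<^sup>2\<close>.\<close>

lemma mean_square_deviation:
  assumes ab: "a < b" and u: "continuous_on UNIV u"
  shows "(b - a) * (mean u a b - c)\<^sup>2 \<le> integral {a..b} (\<lambda>x. (u x - c)\<^sup>2)"
proof -
  let ?m = "mean u a b"
  have int: "u integrable_on {a..b}"
    by (intro integrable_continuous_interval continuous_on_subset[OF u]) auto
  have "((\<lambda>x. 2 * (?m - c) * (u x - c) - (?m - c)\<^sup>2) has_integral
      (2 * (?m - c) * (integral {a..b} u - c * (b - a)) - (?m - c)\<^sup>2 * (b - a))) {a..b}"
    using ab has_integral_const_real[of c a b] has_integral_const_real[of "(?m - c)\<^sup>2" a b]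
    by (intro has_integral_diff has_integral_mult_right integrable_integral int) (auto simp: mult.commute)
  moreover have "((\<lambda>x. (u x - c)\<^sup>2) has_integral integral {a..b} (\<lambda>x. (u x - c)\<^sup>2)) {a..b}"
    by (intro integrable_integral integrable_continuous_interval continuous_intros continuous_on_subset[OF u]) auto
  moreover have "2 * d * e - d\<^sup>2 \<le> e\<^sup>2" for d e :: real
    using zero_le_power2[of "d - e"] by (simp add: power2_eq_square algebra_simps)
  ultimately have "2 * (?m - c) * (integral {a..b} u - c * (b - a)) - (?m - c)\<^sup>2 * (b - a)
      \<le> integral {a..b} (\<lambda>x. (u x - c)\<^sup>2)"
    by (rule has_integral_le)
  moreover have "integral {a..b} u = ?m * (b - a)" using ab by (simp add: mean_def)
  ultimately show ?thesis by (simp add: power2_eq_square algebra_simps)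
qed

text \<open>Besides the pairs within one half, the double integral contains the pairs from different halves.
  Their distance is at most \<open>b - a\<close>, so that by Jensen's inequality in both variables they contribute at
  least the square of the martingale increment.\<close>

lemma gagliardo_split:
  assumes ab: "a < b" and u: "continuous_on UNIV u"
  defines "m \<equiv> (a + b) / 2"
  shows "gagliardo u a m + gagliardo u m b + ennreal (((mean u m b - mean u a m) / 2)\<^sup>2)
    \<le> gagliardo u a b"
proof -
  have m: "a < m" "m < b" "m - a = (b - a) / 2" "b - m = (b - a) / 2"
    using ab by (auto simp: m_def field_simps)
  have [measurable]: "u \<in> borel_measurable borel" by (rule borel_measurable_continuous_onI[OF u])
  define d where "d = (mean u m b - mean u a m) / 2"
  let ?F = "\<lambda>x y. ennreal ((u y - u x)\<^sup>2 / (y - x)\<^sup>2)"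
  let ?G = "\<lambda>a b x y. if a < x \<and> x < y \<and> y < b then ?F x y else 0"
  let ?H = "\<lambda>x y. if a < x \<and> x < m \<and> m < y \<and> y < b then ?F x y else 0"
  have cross: "ennreal (d\<^sup>2) \<le> (\<integral>\<^sup>+x. \<integral>\<^sup>+y. ?H x y \<partial>lborel \<partial>lborel)"
  proof -
    have in1: "ennreal ((b - m) * (mean u m b - u x)\<^sup>2 / (b - a)\<^sup>2) * indicator {a<..<m} x
        \<le> (\<integral>\<^sup>+y. ?H x y \<partial>lborel)" for x
    proof (cases "x \<in> {a<..<m}")
      case True
      have "ennreal ((b - m) * (mean u m b - u x)\<^sup>2 / (b - a)\<^sup>2)
          \<le> ennreal (integral {m..b} (\<lambda>y. (u y - u x)\<^sup>2 / (b - a)\<^sup>2))"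
        using mean_square_deviation[OF m(2) u, of "u x"]
        by (intro ennreal_leI) (simp add: divide_right_mono)
      also have "\<dots> = (\<integral>\<^sup>+y. ennreal ((u y - u x)\<^sup>2 / (b - a)\<^sup>2) * indicator {m<..<b} y \<partial>lborel)"
        by (rule nn_integral_continuous_Ioo[symmetric]) (use ab in \<open>auto intro!: continuous_intros u\<close>)
      also have "\<dots> \<le> (\<integral>\<^sup>+y. ?H x y \<partial>lborel)"
      proof (rule nn_integral_mono)
        fix y
        show "ennreal ((u y - u x)\<^sup>2 / (b - a)\<^sup>2) * indicator {m<..<b} y \<le> ?H x y"
        proof (cases "y \<in> {m<..<b}")
          case y: True
          have "(y - x)\<^sup>2 \<le> (b - a)\<^sup>2" using True y by (intro power_mono) auto
          then have "(u y - u x)\<^sup>2 / (b - a)\<^sup>2 \<le> (u y - u x)\<^sup>2 / (y - x)\<^sup>2"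
            using True y by (intro divide_left_mono) auto
          then show ?thesis using True y by (simp add: ennreal_leI)
        qed simp
      qed
      finally show ?thesis using True by simp
    qed simp
    have "d\<^sup>2 \<le> integral {a..m} (\<lambda>x. (b - m) * (mean u m b - u x)\<^sup>2 / (b - a)\<^sup>2)"
    proof -
      have "(m - a) * (mean u a m - mean u m b)\<^sup>2 \<le> integral {a..m} (\<lambda>x. (u x - mean u m b)\<^sup>2)"
        by (rule mean_square_deviation[OF m(1) u])
      then have "(b - m) / (b - a)\<^sup>2 * ((m - a) * (mean u a m - mean u m b)\<^sup>2)
          \<le> (b - m) / (b - a)\<^sup>2 * integral {a..m} (\<lambda>x. (u x - mean u m b)\<^sup>2)"
        by (rule mult_left_mono) (use m(2) in auto)
      moreover have "(b - m) / (b - a)\<^sup>2 * ((m - a) * (mean u a m - mean u m b)\<^sup>2) = d\<^sup>2"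
      proof -
        have "L / 2 / L\<^sup>2 * (L / 2 * X) = X / 4" if "L \<noteq> 0" for L X :: real
          using that by (simp add: power2_eq_square)
        moreover have "b - a \<noteq> 0" using ab by simp
        ultimately have "(b - a) / 2 / (b - a)\<^sup>2 * ((b - a) / 2 * X) = X / 4" for X by blast
        then show ?thesis
          unfolding m(3,4) d_def by (simp add: power_divide power2_commute)
      qed
      ultimately show ?thesis
        by (simp add: power2_commute[of "mean u m b"] flip: integral_mult_right)
    qed
    then have "ennreal (d\<^sup>2) \<le> ennreal (integral {a..m} (\<lambda>x. (b - m) * (mean u m b - u x)\<^sup>2 / (b - a)\<^sup>2))"
      by (rule ennreal_leI)
    also have "\<dots> = (\<integral>\<^sup>+x. ennreal ((b - m) * (mean u m b - u x)\<^sup>2 / (b - a)\<^sup>2) * indicator {a<..<m} x \<partial>lborel)"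
      by (rule nn_integral_continuous_Ioo[symmetric]) (use m ab in \<open>auto intro!: continuous_intros u\<close>)
    also have "\<dots> \<le> (\<integral>\<^sup>+x. \<integral>\<^sup>+y. ?H x y \<partial>lborel \<partial>lborel)"
      by (intro nn_integral_mono in1)
    finally show ?thesis .
  qed
  have "gagliardo u a m + gagliardo u m b + ennreal (d\<^sup>2)
     \<le> gagliardo u a m + gagliardo u m b + (\<integral>\<^sup>+x. \<integral>\<^sup>+y. ?H x y \<partial>lborel \<partial>lborel)"
    by (intro add_left_mono cross)
  also have "\<dots> = (\<integral>\<^sup>+x. \<integral>\<^sup>+y. (?G a m x y + ?G m b x y) + ?H x y \<partial>lborel \<partial>lborel)"
    unfolding gagliardo_def
    by (subst nn_integral_iterated_add, measurable, subst nn_integral_iterated_add, measurable)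
  also have "\<dots> \<le> gagliardo u a b"
    unfolding gagliardo_def
    by (intro nn_integral_mono) (use m in auto)
  finally show ?thesis unfolding d_def .
qed

lemma gagliardo_add_le:
  assumes u: "continuous_on UNIV u" and m: "a \<le> m" "m \<le> b"
  shows "gagliardo u a m + gagliardo u m b \<le> gagliardo u a b"
proof -
  have [measurable]: "u \<in> borel_measurable borel" by (rule borel_measurable_continuous_onI[OF u])
  show ?thesis
    unfolding gagliardo_def
    by (subst nn_integral_iterated_add, measurable, intro nn_integral_mono) (use m in auto)
qed

text \<open>The derivative of \<open>x\<^sup>2 / 2 - ln (cosh x)\<close> is \<open>x - tanh x\<close>, whose derivative is \<open>(tanh x)\<^sup>2\<close>.\<close>

lemma cosh_le_exp_half_square: "cosh (y::real) \<le> exp (y\<^sup>2 / 2)"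
proof -
  have tanh_le: "tanh x \<le> x" if "0 \<le> x" for x :: real
  proof -
    have "0 - tanh 0 \<le> x - tanh x"
      by (rule DERIV_nonneg_imp_nondecreasing[OF that, of "\<lambda>x. x - tanh x"])
        (auto intro!: derivative_eq_intros exI)
    then show ?thesis by simp
  qed
  have pos: "cosh x \<le> exp (x\<^sup>2 / 2)" if "0 \<le> x" for x :: real
  proof -
    have "0\<^sup>2 / 2 - ln (cosh 0) \<le> x\<^sup>2 / 2 - ln (cosh x)"
    proof (rule DERIV_nonneg_imp_nondecreasing[OF that, of "\<lambda>x. x\<^sup>2 / 2 - ln (cosh x)"])
      fix z :: real assume "0 \<le> z" "z \<le> x"
      have "((\<lambda>x. x\<^sup>2 / 2 - ln (cosh x)) has_real_derivative z - tanh z) (at z)"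
        by (auto intro!: derivative_eq_intros simp: tanh_def)
      then show "\<exists>y. ((\<lambda>x. x\<^sup>2 / 2 - ln (cosh x)) has_real_derivative y) (at z) \<and> 0 \<le> y"
        using tanh_le[OF \<open>0 \<le> z\<close>] by auto
    qed
    then have "ln (cosh x) \<le> x\<^sup>2 / 2" by simp
    then show ?thesis using cosh_real_pos[of x] by (metis exp_le_cancel_iff exp_ln)
  qed
  show ?thesis using pos[of y] pos[of "-y"] by (cases "0 \<le> y") auto
qed

text \<open>The function \<open>exp (m\<^sup>2 / (4 - 2 * s) + s / 2)\<close> bounds the mean of \<open>exp (X\<^sup>2 / 4)\<close> for a martingale
  started at \<open>m\<close> whose squared increments add up to at most \<open>s\<close>. Up to the second summand, which
  replaces a logarithm, it is the value for a normal variable of mean \<open>m\<close> and variance \<open>s\<close>. One step of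
  the martingale replaces \<open>m\<close> by \<open>m - d\<close> or \<open>m + d\<close> and leaves \<open>s - d\<^sup>2\<close> for the further steps.\<close>

lemma gaussian_step:
  fixes m d s :: real
  assumes s: "0 \<le> s" "s \<le> 1" "d\<^sup>2 \<le> s"
  shows "(exp ((m - d)\<^sup>2 / (4 - 2 * (s - d\<^sup>2)) + (s - d\<^sup>2) / 2) + exp ((m + d)\<^sup>2 / (4 - 2 * (s - d\<^sup>2)) + (s - d\<^sup>2) / 2)) / 2
    \<le> exp (m\<^sup>2 / (4 - 2 * s) + s / 2)"
proof -
  define a b where "a = 4 - 2 * s" and "b = a + 2 * d\<^sup>2"
  have a: "2 \<le> a" "a \<le> b" using s by (auto simp: a_def b_def)
  have bb: "4 - 2 * (s - d\<^sup>2) = b" by (simp add: a_def b_def)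
  have sq: "(m - d)\<^sup>2 / b + (s - d\<^sup>2) / 2 = ((m\<^sup>2 + d\<^sup>2) / b + (s - d\<^sup>2) / 2) + - (2 * m * d / b)"
    "(m + d)\<^sup>2 / b + (s - d\<^sup>2) / 2 = ((m\<^sup>2 + d\<^sup>2) / b + (s - d\<^sup>2) / 2) + 2 * m * d / b"
    by (auto simp: power2_eq_square add_divide_distrib diff_divide_distrib algebra_simps)
  have "(exp ((m - d)\<^sup>2 / b + (s - d\<^sup>2) / 2) + exp ((m + d)\<^sup>2 / b + (s - d\<^sup>2) / 2)) / 2
      = exp ((m\<^sup>2 + d\<^sup>2) / b + (s - d\<^sup>2) / 2) * cosh (2 * m * d / b)"
    unfolding sq exp_add cosh_def by (simp add: algebra_simps)
  also have "\<dots> \<le> exp ((m\<^sup>2 + d\<^sup>2) / b + (s - d\<^sup>2) / 2) * exp ((2 * m * d / b)\<^sup>2 / 2)"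
    by (intro mult_left_mono cosh_le_exp_half_square) auto
  also have "\<dots> = exp ((m\<^sup>2 + d\<^sup>2) / b + (s - d\<^sup>2) / 2 + (2 * m * d / b)\<^sup>2 / 2)"
    by (rule exp_add[symmetric])
  also have "\<dots> \<le> exp (m\<^sup>2 / a + s / 2)"
  proof -
    have 1: "d\<^sup>2 / b \<le> d\<^sup>2 / 2" using a by (intro divide_left_mono) auto
    have "m\<^sup>2 * (2 * d\<^sup>2) / (b * b) \<le> m\<^sup>2 * (2 * d\<^sup>2) / (a * b)"
      using a by (intro divide_left_mono mult_right_mono) auto
    also have "\<dots> = m\<^sup>2 / a - m\<^sup>2 / b"
    proof -
      have "m\<^sup>2 * (b - a) / (a * b) = m\<^sup>2 / a - m\<^sup>2 / b" using a by (simp add: field_simps)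
      then show ?thesis by (simp add: b_def)
    qed
    finally have 2: "(2 * m * d / b)\<^sup>2 / 2 \<le> m\<^sup>2 / a - m\<^sup>2 / b"
      by (simp add: power2_eq_square mult_ac)
    show ?thesis using 1 2 unfolding add_divide_distrib diff_divide_distrib exp_le_cancel_iff by linarith
  qed
  finally show ?thesis unfolding bb a_def .
qed

text \<open>The integral of \<open>exp (M\<^sup>2 / 4)\<close> over the interval, where the step function \<open>M\<close> is the mean of \<open>u\<close> over
  the dyadic subinterval of generation \<open>n\<close>.\<close>

fun dyadic_exp_sum :: "(real \<Rightarrow> real) \<Rightarrow> nat \<Rightarrow> real \<Rightarrow> real \<Rightarrow> real" where
  "dyadic_exp_sum u 0 a b = (b - a) * exp ((mean u a b)\<^sup>2 / 4)"
| "dyadic_exp_sum u (Suc n) a b = dyadic_exp_sum u n a ((a + b) / 2) + dyadic_exp_sum u n ((a + b) / 2) b"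

lemma mean_halves:
  assumes ab: "a < b" and u: "continuous_on UNIV u"
  shows "mean u a b = (mean u a ((a + b) / 2) + mean u ((a + b) / 2) b) / 2"
proof -
  let ?m = "(a + b) / 2"
  have "integral {a..?m} u + integral {?m..b} u = integral {a..b} u"
    by (rule Henstock_Kurzweil_Integration.integral_combine)
      (use ab in \<open>auto intro!: integrable_continuous_interval continuous_on_subset[OF u]\<close>)
  moreover have "?m - a = (b - a) / 2" "b - ?m = (b - a) / 2" by (auto simp: field_simps)
  then have "mean u a ?m = 2 * integral {a..?m} u / (b - a)" "mean u ?m b = 2 * integral {?m..b} u / (b - a)"
    by (simp_all only: mean_def) simp_all
  moreover have "(2 * p / r + 2 * q / r) / 2 = (p + q) / r" for p q r :: real
    by (simp add: add_divide_distrib)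
  ultimately show ?thesis
    unfolding mean_def[of u a b] by (simp only:)
qed

lemma dyadic_exp_sum_le:
  assumes u: "continuous_on UNIV u"
  shows "a < b \<Longrightarrow> 0 \<le> s \<Longrightarrow> s \<le> 1 \<Longrightarrow> gagliardo u a b \<le> ennreal s \<Longrightarrow>
    dyadic_exp_sum u n a b \<le> (b - a) * exp ((mean u a b)\<^sup>2 / (4 - 2 * s) + s / 2)"
proof (induction n arbitrary: a b s)
  case 0
  have "(mean u a b)\<^sup>2 / 4 \<le> (mean u a b)\<^sup>2 / (4 - 2 * s)"
    using 0 by (intro divide_left_mono) auto
  then have "(mean u a b)\<^sup>2 / 4 \<le> (mean u a b)\<^sup>2 / (4 - 2 * s) + s / 2"
    using 0 by linarith
  then show ?case using 0 by (simp add: mult_left_mono)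
next
  case (Suc n)
  define m where "m = (a + b) / 2"
  define d where "d = (mean u m b - mean u a m) / 2"
  have m: "a < m" "m < b" "m - a = (b - a) / 2" "b - m = (b - a) / 2"
    using Suc.prems(1) by (auto simp: m_def field_simps)
  have split: "gagliardo u a m + gagliardo u m b + ennreal (d\<^sup>2) \<le> ennreal s"
    using gagliardo_split[OF Suc.prems(1) u] Suc.prems(4) unfolding d_def m_def by (rule order_trans)
  have "ennreal (d\<^sup>2) \<le> ennreal s"
    using split by (meson add_increasing order_trans zero_le order_refl)
  then have ds: "d\<^sup>2 \<le> s" using Suc.prems(2) by simp
  have sub: "x \<le> ennreal (s - d\<^sup>2)" if "x + ennreal (d\<^sup>2) \<le> ennreal s" for x
  proof -
    have "x + ennreal (d\<^sup>2) \<le> ennreal (s - d\<^sup>2) + ennreal (d\<^sup>2)"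
      using that ds by (simp add: ennreal_plus[symmetric] del: ennreal_plus)
    then show ?thesis by (simp add: add.commute[of _ "ennreal (d\<^sup>2)"] ennreal_add_left_cancel_le)
  qed
  have l: "gagliardo u a m \<le> ennreal (s - d\<^sup>2)"
    by (rule sub, rule order_trans[OF _ split]) (simp add: add_right_mono)
  have r: "gagliardo u m b \<le> ennreal (s - d\<^sup>2)"
    by (rule sub, rule order_trans[OF _ split]) (simp add: add_right_mono)
  let ?e = "\<lambda>v. exp (v\<^sup>2 / (4 - 2 * (s - d\<^sup>2)) + (s - d\<^sup>2) / 2)"
  have s': "0 \<le> s - d\<^sup>2" "s - d\<^sup>2 \<le> 1"
    using ds Suc.prems(3) zero_le_power2[of d] by linarith+
  have mean: "mean u a m = mean u a b - d" "mean u m b = mean u a b + d"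
    using mean_halves[OF Suc.prems(1) u] unfolding d_def m_def by (auto simp: field_simps)
  have "dyadic_exp_sum u (Suc n) a b \<le> (m - a) * ?e (mean u a m) + (b - m) * ?e (mean u m b)"
    unfolding dyadic_exp_sum.simps m_def[symmetric]
    by (intro add_mono Suc.IH m l r s')
  also have "\<dots> = (b - a) * ((?e (mean u a b - d) + ?e (mean u a b + d)) / 2)"
    unfolding m(3,4) mean by (simp add: field_simps)
  also have "\<dots> \<le> (b - a) * exp ((mean u a b)\<^sup>2 / (4 - 2 * s) + s / 2)"
    using gaussian_step[of s d "mean u a b"] Suc.prems ds by (intro mult_left_mono) auto
  finally show ?case .
qed

lemma mean_attained:
  assumes ab: "a < b" and u: "continuous_on UNIV u"
  shows "\<exists>\<xi>\<in>{a..b}. u \<xi> = mean u a b"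
proof -
  have c: "continuous_on {a..b} u" by (rule continuous_on_subset[OF u]) simp
  have ne: "{a..b} \<noteq> {}" using ab by simp
  obtain p where p: "p \<in> {a..b}" "\<And>y. y \<in> {a..b} \<Longrightarrow> u p \<le> u y"
    using continuous_attains_inf[OF compact_Icc ne c] by blast
  obtain q where q: "q \<in> {a..b}" "\<And>y. y \<in> {a..b} \<Longrightarrow> u y \<le> u q"
    using continuous_attains_sup[OF compact_Icc ne c] by blast
  have I: "(u has_integral integral {a..b} u) {a..b}"
    by (intro integrable_integral integrable_continuous_interval c)
  have "u p * (b - a) \<le> integral {a..b} u"
    using has_integral_le[OF has_integral_const_real[of "u p" a b] I] p ab by (simp add: mult.commute)
  moreover have "integral {a..b} u \<le> u q * (b - a)"
    using has_integral_le[OF I has_integral_const_real[of "u q" a b]] q ab by (simp add: mult.commute)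
  ultimately have "mean u a b \<in> {u p..u q}" using ab by (simp add: mean_def field_simps)
  moreover have "connected (u ` {a..b})" by (intro connected_continuous_image c) simp
  ultimately have "mean u a b \<in> u ` {a..b}"
    using connected_contains_Icc[of "u ` {a..b}" "u p" "u q"] p q by blast
  then show ?thesis by force
qed

text \<open>By the mean value theorem for integrals, the sums are Riemann sums of \<open>exp (u\<^sup>2 / 4)\<close>.\<close>

lemma integral_le_dyadic_exp_sum:
  assumes u: "continuous_on UNIV u" and ab: "a < b" and \<epsilon>: "\<epsilon> > 0"
  shows "\<exists>n. integral {a..b} (\<lambda>x. exp ((u x)\<^sup>2 / 4)) \<le> dyadic_exp_sum u n a b + \<epsilon> * (b - a)"
proof -
  let ?f = "\<lambda>x. exp ((u x)\<^sup>2 / 4)"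
  have f: "continuous_on S ?f" for S
    by (intro continuous_intros continuous_on_subset[OF u]) auto
  have int: "?f integrable_on {c..d}" for c d by (intro integrable_continuous_interval f)
  have "uniformly_continuous_on {a..b} ?f" by (intro compact_uniformly_continuous f) auto
  then obtain \<delta> where \<delta>: "\<delta> > 0" "\<And>x y. x \<in> {a..b} \<Longrightarrow> y \<in> {a..b} \<Longrightarrow> \<bar>x - y\<bar> < \<delta> \<Longrightarrow> \<bar>?f x - ?f y\<bar> < \<epsilon>"
    unfolding uniformly_continuous_on_def dist_real_def using \<epsilon> by metis
  have *: "integral {c..d} ?f \<le> dyadic_exp_sum u n c d + \<epsilon> * (d - c)"
    if "c < d" "a \<le> c" "d \<le> b" "d - c < \<delta> * 2 ^ n" for n c d
    using that
  proof (induction n arbitrary: c d)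
    case 0
    obtain \<xi> where xi: "\<xi> \<in> {c..d}" "u \<xi> = mean u c d"
      using mean_attained[OF 0(1) u] by blast
    have "integral {c..d} ?f \<le> (?f \<xi> + \<epsilon>) * (d - c)"
    proof (rule has_integral_le[OF integrable_integral[OF int]])
      show "((\<lambda>x. ?f \<xi> + \<epsilon>) has_integral (?f \<xi> + \<epsilon>) * (d - c)) {c..d}"
        using has_integral_const_real[of "?f \<xi> + \<epsilon>" c d] 0 by (simp add: mult.commute)
      fix x assume "x \<in> {c..d}"
      then have "x \<in> {a..b}" "\<xi> \<in> {a..b}" "\<bar>x - \<xi>\<bar> < \<delta>" using xi(1) 0 by auto
      from \<delta>(2)[OF this] show "?f x \<le> ?f \<xi> + \<epsilon>" by linarith
    qed
    then show ?case using xi by (simp add: algebra_simps)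
  next
    case (Suc n)
    let ?m = "(c + d) / 2"
    have "integral {c..d} ?f = integral {c..?m} ?f + integral {?m..d} ?f"
      by (rule Henstock_Kurzweil_Integration.integral_combine[symmetric]) (use Suc.prems int in auto)
    also have "\<dots> \<le> (dyadic_exp_sum u n c ?m + \<epsilon> * (?m - c)) + (dyadic_exp_sum u n ?m d + \<epsilon> * (d - ?m))"
      by (intro add_mono Suc.IH) (use Suc.prems in \<open>auto simp: field_simps\<close>)
    also have "\<dots> = dyadic_exp_sum u (Suc n) c d + \<epsilon> * (d - c)" by (simp add: field_simps)
    finally show ?case .
  qed
  obtain n where "(b - a) / \<delta> < 2 ^ n" using real_arch_pow[of 2 "(b - a) / \<delta>"] by auto
  then have "b - a < \<delta> * 2 ^ n" using \<delta>(1) by (simp add: field_simps)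
  with *[of a b n] ab show ?thesis by auto
qed

text \<open>The martingale bound with \<open>m = 0\<close> and \<open>s = 1\<close>, in the limit of fine partitions. The constant 2 is a
  bound of \<open>exp (1 / 2)\<close>.\<close>

lemma trudinger_interval:
  assumes u: "continuous_on UNIV u" and ab: "a < b" and g: "gagliardo u a b \<le> 1"
    and mean0: "integral {a..b} u = 0"
  shows "integral {a..b} (\<lambda>x. exp ((u x)\<^sup>2 / 4)) \<le> 2 * (b - a)"
proof -
  have "integral {a..b} (\<lambda>x. exp ((u x)\<^sup>2 / 4)) \<le> exp (1 / 2) * (b - a) + \<epsilon>" if e: "\<epsilon> > 0" for \<epsilon>
  proof -
    have e': "\<epsilon> / (b - a) > 0" using e ab by simp
    obtain n where n: "integral {a..b} (\<lambda>x. exp ((u x)\<^sup>2 / 4)) \<le> dyadic_exp_sum u n a b + \<epsilon> / (b - a) * (b - a)"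
      using integral_le_dyadic_exp_sum[OF u ab e'] by blast
    have "dyadic_exp_sum u n a b \<le> (b - a) * exp ((mean u a b)\<^sup>2 / (4 - 2 * 1) + 1 / 2)"
      by (rule dyadic_exp_sum_le[OF u ab]) (use g in auto)
    then show ?thesis using n ab by (simp add: mean_def mean0 mult.commute)
  qed
  then have "integral {a..b} (\<lambda>x. exp ((u x)\<^sup>2 / 4)) \<le> exp (1 / 2) * (b - a)" by (rule field_le_epsilon)
  also have "\<dots> \<le> 2 * (b - a)"
  proof -
    have "exp (1 / 2 :: real) \<le> 1 + 1 / 2 + (1 / 2)\<^sup>2" by (rule exp_bound) auto
    then show ?thesis using ab by (intro mult_right_mono) (auto simp: power2_eq_square)
  qed
  finally show ?thesis .
qed

subsection \<open>The double integral is controlled by the energy\<close>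

lemma C_2pi_shift_diff:
  assumes u: "u \<in> C_2pi"
  shows "(\<lambda>t. u (t + h) - u t) \<in> C_2pi"
proof -
  have "continuous_on UNIV (\<lambda>t. u (t + h) - u t)"
    by (intro continuous_intros C_2pi_continuous_compose[OF u])
  moreover have "u (t + 2 * pi + h) = u (t + h)" for t
  proof -
    have "u ((t + h) + 2 * pi) = u (t + h)" using u by (simp add: C_2pi_def periodic_2pi_def)
    then show ?thesis by (simp add: add_ac)
  qed
  ultimately show ?thesis using u by (simp add: C_2pi_def periodic_2pi_def)
qed

text \<open>The quotient is at most \<open>n\<^sup>2\<close> for \<open>h \<le> 1 / \<bar>n\<bar>\<close> and at most \<open>4 / h\<^sup>2\<close> for \<open>h \<ge> 1 / \<bar>n\<bar>\<close>. The two parts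
  contribute \<open>\<bar>n\<bar>\<close> and \<open>4 * \<bar>n\<bar>\<close>.\<close>

lemma nn_integral_min_frequency:
  fixes n :: int
  shows "(\<integral>\<^sup>+h. ennreal (min 4 ((of_int n * h)\<^sup>2) / h\<^sup>2) * indicator {0<..} h \<partial>lborel)
    \<le> ennreal (5 * \<bar>of_int n\<bar>)"
proof (cases "n = 0")
  case False
  define k where "k = \<bar>real_of_int n\<bar>"
  have k: "k > 0" using False by (simp add: k_def)
  have "(\<integral>\<^sup>+h. ennreal (min 4 ((of_int n * h)\<^sup>2) / h\<^sup>2) * indicator {0<..} h \<partial>lborel)
     \<le> (\<integral>\<^sup>+h. ennreal (k\<^sup>2) * indicator {0..1 / k} h + ennreal (4 / h\<^sup>2) * indicator {1 / k..} h \<partial>lborel)"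
  proof (rule nn_integral_mono)
    fix h :: real
    have "min 4 ((of_int n * h)\<^sup>2) / h\<^sup>2 \<le> k\<^sup>2" if "h > 0"
    proof -
      have "min 4 ((of_int n * h)\<^sup>2) / h\<^sup>2 \<le> (of_int n * h)\<^sup>2 / h\<^sup>2"
        by (intro divide_right_mono) auto
      also have "\<dots> = k\<^sup>2" using that by (simp add: k_def power_mult_distrib)
      finally show ?thesis .
    qed
    moreover have "min 4 ((of_int n * h)\<^sup>2) / h\<^sup>2 \<le> 4 / h\<^sup>2" by (intro divide_right_mono) auto
    ultimately show "ennreal (min 4 ((of_int n * h)\<^sup>2) / h\<^sup>2) * indicator {0<..} h
        \<le> ennreal (k\<^sup>2) * indicator {0..1 / k} h + ennreal (4 / h\<^sup>2) * indicator {1 / k..} h"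
      by (cases "h > 0"; cases "h \<le> 1 / k") (auto intro!: ennreal_leI add_increasing2 split: split_indicator)
  qed
  also have "\<dots> = ennreal (k\<^sup>2) * emeasure lborel {0..1 / k} + (\<integral>\<^sup>+h. ennreal (4 / h\<^sup>2) * indicator {1 / k..} h \<partial>lborel)"
    by (subst nn_integral_add) (auto simp: nn_integral_cmult_indicator)
  also have "ennreal (k\<^sup>2) * emeasure lborel {0..1 / k} = ennreal k"
    using k by (simp add: ennreal_mult[symmetric] power2_eq_square)
  also have "(\<integral>\<^sup>+h. ennreal (4 / h\<^sup>2) * indicator {1 / k..} h \<partial>lborel) = ennreal (0 - (- 4 / (1 / k)))"
  proof (rule nn_integral_FTC_atLeast)
    fix x assume "1 / k \<le> x"
    then have "x \<noteq> 0" using k by (auto simp: field_simps)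
    then show "((\<lambda>x. - 4 / x) has_real_derivative 4 / x\<^sup>2) (at x)"
      by (auto intro!: derivative_eq_intros simp: power2_eq_square)
  next
    show "((\<lambda>x::real. - 4 / x) \<longlongrightarrow> 0) at_top"
      by (rule real_tendsto_divide_at_top[OF tendsto_const filterlim_ident])
  qed auto
  also have "ennreal k + ennreal (0 - (- 4 / (1 / k))) = ennreal (5 * k)"
    using k by (simp add: ennreal_plus[symmetric] del: ennreal_plus)
  finally show ?thesis by (simp add: k_def)
qed simp

lemma fourier_energy_ge_sum:
  assumes u: "u \<in> H_half_2pi" and F: "finite F"
  shows "2 * pi * (\<Sum>n\<in>F. \<bar>real_of_int n\<bar> * (norm (fourier_coeff u n))\<^sup>2) \<le> fourier_energy u"
proof -
  have "(\<lambda>n. (1 + \<bar>real_of_int n\<bar>) * (norm (fourier_coeff u n))\<^sup>2) summable_on UNIV"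
    using u by (simp add: H_half_2pi_def)
  then have "(\<lambda>n. \<bar>real_of_int n\<bar> * (norm (fourier_coeff u n))\<^sup>2) summable_on UNIV"
    by (rule summable_on_comparison_test) (auto simp: distrib_right)
  then have "(\<Sum>n\<in>F. \<bar>real_of_int n\<bar> * (norm (fourier_coeff u n))\<^sup>2)
      \<le> (\<Sum>\<^sub>\<infinity>n\<in>UNIV. \<bar>real_of_int n\<bar> * (norm (fourier_coeff u n))\<^sup>2)"
    by (rule finite_sum_le_infsum) (use F in auto)
  then show ?thesis by (simp add: fourier_energy_def)
qed

text \<open>With \<open>y = x + h\<close>, the inner integral over \<open>x\<close> is at most the squared norm \<open>D h\<close> of a difference of
  shifts, and Parseval's identity expresses it by the Fourier coefficients of \<open>u\<close>. The integration
  over \<open>h\<close> is carried out frequency by frequency, for partial sums, and monotone convergence does the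
  rest.\<close>

lemma gagliardo_le_energy:
  assumes u: "u \<in> C_2pi" "u \<in> H_half_2pi"
  shows "gagliardo u (-pi) pi \<le> ennreal (5 * fourier_energy u)"
proof -
  have [measurable]: "u \<in> borel_measurable borel"
    by (rule borel_measurable_continuous_onI[OF C_2pi_continuous[OF u(1)]])
  define D where "D h = integral {-pi..pi} (\<lambda>x. (u (x + h) - u x)\<^sup>2)" for h
  define S where "S N h = (\<Sum>n\<in>{-int N..int N}. 2 * pi * (norm (fourier_coeff u n))\<^sup>2 * (min 4 ((of_int n * h)\<^sup>2) / h\<^sup>2))"
    for N :: nat and h :: real
  have S0: "0 \<le> S N h" for N h unfolding S_def by (intro sum_nonneg) auto
  have Smono: "S N h \<le> S M h" if "N \<le> M" for N M h
    unfolding S_def by (intro sum_mono2) (use that in auto)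
  have DS: "ennreal (D h / h\<^sup>2) \<le> (SUP N. ennreal (S N h))" if h: "h > 0" for h
  proof (rule ennreal_le_epsilon)
    fix e :: real assume e: "e > 0"
    let ?w = "\<lambda>t. u (t + h) - u t"
    have "e * h\<^sup>2 > 0" using e h by simp
    then obtain N :: nat where N: "integral {-pi..pi} (\<lambda>t. (?w t)\<^sup>2) \<le>
        2 * pi * (\<Sum>n\<in>{-int N..int N}. (norm (fourier_coeff ?w n))\<^sup>2) + e * h\<^sup>2"
      using fourier_parseval_approx[OF C_2pi_shift_diff[OF u(1)]] by blast
    \<comment> \<open>The shift multiplies the coefficient by \<open>cis (n * h)\<close>.\<close>
    have c: "(norm (fourier_coeff ?w n))\<^sup>2 \<le> (norm (fourier_coeff u n))\<^sup>2 * min 4 ((of_int n * h)\<^sup>2)" for n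
    proof -
      have "cmod (cis (of_int n * h) - 1) \<le> \<bar>of_int n * h\<bar>"
        using chord_le[of "of_int n * h" 0] by simp
      then have "(cmod (cis (of_int n * h) - 1))\<^sup>2 \<le> \<bar>of_int n * h\<bar>\<^sup>2" by (rule power_mono) simp
      moreover have "cmod (cis (of_int n * h) - 1) \<le> 2"
        using norm_triangle_ineq4[of "cis (of_int n * h)" 1] by simp
      then have "(cmod (cis (of_int n * h) - 1))\<^sup>2 \<le> 2\<^sup>2" by (rule power_mono) simp
      ultimately have "(cmod (cis (of_int n * h) - 1))\<^sup>2 \<le> min 4 ((of_int n * h)\<^sup>2)" by simp
      then have "(cmod (cis (of_int n * h) - 1))\<^sup>2 * (norm (fourier_coeff u n))\<^sup>2
          \<le> min 4 ((of_int n * h)\<^sup>2) * (norm (fourier_coeff u n))\<^sup>2"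
        by (intro mult_right_mono) auto
      then show ?thesis
        unfolding fourier_coeff_shift_diff[OF u(1)] by (simp add: norm_mult power_mult_distrib mult.commute)
    qed
    have "D h \<le> 2 * pi * (\<Sum>n\<in>{-int N..int N}. (norm (fourier_coeff u n))\<^sup>2 * min 4 ((of_int n * h)\<^sup>2)) + e * h\<^sup>2"
    proof -
      have "2 * pi * (\<Sum>n\<in>{-int N..int N}. (norm (fourier_coeff ?w n))\<^sup>2)
          \<le> 2 * pi * (\<Sum>n\<in>{-int N..int N}. (norm (fourier_coeff u n))\<^sup>2 * min 4 ((of_int n * h)\<^sup>2))"
        by (intro mult_left_mono sum_mono c) auto
      with N show ?thesis unfolding D_def by linarith
    qed
    then have "D h / h\<^sup>2 \<le> (2 * pi * (\<Sum>n\<in>{-int N..int N}. (norm (fourier_coeff u n))\<^sup>2 * min 4 ((of_int n * h)\<^sup>2)) + e * h\<^sup>2) / h\<^sup>2"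
      by (rule divide_right_mono) simp
    also have "\<dots> = S N h + e"
      unfolding S_def using h by (simp add: add_divide_distrib sum_distrib_left sum_divide_distrib mult.assoc)
    finally have "ennreal (D h / h\<^sup>2) \<le> ennreal (S N h) + ennreal e"
      using S0 e by (simp add: ennreal_leI flip: ennreal_plus)
    also have "\<dots> \<le> (SUP N. ennreal (S N h)) + ennreal e"
      by (intro add_right_mono SUP_upper) auto
    finally show "ennreal (D h / h\<^sup>2) \<le> (SUP N. ennreal (S N h)) + ennreal e" .
  qed
  let ?K = "\<lambda>x y. if -pi < x \<and> x < y \<and> y < pi then ennreal ((u y - u x)\<^sup>2 / (y - x)\<^sup>2) else 0"
  have "gagliardo u (-pi) pi = (\<integral>\<^sup>+x. \<integral>\<^sup>+h. ?K x (x + h) \<partial>lborel \<partial>lborel)"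
    unfolding gagliardo_def
  proof (rule nn_integral_cong)
    fix x
    show "(\<integral>\<^sup>+y. ?K x y \<partial>lborel) = (\<integral>\<^sup>+h. ?K x (x + h) \<partial>lborel)"
      using nn_integral_real_affine[of "?K x" 1 x] by (simp only: mult_1 abs_one ennreal_1) simp
  qed
  also have "\<dots> = (\<integral>\<^sup>+h. \<integral>\<^sup>+x. ?K x (x + h) \<partial>lborel \<partial>lborel)"
    by (rule lborel_pair.Fubini'[symmetric]) measurable
  also have "\<dots> \<le> (\<integral>\<^sup>+h. (SUP N. ennreal (S N h) * indicator {0<..} h) \<partial>lborel)"
  proof (rule nn_integral_mono)
    fix h :: real
    show "(\<integral>\<^sup>+x. ?K x (x + h) \<partial>lborel) \<le> (SUP N. ennreal (S N h) * indicator {0<..} h)"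
    proof (cases "h > 0")
      case True
      have "(\<integral>\<^sup>+x. ?K x (x + h) \<partial>lborel)
          \<le> (\<integral>\<^sup>+x. ennreal ((u (x + h) - u x)\<^sup>2 / h\<^sup>2) * indicator {-pi<..<pi} x \<partial>lborel)"
        using True by (intro nn_integral_mono) (auto split: split_indicator)
      also have "\<dots> = ennreal (integral {-pi..pi} (\<lambda>x. (u (x + h) - u x)\<^sup>2 / h\<^sup>2))"
        by (rule nn_integral_continuous_Ioo)
          (use True in \<open>auto intro!: continuous_intros C_2pi_continuous_compose[OF u(1)]\<close>)
      also have "\<dots> = ennreal (D h / h\<^sup>2)" by (simp add: D_def)
      also have "\<dots> \<le> (SUP N. ennreal (S N h))" by (rule DS[OF True])
      finally show ?thesis using True by simp
    next
      case False
      have "(\<integral>\<^sup>+x. ?K x (x + h) \<partial>lborel) = (\<integral>\<^sup>+x. 0 \<partial>(lborel :: real measure))"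
        by (rule nn_integral_cong) (use False in auto)
      then show ?thesis by simp
    qed
  qed
  also have "\<dots> = (SUP N. \<integral>\<^sup>+h. ennreal (S N h) * indicator {0<..} h \<partial>lborel)"
  proof (rule nn_integral_monotone_convergence_SUP)
    show "incseq (\<lambda>N h. ennreal (S N h) * indicator {0<..} h)"
      by (intro incseq_SucI le_funI mult_right_mono ennreal_leI Smono) auto
  qed (simp add: S_def)
  also have "\<dots> \<le> ennreal (5 * fourier_energy u)"
  proof (rule SUP_least)
    fix N :: nat
    let ?c = "\<lambda>n. 2 * pi * (norm (fourier_coeff u n))\<^sup>2"
    let ?w = "\<lambda>n h. min 4 ((of_int n * h)\<^sup>2) / h\<^sup>2"
    have "(\<integral>\<^sup>+h. ennreal (S N h) * indicator {0<..} h \<partial>lborel)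
       = (\<integral>\<^sup>+h. (\<Sum>n\<in>{-int N..int N}. ennreal (?c n) * (ennreal (?w n h) * indicator {0<..} h)) \<partial>lborel)"
    proof (rule nn_integral_cong)
      fix h :: real
      have "ennreal (S N h) = (\<Sum>n\<in>{-int N..int N}. ennreal (?c n * ?w n h))"
        unfolding S_def by (rule sum_ennreal[symmetric]) auto
      also have "\<dots> = (\<Sum>n\<in>{-int N..int N}. ennreal (?c n) * ennreal (?w n h))"
        by (intro sum.cong refl ennreal_mult) auto
      finally show "ennreal (S N h) * indicator {0<..} h
          = (\<Sum>n\<in>{-int N..int N}. ennreal (?c n) * (ennreal (?w n h) * indicator {0<..} h))"
        by (simp only: sum_distrib_right mult.assoc)
    qed
    also have "\<dots> = (\<Sum>n\<in>{-int N..int N}. ennreal (?c n) * (\<integral>\<^sup>+h. ennreal (?w n h) * indicator {0<..} h \<partial>lborel))"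
      by (subst nn_integral_sum) (auto simp: nn_integral_cmult)
    also have "\<dots> \<le> (\<Sum>n\<in>{-int N..int N}. ennreal (?c n) * ennreal (5 * \<bar>of_int n\<bar>))"
      by (intro sum_mono mult_left_mono nn_integral_min_frequency) auto
    also have "\<dots> = (\<Sum>n\<in>{-int N..int N}. ennreal (?c n * (5 * \<bar>of_int n\<bar>)))"
      by (intro sum.cong refl ennreal_mult[symmetric]) auto
    also have "\<dots> = ennreal (\<Sum>n\<in>{-int N..int N}. ?c n * (5 * \<bar>of_int n\<bar>))"
      by (intro sum_ennreal) auto
    also have "\<dots> \<le> ennreal (5 * fourier_energy u)"
    proof (rule ennreal_leI)
      have "(\<Sum>n\<in>{-int N..int N}. ?c n * (5 * \<bar>of_int n\<bar>))
          = 5 * (2 * pi * (\<Sum>n\<in>{-int N..int N}. \<bar>real_of_int n\<bar> * (norm (fourier_coeff u n))\<^sup>2))"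
        by (simp add: sum_distrib_left mult_ac)
      then show "(\<Sum>n\<in>{-int N..int N}. ?c n * (5 * \<bar>of_int n\<bar>)) \<le> 5 * fourier_energy u"
        using fourier_energy_ge_sum[OF u(2), of "{-int N..int N}"] by simp
    qed
    finally show "(\<integral>\<^sup>+h. ennreal (S N h) * indicator {0<..} h \<partial>lborel) \<le> ennreal (5 * fourier_energy u)" .
  qed
  finally show ?thesis .
qed

subsection \<open>The local Orlicz bound\<close>

lemma A_fun_0 [simp]: "A_fun 0 = 0"
  by (simp add: A_fun_def)

lemma A_fun_nonneg: "0 \<le> A_fun s"
  using exp_ge_add_one_self[of "\<bar>s\<bar>"] unfolding A_fun_def by linarith

lemma A_fun_measurable [measurable]: "A_fun \<in> borel_measurable borel"
  unfolding A_fun_def by measurable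

lemma A_fun_scale_le_exp:
  assumes \<theta>: "0 \<le> \<theta>" "\<theta> \<le> 1" and z: "0 \<le> z"
  shows "A_fun (\<theta> * z) \<le> \<theta> * (exp z - 1 - z)"
proof -
  have "exp ((1 - \<theta>) *\<^sub>R 0 + \<theta> *\<^sub>R z) \<le> (1 - \<theta>) * exp 0 + \<theta> * exp z"
    by (rule convex_onD[OF exp_convex]) (use \<theta> in auto)
  then show ?thesis using \<theta> z by (simp add: A_fun_def algebra_simps)
qed

lemma A_fun_scale_le:
  assumes "0 \<le> \<theta>" "\<theta> \<le> 1" "0 \<le> z"
  shows "A_fun (\<theta> * z) \<le> \<theta> * A_fun z"
  using A_fun_scale_le_exp[OF assms] assms(3) by (simp add: A_fun_def)

lemma gagliardo_scale:
  assumes u: "continuous_on UNIV u"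
  shows "gagliardo (\<lambda>x. c * u x) a b = ennreal (c\<^sup>2) * gagliardo u a b"
proof -
  have [measurable]: "u \<in> borel_measurable borel" by (rule borel_measurable_continuous_onI[OF u])
  have sc: "(c * u y - c * u x)\<^sup>2 / (y - x)\<^sup>2 = c\<^sup>2 * ((u y - u x)\<^sup>2 / (y - x)\<^sup>2)" for x y
    by (simp add: power_mult_distrib flip: right_diff_distrib)
  have "gagliardo (\<lambda>x. c * u x) a b = (\<integral>\<^sup>+x. \<integral>\<^sup>+y. ennreal (c\<^sup>2) *
      (if a < x \<and> x < y \<and> y < b then ennreal ((u y - u x)\<^sup>2 / (y - x)\<^sup>2) else 0) \<partial>lborel \<partial>lborel)"
    unfolding gagliardo_def sc
    by (intro nn_integral_cong) (simp only: ennreal_mult[OF zero_le_power2 divide_nonneg_nonneg[OF zero_le_power2 zero_le_power2]] if_distrib[of "(*) _"] mult_zero_right)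
  also have "\<dots> = (\<integral>\<^sup>+x. ennreal (c\<^sup>2) * (\<integral>\<^sup>+y.
      (if a < x \<and> x < y \<and> y < b then ennreal ((u y - u x)\<^sup>2 / (y - x)\<^sup>2) else 0) \<partial>lborel) \<partial>lborel)"
    by (intro nn_integral_cong nn_integral_cmult; measurable)
  also have "\<dots> = ennreal (c\<^sup>2) * gagliardo u a b"
    unfolding gagliardo_def by (intro nn_integral_cmult; measurable)
  finally show ?thesis .
qed

text \<open>The exponential inequality for \<open>u / sqrt s\<close>. By convexity, the factor 1/16 inside \<open>A_fun\<close> may be taken
  out, and it turns the bound \<open>2 * (b - a)\<close> into \<open>(b - a) / 8\<close>.\<close>

lemma orlicz_interval:
  assumes u: "continuous_on UNIV u" and ab: "a < b" and s: "s > 0"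
    and g: "gagliardo u a b \<le> ennreal s" and mean0: "integral {a..b} u = 0"
  shows "integral {a..b} (\<lambda>x. A_fun ((u x)\<^sup>2 / (64 * s))) \<le> (b - a) / 8"
proof -
  let ?c = "1 / sqrt s"
  let ?w = "\<lambda>x. ?c * u x"
  have w: "continuous_on UNIV ?w" by (intro continuous_intros u)
  have cu: "continuous_on {a..b} u" by (rule continuous_on_subset[OF u]) simp
  have "gagliardo ?w a b \<le> ennreal (?c\<^sup>2) * ennreal s"
    unfolding gagliardo_scale[OF u] by (intro mult_left_mono g) auto
  also have "\<dots> = 1" using s by (simp add: power_divide flip: ennreal_mult)
  finally have g1: "gagliardo ?w a b \<le> 1" .
  have "integral {a..b} ?w = 0" using mean0 by simp
  from trudinger_interval[OF w ab g1 this]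
  have T: "integral {a..b} (\<lambda>x. exp ((?w x)\<^sup>2 / 4)) \<le> 2 * (b - a)" .
  have pt: "A_fun ((u x)\<^sup>2 / (64 * s)) \<le> 1 / 16 * exp ((?w x)\<^sup>2 / 4)" for x
  proof -
    have e: "(?w x)\<^sup>2 / 4 = (u x)\<^sup>2 / (4 * s)" using s by (simp add: power_mult_distrib power_divide)
    have "A_fun (1 / 16 * ((u x)\<^sup>2 / (4 * s))) \<le> 1 / 16 * (exp ((u x)\<^sup>2 / (4 * s)) - 1 - (u x)\<^sup>2 / (4 * s))"
      by (rule A_fun_scale_le_exp) (use s in auto)
    also have "\<dots> \<le> 1 / 16 * exp ((u x)\<^sup>2 / (4 * s))"
    proof -
      have drop: "1 / 16 * (y - 1 - z) \<le> 1 / 16 * y" if "0 \<le> z" for y z :: real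
        using that by simp
      show ?thesis by (rule drop) (use s in simp)
    qed
    finally show ?thesis unfolding e by simp
  qed
  have "integral {a..b} (\<lambda>x. A_fun ((u x)\<^sup>2 / (64 * s))) \<le> integral {a..b} (\<lambda>x. 1 / 16 * exp ((?w x)\<^sup>2 / 4))"
  proof (rule integral_le)
    show "(\<lambda>x. A_fun ((u x)\<^sup>2 / (64 * s))) integrable_on {a..b}"
      unfolding A_fun_def by (intro integrable_continuous_interval continuous_intros cu) (use s in auto)
    show "(\<lambda>x. 1 / 16 * exp ((?w x)\<^sup>2 / 4)) integrable_on {a..b}"
      by (intro integrable_continuous_interval continuous_intros cu) auto
  qed (rule pt)
  also have "\<dots> \<le> (b - a) / 8" using T by simp
  finally show ?thesis .
qed

subsection \<open>Counting dimensions\<close>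

text \<open>Induction on the number of functionals: a subspace is spanned by the kernel of one of them together
  with a single further vector. The functionals are linear on \<open>L\<close> only, because the integrals to which
  this is applied are not linear on all functions.\<close>

lemma subspace_in_span_of_functionals:
  fixes T :: "nat \<Rightarrow> ('a \<Rightarrow> real) \<Rightarrow> real"
  assumes "fun_space.subspace L"
    and "\<And>i u v. i < N \<Longrightarrow> u \<in> L \<Longrightarrow> v \<in> L \<Longrightarrow> T i (u + v) = T i u + T i v"
    and "\<And>i c u. i < N \<Longrightarrow> u \<in> L \<Longrightarrow> T i (fun_scale c u) = c * T i u"
    and "\<And>u. u \<in> L \<Longrightarrow> (\<And>i. i < N \<Longrightarrow> T i u = 0) \<Longrightarrow> u = 0"
  shows "\<exists>B. finite B \<and> card B \<le> N \<and> L \<subseteq> fun_space.span B"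
  using assms
proof (induction N arbitrary: L)
  case 0
  have "u = 0" if "u \<in> L" for u
    by (rule "0.prems"(4)[OF that]) simp
  then have "L \<subseteq> {0}" by blast
  then show ?case by (intro exI[of _ "{}"]) auto
next
  case (Suc N)
  note sub = Suc.prems(1) and add = Suc.prems(2) and scale = Suc.prems(3) and inj = Suc.prems(4)
  define K where "K = {u \<in> L. T N u = 0}"
  have "T N (fun_scale 0 0) = 0 * T N 0" by (rule scale[OF _ fun_space.subspace_0[OF sub]]) simp
  then have T0: "T N 0 = 0" by (simp only: fun_space.scale_zero_left mult_zero_left)
  have K: "fun_space.subspace K"
  proof (rule fun_space.subspaceI)
    show "0 \<in> K" unfolding K_def using fun_space.subspace_0[OF sub] T0 by (intro CollectI conjI)
    show "x + y \<in> K" if "x \<in> K" "y \<in> K" for x y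
    proof -
      have "x \<in> L" "y \<in> L" "T N x = 0" "T N y = 0" using that unfolding K_def by blast+
      then have "x + y \<in> L" "T N (x + y) = 0 + 0"
        using add[OF lessI, of x y] fun_space.subspace_add[OF sub, of x y] by (simp_all only:)
      then show ?thesis unfolding K_def by (intro CollectI conjI) (simp_all only: add_0)
    qed
    show "fun_scale c x \<in> K" if "x \<in> K" for c x
    proof -
      have "x \<in> L" "T N x = 0" using that unfolding K_def by blast+
      then show ?thesis
        using scale[of N x c] fun_space.subspace_scale[OF sub, of x c] unfolding K_def by (intro CollectI conjI) auto
    qed
  qed
  have "\<exists>B. finite B \<and> card B \<le> N \<and> K \<subseteq> fun_space.span B"
  proof (rule Suc.IH[OF K])
    fix u assume u: "u \<in> K" "\<And>i. i < N \<Longrightarrow> T i u = 0"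
    show "u = 0"
    proof (rule inj)
      show "u \<in> L" using u(1) unfolding K_def by blast
      show "T i u = 0" if "i < Suc N" for i
        using that u unfolding K_def less_Suc_eq by blast
    qed
  qed (use add scale in \<open>auto simp: K_def\<close>)
  then obtain B where B: "finite B" "card B \<le> N" "K \<subseteq> fun_space.span B" by blast
  show ?case
  proof (cases "K = L")
    case True
    then show ?thesis using B by (intro exI[of _ B]) auto
  next
    case False
    then obtain w where w: "w \<in> L" "T N w \<noteq> 0" by (auto simp: K_def)
    have "u \<in> fun_space.span (insert w B)" if u: "u \<in> L" for u
    proof -
      define c where "c = - (T N u / T N w)"
      have "fun_scale c w \<in> L" using fun_space.subspace_scale[OF sub w(1)] .
      then have "u + fun_scale c w \<in> L" "T N (u + fun_scale c w) = T N u + c * T N w"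
        using add[OF lessI u, of "fun_scale c w"] scale[OF lessI w(1), of c] fun_space.subspace_add[OF sub u]
        by (simp_all only:)
      moreover have "T N u + c * T N w = 0" using w(2) by (simp add: c_def)
      ultimately have "u + fun_scale c w \<in> K" unfolding K_def by (intro CollectI conjI) (simp_all only:)
      then have "u + fun_scale c w \<in> fun_space.span (insert w B)"
        using B(3) fun_space.span_mono[of B "insert w B"] by auto
      moreover have "fun_scale c w \<in> fun_space.span (insert w B)"
        by (intro fun_space.span_scale fun_space.span_base) auto
      ultimately have "(u + fun_scale c w) - fun_scale c w \<in> fun_space.span (insert w B)"
        by (rule fun_space.span_diff)
      then show ?thesis by simp
    qed
    moreover have "card (insert w B) \<le> Suc N" using B by (simp add: card_insert_if)
    ultimately show ?thesis using B(1) by (intro exI[of _ "insert w B"]) auto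
  qed
qed

text \<open>A subspace on which \<open>q\<close> is negative meets the common kernel of the functionals only in 0.\<close>

lemma N_minus_le:
  fixes T :: "nat \<Rightarrow> ('a \<Rightarrow> real) \<Rightarrow> real"
  assumes add: "\<And>i u v. i < N \<Longrightarrow> u \<in> D \<Longrightarrow> v \<in> D \<Longrightarrow> T i (u + v) = T i u + T i v"
    and scale: "\<And>i c u. i < N \<Longrightarrow> u \<in> D \<Longrightarrow> T i (fun_scale c u) = c * T i u"
    and nonneg: "\<And>u. u \<in> D \<Longrightarrow> (\<And>i. i < N \<Longrightarrow> T i u = 0) \<Longrightarrow> 0 \<le> q u"
  shows "N_minus D q \<le> enat N"
  unfolding N_minus_def
proof (rule SUP_least)
  fix L assume "L \<in> {L. fun_space.subspace L \<and> L \<subseteq> D \<and> (\<forall>u\<in>L - {0}. q u < 0)}"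
  then have L: "fun_space.subspace L" "L \<subseteq> D" "\<And>u. u \<in> L \<Longrightarrow> u \<noteq> 0 \<Longrightarrow> q u < 0" by auto
  have "\<exists>B. finite B \<and> card B \<le> N \<and> L \<subseteq> fun_space.span B"
  proof (rule subspace_in_span_of_functionals[OF L(1)])
    fix u assume "u \<in> L" "\<And>i. i < N \<Longrightarrow> T i u = 0"
    then show "u = 0" using nonneg[of u] L(2,3) by force
  qed (use L(2) add scale in blast)+
  then obtain B where B: "finite B" "card B \<le> N" "L \<subseteq> fun_space.span B" by blast
  have "fun_space.dim L \<le> card B" using B by (intro fun_space.dim_le_card)
  then show "ext_dim L \<le> enat N" using B by (auto simp: ext_dim_def)
qed

section \<open>Partition of the circle and the upper bound\<close>

abbreviation period_measure :: "real measure" where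
  "period_measure \<equiv> lebesgue_on {-pi..pi}"

lemma borel_measurable_period:
  "f \<in> borel_measurable borel \<Longrightarrow> f \<in> borel_measurable period_measure" for f :: "real \<Rightarrow> real"
  by (intro measurable_restrict_space1 measurable_completion) simp

lemma nn_integral_period:
  assumes f: "continuous_on UNIV f" "\<And>x. 0 \<le> f x" and xy: "-pi \<le> x" "y \<le> pi"
  shows "(\<integral>\<^sup>+t. ennreal (f t) * indicator {x<..<y} t \<partial>period_measure) = ennreal (integral {x..y} f)"
proof -
  have "(\<integral>\<^sup>+t. ennreal (f t) * indicator {x<..<y} t \<partial>period_measure)
      = (\<integral>\<^sup>+t. ennreal (f t) * indicator {x<..<y} t * indicator {-pi..pi} t \<partial>lebesgue)"
    by (rule nn_integral_restrict_space) simp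
  also have "\<dots> = (\<integral>\<^sup>+t. ennreal (f t) * indicator {x<..<y} t \<partial>lebesgue)"
    by (intro nn_integral_cong) (use xy in \<open>auto split: split_indicator\<close>)
  also have "\<dots> = (\<integral>\<^sup>+t. ennreal (f t) * indicator {x<..<y} t \<partial>lborel)"
    by (rule nn_integral_completion)
  also have "\<dots> = ennreal (integral {x..y} f)"
    by (rule nn_integral_continuous_Ioo[OF f])
  finally show ?thesis .
qed

text \<open>The Orlicz norm enters through bounded nonnegative test functions only. As \<open>V\<close> is integrable, all
  products with them are integrable.\<close>

locale orlicz_bounded =
  fixes V :: "real \<Rightarrow> real" and S :: real
  assumes V_int: "integrable period_measure V"
    and V_nonneg: "AE t in period_measure. 0 \<le> V t"
    and test: "\<And>g C. g \<in> borel_measurable period_measure \<Longrightarrow> (\<And>t. 0 \<le> g t) \<Longrightarrow>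
      (\<And>t. t \<in> {-pi..pi} \<Longrightarrow> g t \<le> C) \<Longrightarrow>
      (\<integral>\<^sup>+t. ennreal (A_fun (g t)) \<partial>period_measure) \<le> 1 \<Longrightarrow>
      (LINT t|period_measure. V t * g t) \<le> S"
begin

text \<open>The test functions on an interval, under a constraint proportional to its length. The factor 1/8 is
  the one that \<open>orlicz_interval\<close> provides, and it makes the constraint for the whole circle at least as
  strong as that of the Orlicz norm, as \<open>2 * pi \<le> 8\<close>.\<close>

definition admissible :: "real \<Rightarrow> real \<Rightarrow> (real \<Rightarrow> real) set" where
  "admissible x y = {g \<in> borel_measurable period_measure.
     (\<forall>t. 0 \<le> g t) \<and> (\<exists>C. \<forall>t\<in>{-pi..pi}. g t \<le> C) \<and> (\<forall>t. t \<le> x \<or> y < t \<longrightarrow> g t = 0) \<and>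
     (\<integral>\<^sup>+t. ennreal (A_fun (g t)) \<partial>period_measure) \<le> ennreal ((y - x) / 8)}"

text \<open>An averaged Orlicz norm of \<open>V\<close> over the interval from \<open>-pi\<close> to \<open>x\<close>.\<close>

definition mass_below :: "real \<Rightarrow> real" where
  "mass_below x = Sup ((\<lambda>g. LINT t|period_measure. V t * g t) ` admissible (-pi) x)"

lemma integrable_V_bounded:
  assumes "g \<in> borel_measurable period_measure" "\<And>t. 0 \<le> g t" "\<And>t. t \<in> {-pi..pi} \<Longrightarrow> g t \<le> C"
  shows "integrable period_measure (\<lambda>t. V t * g t)"
  by (rule integrable_mult_bounded[OF V_int assms(1)]) (use assms(2,3) in auto)

lemma admissible_integrable:
  assumes "g \<in> admissible x y"
  shows "integrable period_measure (\<lambda>t. V t * g t)"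
  using assms integrable_V_bounded unfolding admissible_def by blast

lemma zero_admissible: "(\<lambda>_. 0) \<in> admissible x y"
  unfolding admissible_def by auto

lemma admissible_le:
  assumes g: "g \<in> admissible (-pi) x" and x: "x \<le> pi"
  shows "(LINT t|period_measure. V t * g t) \<le> S"
proof -
  have "(x - (-pi)) / 8 \<le> 1" using x pi_less_4 by simp
  then have "ennreal ((x - (-pi)) / 8) \<le> 1" by simp
  then have "(\<integral>\<^sup>+t. ennreal (A_fun (g t)) \<partial>period_measure) \<le> 1"
    using g unfolding admissible_def by (auto intro: order_trans)
  then show ?thesis using g test unfolding admissible_def by blast
qed

lemma mass_bdd: "x \<le> pi \<Longrightarrow> bdd_above ((\<lambda>g. LINT t|period_measure. V t * g t) ` admissible (-pi) x)"
  using admissible_le by (auto intro!: bdd_aboveI)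

lemma mass_below_le: "x \<le> pi \<Longrightarrow> mass_below x \<le> S"
  unfolding mass_below_def
  by (rule cSup_least) (use zero_admissible[of "-pi" x] admissible_le in \<open>blast, auto\<close>)

lemma mass_below_nonneg: "x \<le> pi \<Longrightarrow> 0 \<le> mass_below x"
  unfolding mass_below_def
  by (rule cSup_upper2[of "LINT t|period_measure. V t * 0"]) (use zero_admissible mass_bdd in \<open>force+\<close>)

text \<open>Test functions on adjacent intervals add up to a test function, since the constraint is proportional
  to the length and \<open>A_fun\<close> vanishes at 0.\<close>

lemma mass_below_add:
  assumes xy: "-pi \<le> x" "x \<le> y" "y \<le> pi" and g': "g' \<in> admissible x y"
  shows "mass_below x + (LINT t|period_measure. V t * g' t) \<le> mass_below y"
proof -
  have "(LINT t|period_measure. V t * g t) \<le> mass_below y - (LINT t|period_measure. V t * g' t)"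
    if g: "g \<in> admissible (-pi) x" for g
  proof -
    have m[measurable]: "g \<in> borel_measurable period_measure" "g' \<in> borel_measurable period_measure"
      using g g' by (auto simp: admissible_def)
    have "A_fun (g t + g' t) = A_fun (g t) + A_fun (g' t)" for t
      using g g' by (cases "t \<le> x") (auto simp: admissible_def)
    then have "(\<integral>\<^sup>+t. ennreal (A_fun (g t + g' t)) \<partial>period_measure)
        = (\<integral>\<^sup>+t. ennreal (A_fun (g t)) + ennreal (A_fun (g' t)) \<partial>period_measure)"
      by (simp add: A_fun_nonneg)
    also have "\<dots> = (\<integral>\<^sup>+t. ennreal (A_fun (g t)) \<partial>period_measure) + (\<integral>\<^sup>+t. ennreal (A_fun (g' t)) \<partial>period_measure)"
      by (rule nn_integral_add; measurable)
    also have "\<dots> \<le> ennreal ((x - (-pi)) / 8) + ennreal ((y - x) / 8)"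
      using g g' by (intro add_mono) (auto simp: admissible_def)
    also have "\<dots> = ennreal ((y - (-pi)) / 8)"
      using xy by (simp add: ennreal_plus[symmetric] add_divide_distrib[symmetric] del: ennreal_plus)
    finally have A: "(\<integral>\<^sup>+t. ennreal (A_fun (g t + g' t)) \<partial>period_measure) \<le> ennreal ((y - (-pi)) / 8)" .
    obtain C C' where C: "\<And>t. t \<in> {-pi..pi} \<Longrightarrow> g t \<le> C" "\<And>t. t \<in> {-pi..pi} \<Longrightarrow> g' t \<le> C'"
      using g g' unfolding admissible_def by blast
    have "\<exists>C. \<forall>t\<in>{-pi..pi}. g t + g' t \<le> C"
      using C by (intro exI[of _ "C + C'"] ballI add_mono) auto
    then have "(\<lambda>t. g t + g' t) \<in> admissible (-pi) y"
      using g g' A xy unfolding admissible_def by auto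
    then have "(LINT t|period_measure. V t * (g t + g' t)) \<le> mass_below y"
      unfolding mass_below_def by (intro cSup_upper mass_bdd xy) auto
    also have "(LINT t|period_measure. V t * (g t + g' t))
        = (LINT t|period_measure. V t * g t) + (LINT t|period_measure. V t * g' t)"
      unfolding distrib_left
      by (rule Bochner_Integration.integral_add) (use g g' admissible_integrable in auto)
    finally show ?thesis by simp
  qed
  then have "mass_below x \<le> mass_below y - (LINT t|period_measure. V t * g' t)"
    unfolding mass_below_def[of x]
    by (intro cSup_least) (use zero_admissible[of "-pi" x] in \<open>blast, auto\<close>)
  then show ?thesis by simp
qed

lemma mass_below_mono:
  assumes "-pi \<le> x" "x \<le> y" "y \<le> pi"
  shows "mass_below x \<le> mass_below y"
  using mass_below_add[OF assms zero_admissible] by simp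

text \<open>The points where the mass passes the multiples of \<open>\<delta>\<close>. The point \<open>-pi\<close> is put into the set so that
  the supremum is meaningful. The mass is nonnegative, so that the first interval can start at \<open>-pi\<close>
  instead of at the last point of mass 0; otherwise there would be one more interval.\<close>

definition cut :: "real \<Rightarrow> nat \<Rightarrow> real" where
  "cut \<delta> i = (if i = 0 then -pi
     else Sup {x \<in> {-pi..pi}. x = -pi \<or> mass_below x \<le> real i * \<delta>})"

lemma cut_set:
  "-pi \<in> {x \<in> {-pi..pi}. x = -pi \<or> mass_below x \<le> c}"
  "bdd_above {x \<in> {-pi..pi}. x = -pi \<or> mass_below x \<le> c}"
  by (auto intro!: bdd_aboveI[of _ pi])

lemma cut_bounds: "-pi \<le> cut \<delta> i" "cut \<delta> i \<le> pi"
  unfolding cut_def using cut_set by (auto intro!: cSup_upper cSup_least)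

lemma cut_Suc_mono:
  assumes "0 \<le> \<delta>"
  shows "cut \<delta> i \<le> cut \<delta> (Suc i)"
proof (cases "i = 0")
  case True
  then show ?thesis using cut_bounds(1)[of \<delta> "Suc i"] by (simp add: cut_def)
next
  case False
  have "real i * \<delta> \<le> real (Suc i) * \<delta>" using assms by (intro mult_right_mono) auto
  then have "{x \<in> {-pi..pi}. x = -pi \<or> mass_below x \<le> real i * \<delta>}
      \<subseteq> {x \<in> {-pi..pi}. x = -pi \<or> mass_below x \<le> real (Suc i) * \<delta>}"
    by (auto intro: order_trans)
  moreover have "{x \<in> {-pi..pi}. x = -pi \<or> mass_below x \<le> real i * \<delta>} \<noteq> {}"
    using cut_set(1) by blast
  ultimately show ?thesis
    using False cut_set(2) unfolding cut_def by (simp only: if_False nat.distinct) (rule cSup_subset_mono)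
qed

lemma cut_last:
  assumes "S \<le> real N * \<delta>" "0 < N"
  shows "cut \<delta> N = pi"
proof -
  have "pi \<in> {x \<in> {-pi..pi}. x = -pi \<or> mass_below x \<le> real N * \<delta>}"
    using mass_below_le[of pi] assms by auto
  from cSup_upper[OF this cut_set(2)] show ?thesis
    using assms cut_bounds(2)[of \<delta> N] by (auto simp: cut_def intro: antisym)
qed

text \<open>The strict inequalities place both values between consecutive multiples of \<open>\<delta>\<close>, whether or not
  \<open>mass_below\<close> jumps at the cuts.\<close>

lemma mass_between_cuts:
  assumes "cut \<delta> i < x" "x < y" "y < cut \<delta> (Suc i)"
  shows "mass_below y - mass_below x \<le> \<delta>"
proof -
  have x: "-pi < x" using assms(1) cut_bounds(1)[of \<delta> i] by linarith
  have y: "y < pi" using assms(3) cut_bounds(2)[of \<delta> "Suc i"] by linarith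
  have lo: "real i * \<delta> \<le> mass_below x"
  proof (cases "i = 0")
    case True
    then show ?thesis using mass_below_nonneg[of x] assms(2) y by simp
  next
    case False
    have "\<not> mass_below x \<le> real i * \<delta>"
    proof
      assume "mass_below x \<le> real i * \<delta>"
      then have "x \<in> {x \<in> {-pi..pi}. x = -pi \<or> mass_below x \<le> real i * \<delta>}"
        using x y assms(2) by auto
      from cSup_upper[OF this cut_set(2)] show False using False assms(1) by (simp add: cut_def)
    qed
    then show ?thesis by simp
  qed
  have "y < Sup {x \<in> {-pi..pi}. x = -pi \<or> mass_below x \<le> real (Suc i) * \<delta>}"
    using assms(3) unfolding cut_def by (simp only: if_False nat.distinct)
  then obtain z where z: "z \<in> {-pi..pi}" "z = -pi \<or> mass_below z \<le> real (Suc i) * \<delta>" "y < z"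
    using less_cSupD[of "{x \<in> {-pi..pi}. x = -pi \<or> mass_below x \<le> real (Suc i) * \<delta>}" y] cut_set(1)
    by blast
  have "mass_below y \<le> mass_below z"
    by (rule mass_below_mono) (use x assms(2) z in auto)
  also have "\<dots> \<le> real (Suc i) * \<delta>" using z x assms(2) by auto
  finally show ?thesis using lo by (simp add: algebra_simps)
qed

text \<open>On an interval that carries mass at most \<open>\<delta>\<close>, the exponential inequality provides a test function
  proportional to \<open>u\<^sup>2\<close>. It is cut down to compact subintervals, with the factor \<open>\<theta>\<close> that the shorter
  length requires, and the limit recovers the whole interval.\<close>

lemma potential_le_on_interval:
  assumes u: "continuous_on UNIV u" and ab: "-pi \<le> a" "a < b" "b \<le> pi" and s: "s > 0"
    and g: "gagliardo u a b \<le> ennreal s" and mean0: "integral {a..b} u = 0"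
    and mass: "\<And>x y. a < x \<Longrightarrow> x < y \<Longrightarrow> y < b \<Longrightarrow> mass_below y - mass_below x \<le> \<delta>"
    and f: "(\<lambda>t. V t * (u t)\<^sup>2) integrable_on {-pi..pi}"
  shows "integral {a..b} (\<lambda>t. V t * (u t)\<^sup>2) \<le> 64 * \<delta> * s"
proof -
  let ?f = "\<lambda>t. V t * (u t)\<^sup>2"
  have fi: "?f integrable_on {x..y}" if "-pi \<le> x" "y \<le> pi" for x y
    by (rule integrable_subinterval_real[OF f]) (use that in auto)
  define \<Phi> where "\<Phi> z = integral {a..z} ?f" for z
  have cont: "continuous_on {a..b} \<Phi>"
    unfolding \<Phi>_def by (rule indefinite_integral_continuous_1) (use fi ab in auto)
  have diff: "integral {x..y} ?f = \<Phi> y - \<Phi> x" if "a \<le> x" "x \<le> y" "y \<le> b" for x y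
    using Henstock_Kurzweil_Integration.integral_combine[of a x y ?f] that fi[of a y] ab
    by (simp add: \<Phi>_def)
  have inner: "(y - x) * (\<Phi> y - \<Phi> x) \<le> 64 * \<delta> * s * (b - a)" if xy: "a < x" "x < y" "y < b" for x y
  proof -
    define \<theta> where "\<theta> = (y - x) / (b - a)"
    have \<theta>: "0 \<le> \<theta>" "\<theta> \<le> 1" using xy ab by (auto simp: \<theta>_def)
    define z where "z t = (u t)\<^sup>2 / (64 * s)" for t
    have zc: "continuous_on UNIV z" unfolding z_def using s by (intro continuous_intros u) auto
    have z0: "0 \<le> z t" for t using s by (simp add: z_def)
    define h where "h t = \<theta> * z t * indicator {x<..<y} t" for t
    have hm: "h \<in> borel_measurable period_measure"
      unfolding h_def using borel_measurable_continuous_onI[OF zc] by (intro borel_measurable_period) auto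
    have h0: "0 \<le> h t" for t using \<theta> z0 by (simp add: h_def)
    have "compact (z ` {-pi..pi})"
      by (intro compact_continuous_image continuous_on_subset[OF zc]) auto
    then obtain C where C: "\<And>t. t \<in> {-pi..pi} \<Longrightarrow> z t \<le> C"
      using compact_imp_bounded bounded_has_Sup(1)[of "z ` {-pi..pi}"] by blast
    have hC: "h t \<le> C" if "t \<in> {-pi..pi}" for t
    proof -
      have "h t \<le> 1 * z t" using \<theta> z0 mult_right_mono[OF \<theta>(2) z0[of t]] by (auto simp: h_def split: split_indicator)
      then show ?thesis using C[OF that] by simp
    qed
    have "(\<integral>\<^sup>+t. ennreal (A_fun (h t)) \<partial>period_measure)
        \<le> (\<integral>\<^sup>+t. ennreal \<theta> * (ennreal (A_fun (z t)) * indicator {a<..<b} t) \<partial>period_measure)"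
    proof (rule nn_integral_mono)
      fix t
      show "ennreal (A_fun (h t)) \<le> ennreal \<theta> * (ennreal (A_fun (z t)) * indicator {a<..<b} t)"
        using A_fun_scale_le[OF \<theta> z0[of t]] xy \<theta>
        by (auto simp: h_def ennreal_leI A_fun_nonneg split: split_indicator simp flip: ennreal_mult)
    qed
    also have "\<dots> = ennreal \<theta> * (\<integral>\<^sup>+t. ennreal (A_fun (z t)) * indicator {a<..<b} t \<partial>period_measure)"
    proof (rule nn_integral_cmult)
      have [measurable]: "z \<in> borel_measurable period_measure"
        by (intro borel_measurable_period borel_measurable_continuous_onI zc)
      have [measurable]: "{a<..<b} \<in> sets period_measure"
        using ab by (auto simp: sets_restrict_space_iff)
      show "(\<lambda>t. ennreal (A_fun (z t)) * indicator {a<..<b} t) \<in> borel_measurable period_measure"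
        by measurable
    qed
    also have "(\<integral>\<^sup>+t. ennreal (A_fun (z t)) * indicator {a<..<b} t \<partial>period_measure)
        = ennreal (integral {a..b} (\<lambda>t. A_fun (z t)))"
      by (rule nn_integral_period) (use ab A_fun_nonneg in \<open>auto simp: A_fun_def intro!: continuous_intros zc\<close>)
    also have "ennreal \<theta> * ennreal (integral {a..b} (\<lambda>t. A_fun (z t))) \<le> ennreal \<theta> * ennreal ((b - a) / 8)"
      using orlicz_interval[OF u ab(2) s g mean0] by (intro mult_left_mono ennreal_leI) (auto simp: z_def)
    also have "\<dots> = ennreal ((y - x) / 8)"
      using \<theta> ab by (simp add: \<theta>_def flip: ennreal_mult)
    finally have hA: "(\<integral>\<^sup>+t. ennreal (A_fun (h t)) \<partial>period_measure) \<le> ennreal ((y - x) / 8)" .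
    have "h t = 0" if "t \<le> x \<or> y < t" for t using that by (auto simp: h_def)
    then have "h \<in> admissible x y"
      unfolding admissible_def using hm h0 hC hA by blast
    then have "mass_below x + (LINT t|period_measure. V t * h t) \<le> mass_below y"
      by (intro mass_below_add) (use ab xy in auto)
    then have le: "(LINT t|period_measure. V t * h t) \<le> \<delta>" using mass[OF xy] by linarith
    have "(LINT t|period_measure. V t * h t) = integral {-pi..pi} (\<lambda>t. V t * h t)"
      by (rule lebesgue_integral_eq_integral[OF integrable_V_bounded[OF hm h0 hC]]) auto
    also have "\<dots> = integral {-pi..pi} (\<lambda>t. if t \<in> {x<..<y} then \<theta> / (64 * s) * ?f t else 0)"
      by (intro integral_cong) (auto simp: h_def z_def)
    also have "\<dots> = integral {x<..<y} (\<lambda>t. \<theta> / (64 * s) * ?f t)"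
    proof -
      have "{x<..<y} \<inter> {-pi..pi} = {x<..<y}" using ab xy by auto
      then show ?thesis by (simp only: integral_restrict_Int)
    qed
    also have "\<dots> = \<theta> / (64 * s) * (\<Phi> y - \<Phi> x)"
      using xy diff[of x y] by (simp add: integral_open_interval_real)
    finally have "\<theta> / (64 * s) * (\<Phi> y - \<Phi> x) \<le> \<delta>" using le by simp
    then show ?thesis using s ab unfolding \<theta>_def by (simp add: field_simps)
  qed
  define H where "H e = (b - a - 2 * e) * (\<Phi> (b - e) - \<Phi> (a + e))" for e
  define d where "d = (b - a) / 3"
  have d: "d > 0" "3 * d = b - a" using ab by (simp_all add: d_def)
  have "continuous_on {0..d} H"
    unfolding H_def
    by (intro continuous_intros continuous_on_compose2[OF cont]) (use ab d in auto)
  then have "(H \<longlongrightarrow> H 0) (at 0 within {0..d})"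
    using d(1) by (simp add: continuous_on)
  then have lim: "(H \<longlongrightarrow> H 0) (at_right 0)" using d(1) by (simp add: at_within_Icc_at_right)
  have "\<forall>\<^sub>F e in at_right 0. H e \<le> 64 * \<delta> * s * (b - a)"
    unfolding eventually_at_right_field
  proof (intro exI[of _ d] conjI d(1) allI impI)
    fix e assume "0 < e" "e < d"
    then show "H e \<le> 64 * \<delta> * s * (b - a)"
      using inner[of "a + e" "b - e"] d by (simp add: H_def algebra_simps)
  qed
  then have "H 0 \<le> 64 * \<delta> * s * (b - a)"
    by (rule tendsto_upperbound[OF lim]) simp
  then show ?thesis
    using ab diff[of a b] by (simp add: H_def mult.commute)
qed

text \<open>The constant 320 is the product of the local constant 64 and the factor 5 of
  \<open>gagliardo_le_energy\<close>.\<close>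

lemma potential_le_energy:
  assumes u: "u \<in> Dom_qform" and \<delta>: "0 \<le> \<delta>" and N: "S \<le> real N * \<delta>" "0 < N"
    and mean0: "\<And>i. i < N \<Longrightarrow> integral {cut \<delta> i..cut \<delta> (Suc i)} u = 0"
  shows "(LINT t|period_measure. V t * (u t)\<^sup>2) \<le> 320 * \<delta> * fourier_energy u"
proof -
  let ?f = "\<lambda>t. V t * (u t)\<^sup>2"
  let ?p = "cut \<delta>"
  have uC: "u \<in> C_2pi" "u \<in> H_half_2pi" using u by (auto simp: Dom_qform_def)
  have uc: "continuous_on UNIV u" by (rule C_2pi_continuous[OF uC(1)])
  have fL: "integrable period_measure ?f"
    by (intro integrable_mult_continuous V_int continuous_intros continuous_on_subset[OF uc]) auto
  have f: "?f integrable_on {-pi..pi}" by (rule integrable_on_lebesgue_on[OF fL]) simp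
  have fi: "?f integrable_on {x..y}" if "-pi \<le> x" "y \<le> pi" for x y
    by (rule integrable_subinterval_real[OF f]) (use that in auto)
  define r where "r i = enn2real (gagliardo u (?p i) (?p (Suc i)))" for i
  have p0: "?p 0 = -pi" by (simp add: cut_def)
  have pN: "?p N = pi" by (rule cut_last[OF N])
  have mono: "?p i \<le> ?p (Suc i)" for i by (rule cut_Suc_mono[OF \<delta>])
  have p0le: "?p 0 \<le> ?p i" for i using cut_bounds(1) p0 by simp
  have gsum: "(\<Sum>i<n. gagliardo u (?p i) (?p (Suc i))) \<le> gagliardo u (-pi) (?p n)" for n
  proof (induction n)
    case (Suc n)
    have "(\<Sum>i<Suc n. gagliardo u (?p i) (?p (Suc i)))
        \<le> gagliardo u (-pi) (?p n) + gagliardo u (?p n) (?p (Suc n))"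
      using Suc by (simp add: add_right_mono)
    also have "\<dots> \<le> gagliardo u (-pi) (?p (Suc n))"
      by (intro gagliardo_add_le uc mono cut_bounds)
    finally show ?case .
  qed simp
  have E0: "0 \<le> fourier_energy u" using fourier_energy_ge_sum[OF uC(2), of "{}"] by simp
  have tot: "(\<Sum>i<N. gagliardo u (?p i) (?p (Suc i))) \<le> ennreal (5 * fourier_energy u)"
    using gsum[of N] gagliardo_le_energy[OF uC] unfolding pN by (rule order_trans)
  have gr: "gagliardo u (?p i) (?p (Suc i)) = ennreal (r i)" if "i < N" for i
  proof -
    have "gagliardo u (?p i) (?p (Suc i)) \<le> (\<Sum>i<N. gagliardo u (?p i) (?p (Suc i)))"
      by (rule member_le_sum) (use that in auto)
    also have "\<dots> < top" using tot by (rule le_less_trans) simp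
    finally show ?thesis by (simp add: r_def)
  qed
  have r0: "0 \<le> r i" for i by (simp add: r_def)
  have "ennreal (\<Sum>i<N. r i) = (\<Sum>i<N. gagliardo u (?p i) (?p (Suc i)))"
    using gr r0 by (simp add: sum_ennreal[symmetric] del: sum_ennreal)
  with tot have "ennreal (\<Sum>i<N. r i) \<le> ennreal (5 * fourier_energy u)" by simp
  then have rsum: "(\<Sum>i<N. r i) \<le> 5 * fourier_energy u" using E0 by (simp add: ennreal_le_iff)
  have loc: "integral {?p i..?p (Suc i)} ?f \<le> 64 * \<delta> * r i" if i: "i < N" for i
  proof (cases "?p i = ?p (Suc i)")
    case True
    then show ?thesis using r0[of i] \<delta> by simp
  next
    case False
    then have less: "?p i < ?p (Suc i)" using mono[of i] by simp
    show ?thesis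
    proof (rule field_le_epsilon)
      fix e :: real assume e: "e > 0"
      \<comment> \<open>The local bound needs a positive budget, also when \<open>u\<close> is constant on the interval.\<close>
      define s where "s = r i + e / (64 * \<delta> + 1)"
      have s: "s > 0" "r i \<le> s" using r0[of i] e \<delta> by (auto simp: s_def intro!: add_nonneg_pos)
      have "integral {?p i..?p (Suc i)} ?f \<le> 64 * \<delta> * s"
      proof (rule potential_le_on_interval[OF uc cut_bounds(1) less cut_bounds(2) s(1) _ mean0[OF i] _ f])
        show "gagliardo u (?p i) (?p (Suc i)) \<le> ennreal s" using gr[OF i] s by (simp add: ennreal_leI)
      qed (rule mass_between_cuts)
      also have "\<dots> \<le> 64 * \<delta> * r i + e"
        using \<delta> e by (simp add: s_def distrib_left field_simps)
      finally show "integral {?p i..?p (Suc i)} ?f \<le> 64 * \<delta> * r i + e" .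
    qed
  qed
  have "(\<Sum>i<n. integral {?p i..?p (Suc i)} ?f) = integral {-pi..?p n} ?f" for n
  proof (induction n)
    case 0
    then show ?case by (simp add: p0)
  next
    case (Suc n)
    have "integral {-pi..?p n} ?f + integral {?p n..?p (Suc n)} ?f = integral {-pi..?p (Suc n)} ?f"
      by (rule Henstock_Kurzweil_Integration.integral_combine) (use mono cut_bounds fi in auto)
    with Suc show ?case by simp
  qed
  from this[of N] have "integral {-pi..pi} ?f = (\<Sum>i<N. integral {?p i..?p (Suc i)} ?f)"
    by (simp add: pN)
  also have "\<dots> \<le> (\<Sum>i<N. 64 * \<delta> * r i)" by (rule sum_mono) (use loc in auto)
  also have "\<dots> = 64 * \<delta> * (\<Sum>i<N. r i)" by (simp add: sum_distrib_left)
  also have "\<dots> \<le> 64 * \<delta> * (5 * fourier_energy u)" using rsum \<delta> by (intro mult_left_mono) auto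
  finally show ?thesis
    using lebesgue_integral_eq_integral[OF fL] by simp
qed

text \<open>With \<open>\<delta> = 1 / 320\<close>, the energy dominates the potential.\<close>

lemma N_minus_upper_bound:
  assumes S0: "0 \<le> S"
  shows "ereal_of_enat (N_minus Dom_qform (qform V)) \<le> ereal (320 * S + 1)"
proof -
  define \<delta> :: real where "\<delta> = 1 / 320"
  define N where "N = nat \<lfloor>S / \<delta>\<rfloor> + 1"
  have N: "S / \<delta> \<le> real N" "real N \<le> S / \<delta> + 1"
    using S0 unfolding N_def \<delta>_def by auto linarith+
  have uc: "u integrable_on {x..y}" if "u \<in> Dom_qform" for u and x y :: real
    using that by (intro integrable_continuous_interval C_2pi_continuous) (auto simp: Dom_qform_def)
  have "N_minus Dom_qform (qform V) \<le> enat N"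
  proof (rule N_minus_le[where T = "\<lambda>i u. integral {cut \<delta> i..cut \<delta> (Suc i)} u"])
    fix u v i assume "u \<in> Dom_qform" "v \<in> Dom_qform"
    then show "integral {cut \<delta> i..cut \<delta> (Suc i)} (u + v)
        = integral {cut \<delta> i..cut \<delta> (Suc i)} u + integral {cut \<delta> i..cut \<delta> (Suc i)} v"
      by (simp only: plus_fun_def integral_add uc)
  next
    fix c u i
    show "integral {cut \<delta> i..cut \<delta> (Suc i)} (fun_scale c u) = c * integral {cut \<delta> i..cut \<delta> (Suc i)} u"
      by (simp add: fun_scale_def)
  next
    fix u assume u: "u \<in> Dom_qform" "\<And>i. i < N \<Longrightarrow> integral {cut \<delta> i..cut \<delta> (Suc i)} u = 0"
    have "(LINT t|period_measure. V t * (u t)\<^sup>2) \<le> 320 * \<delta> * fourier_energy u"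
      by (rule potential_le_energy[OF u(1) _ _ _ u(2)]) (use N in \<open>auto simp: \<delta>_def N_def\<close>)
    then show "0 \<le> qform V u" by (simp add: qform_def fourier_energy_def \<delta>_def)
  qed
  then have "ereal_of_enat (N_minus Dom_qform (qform V)) \<le> ereal_of_enat (enat N)"
    by (simp only: ereal_of_enat_le_iff)
  also have "\<dots> \<le> ereal (320 * S + 1)" using N by (simp add: \<delta>_def mult.commute)
  finally show ?thesis .
qed

end

lemma norm_B_test:
  assumes "g \<in> borel_measurable period_measure" "(\<integral>\<^sup>+t. ennreal (A_fun (g t)) \<partial>period_measure) \<le> 1"
  shows "ereal (LINT t|period_measure. V t * g t) \<le> norm_B V"
proof (cases "V \<in> orlicz_space period_measure B_fun")
  case True
  have "ereal (LINT t|period_measure. V t * g t) \<le> ereal \<bar>LINT t|period_measure. V t * g t\<bar>" by simp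
  also have "\<dots> \<le> norm_B V"
    using True assms unfolding norm_B_def orlicz_norm_def by (auto intro!: SUP_upper2[of g])
  finally show ?thesis .
qed (simp add: norm_B_def orlicz_norm_def)

theorem theorem1p2:
  shows "\<exists>C1 C2 :: real. C1 > 0 \<and> C2 > 0 \<and>
    (\<forall>V \<in> Lp_2pi 1. (AE t in lebesgue. V t \<ge> 0) \<longrightarrow>
       ereal (C1 * L1_norm_2pi V) \<le> ereal_of_enat (N_minus Dom_qform (qform V)) \<and>
       ereal_of_enat (N_minus Dom_qform (qform V)) \<le> ereal C2 * norm_B V + 1)"
proof (rule exI[of _ "1 / (2120 * 8193)"], rule exI[of _ 320], intro conjI ballI impI)
  fix V assume V: "V \<in> Lp_2pi 1" and nonneg: "AE t in lebesgue. V t \<ge> 0"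
  have m: "V \<in> borel_measurable lebesgue" using V by (simp add: Lp_2pi_def)
  have "integrable lebesgue (\<lambda>t. indicator {-pi..pi} t *\<^sub>R \<bar>V t\<bar>)"
    using V by (auto simp: Lp_2pi_def set_integrable_def)
  then have "integrable period_measure (\<lambda>t. \<bar>V t\<bar>)"
    by (simp add: integrable_restrict_space)
  moreover have Vm: "V \<in> borel_measurable period_measure"
    using m by (rule measurable_restrict_space1)
  ultimately have Vi: "integrable period_measure V"
    by (rule integrable_abs_cancel)
  have Vn: "AE t in period_measure. 0 \<le> V t"
    using nonneg by (auto simp: AE_restrict_space_iff)
  show "ereal (1 / (2120 * 8193) * L1_norm_2pi V) \<le> ereal_of_enat (N_minus Dom_qform (qform V))"
  proof -
    have "L1_norm_2pi V = (LINT t|period_measure. V t)"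
      unfolding L1_norm_2pi_def
      by (rule Bochner_Integration.integral_cong_AE) (use Vm Vn in auto)
    then show ?thesis using N_minus_lower_bound[OF Vi Vn] by simp
  qed
  have pos: "0 \<le> norm_B V" using norm_B_test[of "\<lambda>_. 0" V] by (simp add: zero_ereal_def)
  show "ereal_of_enat (N_minus Dom_qform (qform V)) \<le> ereal 320 * norm_B V + 1"
  proof (cases "norm_B V")
    case (real S)
    interpret orlicz_bounded V S
      by unfold_locales (use Vi Vn norm_B_test[of _ V] real in auto)
    have "0 \<le> S" using pos real by simp
    from N_minus_upper_bound[OF this] show ?thesis using real by (simp add: one_ereal_def)
  qed (use pos in auto)
qed simp_all

end
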